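(* For every total polynomial search problem $R$, there exists a consistent universal sentence $\Phi$ (of first-order logic without equality) such that $R$ is many-one polynomially reducible to $HCS(\Phi)$.
   Context: We work in first-order logic without equality (a binary symbol $=$ may occur as an ordinary relation symbol); constants and function symbols are allowed. For a sentence in prenex form $\forall\bar{x}\exists\bar{y}\forall\bar{z}\exists\bar{u}\dots\phi(\bar{x},\bar{y},\bar{z},\bar{u},\dots)$ its skolemization is $\forall\bar{x}\forall\bar{z}\dots\phi(\bar{x},\bar{f}(\bar{x}),\bar{z},\bar{g}(\bar{x},\bar{z}),\dots)$ with new function symbols $\bar f,\bar g,\dots$; for a conjunction $\bigwedge_i\Phi_i$ of prenex sentences the skolemization is the conjunction of the skolemizations (with distinct new function symbols for each conjunct). Herbrand Consistency Search $HCS(\Phi)$, for a consistent sentence $\Phi$ that is a conjunction of prenex sentences whose skolemization has open matrix $\phi(x_1,\dots,x_k)$, is the following search problem: given terms $\tau_{ij}$ ($i=1,\dots,n$, $j=1,\dots,k$) in the language of $\phi$, find a truth assignment to the atomic formulas occurring in $\phi(\tau_{i1},\dots,\tau_{ik})$, $i=1,\dots,n$, that makes the propositional formula $\bigwedge_{i=1}^n\phi(\tau_{i1},\dots,\tau_{ik})$ true (such an assignment exists by Herbrand's theorem since $\Phi$ is consistent). A total polynomial search problem is given by a binary relation $R(x,y)$ on binary strings decidable in polynomial time and a polynomial $p$ such that for every $x$ there is $y$ with $|y|\le p(|x|)$ and $R(x,y)$; the task is, given $x$, to find such a $y$. $R$ is polynomially reducible to a search problem $S$ if $R$ can be solved in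 polynomial time using an oracle returning solutions of $S$; it is many-one polynomially reducible if this can be done with a single oracle query. *)

theory Defs
  imports "HOL-Computational_Algebra.Polynomial"
begin

section \<open>Polynomial-time computation\<close>

text \<open>Deterministic multi-tape Turing machines with one-way infinite tapes. The tape symbols are
  numbers: 0 is the blank, 1 marks the left end of the tape, 2 and 3 stand for the bits 0 and 1,
  and larger symbols are at the disposal of the machine.\<close>

datatype move = MLeft | MStay | MRight

record machine =
  num_tapes :: nat
  num_symbols :: nat
  num_states :: nat
  trans :: "nat \<Rightarrow> nat list \<Rightarrow> nat \<times> (nat \<times> move) list"

text \<open>The working states are those below \<open>num_states\<close>; the number \<open>num_states\<close> itself serves as
  the halting state. The start state is 0.\<close>

definition wf_machine :: "machine \<Rightarrow> bool" where
  "wf_machine M \<longleftrightarrow> num_symbols M \<ge> 4 \<and>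
     (\<forall>q ss. q < num_states M \<and> length ss = num_tapes M \<and> set ss \<subseteq> {..<num_symbols M} \<longrightarrow>
        fst (trans M q ss) \<le> num_states M \<and>
        length (snd (trans M q ss)) = num_tapes M \<and>
        (\<forall>(s, d) \<in> set (snd (trans M q ss)). s < num_symbols M))"

type_synonym tape = "(nat \<Rightarrow> nat) \<times> nat"  \<comment> \<open>contents and head position\<close>
type_synonym config = "nat \<times> tape list"

definition read_tape :: "tape \<Rightarrow> nat" where
  "read_tape t = fst t (snd t)"

text \<open>In the leftmost cell a left move leaves the head where it is (truncated subtraction).\<close>

definition move_head :: "move \<Rightarrow> nat \<Rightarrow> nat" where
  "move_head d h = (case d of MLeft \<Rightarrow> h - 1 | MStay \<Rightarrow> h | MRight \<Rightarrow> Suc h)"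

definition act_tape :: "nat \<times> move \<Rightarrow> tape \<Rightarrow> tape" where
  "act_tape a t = ((fst t)(snd t := fst a), move_head (snd a) (snd t))"

definition step :: "machine \<Rightarrow> config \<Rightarrow> config" where
  "step M c =
     (if fst c \<ge> num_states M then c
      else let (q, as) = trans M (fst c) (map read_tape (snd c))
           in (q, map2 act_tape as (snd c)))"

definition tape_of :: "bool list \<Rightarrow> nat \<Rightarrow> nat" where
  "tape_of w i = (if i = 0 then 1 else if i \<le> length w then (if w ! (i - 1) then 3 else 2) else 0)"

definition start_config :: "machine \<Rightarrow> bool list list \<Rightarrow> config" where
  "start_config M ws =
     (0, map (\<lambda>i. (tape_of (if i < length ws then ws ! i else []), 0)) [0..<num_tapes M])"

text \<open>An \<open>n\<close>-ary function on binary strings, given as a function on lists of length \<open>n\<close>. The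
  inputs are on the tapes \<open>0, \<dots>, n - 1\<close>, the output is on tape \<open>n\<close>, and there may be any number
  of further work tapes. The running time is polynomial in the total length of the inputs.\<close>

definition polytime :: "nat \<Rightarrow> (bool list list \<Rightarrow> bool list) \<Rightarrow> bool" where
  "polytime n F \<longleftrightarrow>
     (\<exists>M (b :: nat poly). wf_machine M \<and> n < num_tapes M \<and>
        (\<forall>ws. length ws = n \<longrightarrow>
           (\<exists>t \<le> poly b (sum_list (map length ws)).
              \<exists>ts. (step M ^^ t) (start_config M ws) = (num_states M, ts) \<and>
                   fst (ts ! n) = tape_of (F ws))))"


section \<open>Search problems\<close>

text \<open>A search problem is given by its solution relation; its instances are the strings that
  have a solution.\<close>

type_synonym search_problem = "bool list \<Rightarrow> bool list \<Rightarrow> bool"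

definition total_polynomial_search :: "search_problem \<Rightarrow> nat poly \<Rightarrow> bool" where
  "total_polynomial_search R p \<longleftrightarrow>
     polytime 2 (\<lambda>ws. [R (ws ! 0) (ws ! 1)]) \<and>
     (\<forall>x. \<exists>y. length y \<le> poly p (length x) \<and> R x y)"

definition bounded_search :: "search_problem \<Rightarrow> nat poly \<Rightarrow> search_problem" where
  "bounded_search R p x y \<longleftrightarrow> length y \<le> poly p (length x) \<and> R x y"

text \<open>The query computed from an instance must itself be an instance, that is, have a solution;
  and every answer to it has to be usable.\<close>

definition many_one_reducible :: "search_problem \<Rightarrow> search_problem \<Rightarrow> bool" where
  "many_one_reducible R S \<longleftrightarrow>
     (\<exists>f g. polytime 1 (\<lambda>ws. f (ws ! 0)) \<and> polytime 2 (\<lambda>ws. g (ws ! 0) (ws ! 1)) \<and>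
        (\<forall>x. (\<exists>y. R x y) \<longrightarrow>
           (\<exists>v. S (f x) v) \<and> (\<forall>v. S (f x) v \<longrightarrow> R x (g x v))))"


section \<open>First-order logic without equality\<close>

text \<open>Bound variables are de Bruijn indices. A function or relation symbol is a name together with
  an arity, the arity being the number of arguments of the occurrence; constants have arity 0.\<close>

datatype trm = Var nat | Fun nat "trm list"

datatype fm =
    Falsum
  | Pred nat "trm list"
  | Imp fm fm
  | And fm fm
  | Or fm fm
  | All fm
  | Ex fm

primrec subst_trm :: "(nat \<Rightarrow> trm) \<Rightarrow> trm \<Rightarrow> trm" where
  "subst_trm \<sigma> (Var i) = \<sigma> i"
| "subst_trm \<sigma> (Fun f ts) = Fun f (map (subst_trm \<sigma>) ts)"

definition lift_subst :: "(nat \<Rightarrow> trm) \<Rightarrow> nat \<Rightarrow> trm" where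
  "lift_subst \<sigma> = case_nat (Var 0) (\<lambda>i. subst_trm (\<lambda>j. Var (Suc j)) (\<sigma> i))"

primrec subst :: "(nat \<Rightarrow> trm) \<Rightarrow> fm \<Rightarrow> fm" where
  "subst \<sigma> Falsum = Falsum"
| "subst \<sigma> (Pred r ts) = Pred r (map (subst_trm \<sigma>) ts)"
| "subst \<sigma> (Imp p q) = Imp (subst \<sigma> p) (subst \<sigma> q)"
| "subst \<sigma> (And p q) = And (subst \<sigma> p) (subst \<sigma> q)"
| "subst \<sigma> (Or p q) = Or (subst \<sigma> p) (subst \<sigma> q)"
| "subst \<sigma> (All p) = All (subst (lift_subst \<sigma>) p)"
| "subst \<sigma> (Ex p) = Ex (subst (lift_subst \<sigma>) p)"

abbreviation lift :: "fm \<Rightarrow> fm" where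
  "lift \<equiv> subst (\<lambda>i. Var (Suc i))"

abbreviation inst :: "trm \<Rightarrow> fm \<Rightarrow> fm" where
  "inst t \<equiv> subst (case_nat t Var)"

primrec closed_trm :: "nat \<Rightarrow> trm \<Rightarrow> bool" where
  "closed_trm n (Var i) \<longleftrightarrow> i < n"
| "closed_trm n (Fun f ts) \<longleftrightarrow> list_all (closed_trm n) ts"

primrec closed_fm :: "nat \<Rightarrow> fm \<Rightarrow> bool" where
  "closed_fm n Falsum \<longleftrightarrow> True"
| "closed_fm n (Pred r ts) \<longleftrightarrow> list_all (closed_trm n) ts"
| "closed_fm n (Imp p q) \<longleftrightarrow> closed_fm n p \<and> closed_fm n q"
| "closed_fm n (And p q) \<longleftrightarrow> closed_fm n p \<and> closed_fm n q"
| "closed_fm n (Or p q) \<longleftrightarrow> closed_fm n p \<and> closed_fm n q"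
| "closed_fm n (All p) \<longleftrightarrow> closed_fm (Suc n) p"
| "closed_fm n (Ex p) \<longleftrightarrow> closed_fm (Suc n) p"

definition sentence :: "fm \<Rightarrow> bool" where
  "sentence p \<longleftrightarrow> closed_fm 0 p"

text \<open>Natural deduction for classical logic.\<close>

inductive derives :: "fm list \<Rightarrow> fm \<Rightarrow> bool"  (infix "\<turnstile>" 50) where
  Assm: "p \<in> set G \<Longrightarrow> G \<turnstile> p"
| Class: "Imp p Falsum # G \<turnstile> Falsum \<Longrightarrow> G \<turnstile> p"
| ImpI: "p # G \<turnstile> q \<Longrightarrow> G \<turnstile> Imp p q"
| ImpE: "G \<turnstile> Imp p q \<Longrightarrow> G \<turnstile> p \<Longrightarrow> G \<turnstile> q"
| AndI: "G \<turnstile> p \<Longrightarrow> G \<turnstile> q \<Longrightarrow> G \<turnstile> And p q"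
| AndE1: "G \<turnstile> And p q \<Longrightarrow> G \<turnstile> p"
| AndE2: "G \<turnstile> And p q \<Longrightarrow> G \<turnstile> q"
| OrI1: "G \<turnstile> p \<Longrightarrow> G \<turnstile> Or p q"
| OrI2: "G \<turnstile> q \<Longrightarrow> G \<turnstile> Or p q"
| OrE: "G \<turnstile> Or p q \<Longrightarrow> p # G \<turnstile> r \<Longrightarrow> q # G \<turnstile> r \<Longrightarrow> G \<turnstile> r"
| AllI: "map lift G \<turnstile> p \<Longrightarrow> G \<turnstile> All p"
| AllE: "G \<turnstile> All p \<Longrightarrow> G \<turnstile> inst t p"
| ExI: "G \<turnstile> inst t p \<Longrightarrow> G \<turnstile> Ex p"
| ExE: "G \<turnstile> Ex p \<Longrightarrow> p # map lift G \<turnstile> lift q \<Longrightarrow> G \<turnstile> q"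

definition consistent :: "fm \<Rightarrow> bool" where
  "consistent p \<longleftrightarrow> \<not> [p] \<turnstile> Falsum"

primrec quantifier_free :: "fm \<Rightarrow> bool" where
  "quantifier_free Falsum \<longleftrightarrow> True"
| "quantifier_free (Pred r ts) \<longleftrightarrow> True"
| "quantifier_free (Imp p q) \<longleftrightarrow> quantifier_free p \<and> quantifier_free q"
| "quantifier_free (And p q) \<longleftrightarrow> quantifier_free p \<and> quantifier_free q"
| "quantifier_free (Or p q) \<longleftrightarrow> quantifier_free p \<and> quantifier_free q"
| "quantifier_free (All p) \<longleftrightarrow> False"
| "quantifier_free (Ex p) \<longleftrightarrow> False"

fun universal :: "fm \<Rightarrow> bool" where
  "universal (All p) \<longleftrightarrow> universal p"
| "universal p \<longleftrightarrow> quantifier_free p"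


section \<open>Skolemization\<close>

primrec funs_trm :: "trm \<Rightarrow> (nat \<times> nat) set" where
  "funs_trm (Var i) = {}"
| "funs_trm (Fun f ts) = insert (f, length ts) (\<Union> (set (map funs_trm ts)))"

primrec funs :: "fm \<Rightarrow> (nat \<times> nat) set" where
  "funs Falsum = {}"
| "funs (Pred r ts) = \<Union> (set (map funs_trm ts))"
| "funs (Imp p q) = funs p \<union> funs q"
| "funs (And p q) = funs p \<union> funs q"
| "funs (Or p q) = funs p \<union> funs q"
| "funs (All p) = funs p"
| "funs (Ex p) = funs p"

definition fresh :: "fm \<Rightarrow> nat" where
  "fresh p = Suc (Max (insert 0 (fst ` funs p)))"

text \<open>The open matrix of the skolemization of a prenex formula. Here \<open>m\<close> is the next unused
  function name, \<open>k\<close> the next unused variable, \<open>us\<close> the universal variables quantified so far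
  (outermost first), and \<open>ts\<close> the terms replacing the bound variables (the \<open>i\<close>-th entry replaces
  the de Bruijn index \<open>i\<close>). The updated values of \<open>m\<close> and \<open>k\<close> are returned together with the
  matrix. In the matrix \<open>Var 0, Var 1, \<dots>\<close> are the variables \<open>x\<^sub>1, x\<^sub>2, \<dots>\<close> in the order of their
  quantifiers.\<close>

fun skolem_prenex :: "nat \<Rightarrow> nat \<Rightarrow> trm list \<Rightarrow> trm list \<Rightarrow> fm \<Rightarrow> nat \<times> nat \<times> fm" where
  "skolem_prenex m k us ts (All p) = skolem_prenex m (Suc k) (us @ [Var k]) (Var k # ts) p"
| "skolem_prenex m k us ts (Ex p) = skolem_prenex (Suc m) k us (Fun m us # ts) p"
| "skolem_prenex m k us ts p = (m, k, subst ((!) ts) p)"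

text \<open>For a conjunction of prenex sentences, with distinct Skolem functions and distinct
  variables for distinct conjuncts.\<close>

fun skolem_conj :: "nat \<Rightarrow> nat \<Rightarrow> fm \<Rightarrow> nat \<times> nat \<times> fm" where
  "skolem_conj m k (And p q) =
     (let (m', k', p') = skolem_conj m k p;
          (m'', k'', q') = skolem_conj m' k' q
      in (m'', k'', And p' q'))"
| "skolem_conj m k p = skolem_prenex m k [] [] p"

definition skolem_matrix :: "fm \<Rightarrow> fm" where
  "skolem_matrix p = snd (snd (skolem_conj (fresh p) 0 p))"

definition num_vars :: "fm \<Rightarrow> nat" where
  "num_vars p = fst (snd (skolem_conj (fresh p) 0 p))"


section \<open>Herbrand consistency search\<close>

text \<open>Truth of quantifier-free formulas under an assignment to the atomic formulas.\<close>

primrec (nonexhaustive) truth :: "(nat \<times> trm list \<Rightarrow> bool) \<Rightarrow> fm \<Rightarrow> bool" where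
  "truth \<alpha> Falsum \<longleftrightarrow> False"
| "truth \<alpha> (Pred r ts) \<longleftrightarrow> \<alpha> (r, ts)"
| "truth \<alpha> (Imp p q) \<longleftrightarrow> (truth \<alpha> p \<longrightarrow> truth \<alpha> q)"
| "truth \<alpha> (And p q) \<longleftrightarrow> truth \<alpha> p \<and> truth \<alpha> q"
| "truth \<alpha> (Or p q) \<longleftrightarrow> truth \<alpha> p \<or> truth \<alpha> q"

primrec (nonexhaustive) atoms :: "fm \<Rightarrow> (nat \<times> trm list) list" where
  "atoms Falsum = []"
| "atoms (Pred r ts) = [(r, ts)]"
| "atoms (Imp p q) = atoms p @ atoms q"
| "atoms (And p q) = atoms p @ atoms q"
| "atoms (Or p q) = atoms p @ atoms q"

text \<open>Self-delimiting binary codes. The empty list of binary digits represents 0; the least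
  significant digit comes first.\<close>

fun bits :: "nat \<Rightarrow> bool list" where
  "bits n = (if n = 0 then [] else odd n # bits (n div 2))"

declare bits.simps [simp del]

definition enc_list :: "bool list list \<Rightarrow> bool list" where
  "enc_list ws = concat (map ((#) True) ws) @ [False]"

definition enc_nat :: "nat \<Rightarrow> bool list" where
  "enc_nat n = enc_list (map (\<lambda>b. [b]) (bits n))"

primrec enc_trm :: "trm \<Rightarrow> bool list" where
  "enc_trm (Var i) = False # enc_nat i"
| "enc_trm (Fun f ts) = True # enc_nat f @ enc_list (map enc_trm ts)"

definition enc_instance :: "trm list list \<Rightarrow> bool list" where
  "enc_instance \<tau>s = enc_list (map (\<lambda>ts. enc_list (map enc_trm ts)) \<tau>s)"

definition hcs_instance :: "fm \<Rightarrow> trm list list \<Rightarrow> bool" where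
  "hcs_instance \<Phi> \<tau>s \<longleftrightarrow>
     (\<forall>ts \<in> set \<tau>s. length ts = num_vars \<Phi> \<and>
        (\<forall>t \<in> set ts. funs_trm t \<subseteq> funs (skolem_matrix \<Phi>)))"

definition hcs_formulas :: "fm \<Rightarrow> trm list list \<Rightarrow> fm list" where
  "hcs_formulas \<Phi> \<tau>s = map (\<lambda>ts. subst ((!) ts) (skolem_matrix \<Phi>)) \<tau>s"

text \<open>A truth assignment to the occurring atomic formulas is written as a string with one bit for
  each of them, listed without repetition in the order of their last occurrences. The problem
  is meant for \<open>\<Phi>\<close> a consistent conjunction of prenex sentences.\<close>

definition HCS :: "fm \<Rightarrow> search_problem" where
  "HCS \<Phi> u v \<longleftrightarrow>
     (\<exists>\<tau>s \<alpha>. hcs_instance \<Phi> \<tau>s \<and> u = enc_instance \<tau>s \<and>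
        v = map \<alpha> (remdups (concat (map atoms (hcs_formulas \<Phi> \<tau>s)))) \<and>
        (\<forall>p \<in> set (hcs_formulas \<Phi> \<tau>s). truth \<alpha> p))"

end

theory Submission
  imports Defs "HOL-Library.Countable" "HOL-Library.Sublist"
begin

text \<open>The sentence describes the computation of the decider of \<open>R\<close> on \<open>(x, y)\<close>, where times are terms
  \<open>s (s (\<dots> x))\<close> over a term for the string \<open>x\<close> and cells are numerals. The bits of \<open>y\<close> are left to the
  truth assignment, and the sentence only forbids the decider to answer 0. The length of \<open>y\<close> is
  controlled by a second machine, a clock, which writes \<open>p(|x|)\<close> in unary; by means of it the
  bound becomes expressible by local conditions. Choosing a short solution \<open>y\<close> for every \<open>x\<close> gives a
  model, whence consistency. Conversely, the instances of the matrix for polynomially many times and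
  cells force any satisfying assignment to follow the two computations until they halt, so that
  the bits guessed by the assignment form a solution.

  The only computations to be carried out by Turing machines for the reduction are writing down
  these instances, which is done by a loop program, and reading \<open>y\<close> off the assignment. The latter is
  easy because additional instances with fresh copies of the guessing predicates put the bits of \<open>y\<close>
  at the beginning of the assignment string.\<close>

section \<open>Loop programs\<close>

text \<open>The sentence is fixed while the input varies, so the input has to enter through the
  terms: a string is a closed term, and the times of its computation are built on top of that term.
  Thus one model can hold the computations on all inputs at once, and no existential quantifier is
  needed to provide times or cells. Without equality a clause cannot test whether a cell is the one
  under the head; this information is kept in predicates and updated through zero and successor
  alone. The obstacle is that every satisfying assignment has to be usable, not only the intended
  one. A guess could be so long that the decider outlasts the polynomially many instances, and then
  nothing would be enforced. Bounding the guess is therefore a task of the sentence itself. Since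
  the halting time of the clock is not known in advance, the guess is made to persist along the
  times until it meets the output of the clock.\<close>

text \<open>Variables hold strings. The loop \<open>For v c d\<close> runs through the bits of \<open>v\<close> from the last one
  to the first, executing \<open>d\<close> for 1 and \<open>c\<close> for 0; in this direction the machine needs no rewinding
  and stops at the left end marker.\<close>

datatype cmd =
    Skip
  | App nat bool
  | Clear nat
  | Seq cmd cmd
  | For nat cmd cmd

primrec exec :: "cmd \<Rightarrow> (nat \<Rightarrow> bool list) \<Rightarrow> (nat \<Rightarrow> bool list)" where
  "exec Skip \<sigma> = \<sigma>"
| "exec (App v b) \<sigma> = \<sigma>(v := \<sigma> v @ [b])"
| "exec (Clear v) \<sigma> = \<sigma>(v := [])"
| "exec (Seq c d) \<sigma> = exec d (exec c \<sigma>)"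
| "exec (For v c d) \<sigma> = foldr (\<lambda>b. if b then exec d else exec c) (\<sigma> v) \<sigma>"

primrec vars :: "cmd \<Rightarrow> nat set" where
  "vars Skip = {}"
| "vars (App v b) = {v}"
| "vars (Clear v) = {v}"
| "vars (Seq c d) = vars c \<union> vars d"
| "vars (For v c d) = insert v (vars c \<union> vars d)"

primrec admissible :: "cmd \<Rightarrow> bool" where
  "admissible Skip \<longleftrightarrow> True"
| "admissible (App v b) \<longleftrightarrow> True"
| "admissible (Clear v) \<longleftrightarrow> True"
| "admissible (Seq c d) \<longleftrightarrow> admissible c \<and> admissible d"
| "admissible (For v c d) \<longleftrightarrow> admissible c \<and> admissible d \<and> v \<notin> vars c \<and> v \<notin> vars d"

text \<open>The exact number of steps of the compiled code, so that correctness can be an equation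
  between configurations. Beyond the sweeps, 3 steps pay for leaving the marker, turning at the
  blank and exiting at the marker; each iteration of a loop adds 2, for the dispatch and the
  return.\<close>

primrec steps :: "cmd \<Rightarrow> (nat \<Rightarrow> bool list) \<Rightarrow> nat" where
  "steps Skip \<sigma> = 0"
| "steps (App v b) \<sigma> = 2 * length (\<sigma> v) + 3"
| "steps (Clear v) \<sigma> = 2 * length (\<sigma> v) + 3"
| "steps (Seq c d) \<sigma> = steps c \<sigma> + steps d (exec c \<sigma>)"
| "steps (For v c d) \<sigma> =
     length (\<sigma> v) + 3 +
     snd (foldr (\<lambda>b (\<rho>, n). ((if b then exec d else exec c) \<rho>, n + (if b then steps d else steps c) \<rho> + 2))
           (\<sigma> v) (\<sigma>, 0))"

section \<open>Compilation of loop programs, one tape per variable\<close>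

type_synonym instr = "nat \<times> (nat \<Rightarrow> nat \<times> move \<times> nat)"

abbreviation bit_symbol :: "bool \<Rightarrow> nat" where
  "bit_symbol b \<equiv> (if b then 3 else 2)"

primrec code_size :: "cmd \<Rightarrow> nat" where
  "code_size Skip = 0"
| "code_size (App v b) = 2"
| "code_size (Clear v) = 2"
| "code_size (Seq c d) = code_size c + code_size d"
| "code_size (For v c d) = code_size c + code_size d + 4"

text \<open>Jump targets are absolute: a block at address \<open>q\<close> exits at
  \<open>q + code_size c\<close>, the first address after it. Hence sequencing is concatenation, and
  running off the end of the program is halting.\<close>

primrec compile :: "cmd \<Rightarrow> nat \<Rightarrow> instr list" where
  "compile Skip q = []"
| "compile (App v b) q =
     [(v, \<lambda>s. if s = 0 then (bit_symbol b, MLeft, q + 1) else (s, MRight, q)),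
      (v, \<lambda>s. if s = 1 then (s, MStay, q + 2) else (s, MLeft, q + 1))]"
| "compile (Clear v) q =
     [(v, \<lambda>s. if s = 0 then (s, MLeft, q + 1) else (s, MRight, q)),
      (v, \<lambda>s. if s = 1 then (s, MStay, q + 2) else (0, MLeft, q + 1))]"
| "compile (Seq c d) q = compile c q @ compile d (q + code_size c)"
| "compile (For v c d) q =
     [(v, \<lambda>s. if s = 0 then (s, MLeft, q + 1) else (s, MRight, q)),
      (v, \<lambda>s. if s = 1 then (s, MStay, q + code_size c + code_size d + 4)
           else if s = 2 then (s, MStay, q + 2) else (s, MStay, q + code_size c + 3))] @
     compile c (q + 2) @ [(v, \<lambda>s. (s, MLeft, q + 1))] @
     compile d (q + code_size c + 3) @ [(v, \<lambda>s. (s, MLeft, q + 1))]"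

definition instr_trans :: "instr \<Rightarrow> nat list \<Rightarrow> nat \<times> (nat \<times> move) list" where
  "instr_trans c ss =
     (let (a, d, q) = snd c (ss ! fst c)
      in (q, (map (\<lambda>s. (s, MStay)) ss)[fst c := (a, d)]))"

definition code_machine :: "nat \<Rightarrow> instr list \<Rightarrow> machine" where
  "code_machine k P = \<lparr>num_tapes = k, num_symbols = 4, num_states = length P,
     trans = (\<lambda>q. instr_trans (P ! q))\<rparr>"

lemma length_compile [simp]: "length (compile c q) = code_size c"
  by (induction c arbitrary: q) auto

lemma act_tape_stay [simp]: "act_tape (read_tape t, MStay) t = t"
  by (simp add: act_tape_def read_tape_def move_head_def)

lemma step_code_machine:
  assumes "q < length P" "P ! q = (v, h)" "v < length ts" "h (read_tape (ts ! v)) = (a, d, q')"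
  shows "step (code_machine k P) (q, ts) = (q', ts[v := act_tape (a, d) (ts ! v)])"
proof -
  have "map2 act_tape ((map (\<lambda>s. (s, MStay)) (map read_tape ts))[v := (a, d)]) ts =
        ts[v := act_tape (a, d) (ts ! v)]"
    using assms by (intro nth_equalityI) (auto simp: nth_list_update)
  then show ?thesis
    using assms by (simp add: step_def code_machine_def instr_trans_def)
qed

lemma read_tape_of [simp]:
  "read_tape (tape_of w, 0) = 1"
  "i < length w \<Longrightarrow> read_tape (tape_of w, Suc i) = bit_symbol (w ! i)"
  "length w \<le> i \<Longrightarrow> read_tape (tape_of w, Suc i) = 0"
  by (auto simp: read_tape_def tape_of_def)

lemma funpow_stepsI:
  assumes "(f ^^ m) x = y" "(f ^^ n) y = z" "k = m + n"
  shows "(f ^^ k) x = z"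
  using assms by (simp add: funpow_add add.commute[of m])

lemma funpow_step_first: "f x = y \<Longrightarrow> (f ^^ n) y = z \<Longrightarrow> (f ^^ Suc n) x = z"
  by (simp add: funpow_swap1)

context
  fixes k :: nat and P :: "instr list" and q v q' :: nat and h :: "nat \<Rightarrow> nat \<times> move \<times> nat"
  assumes instr: "q < length P" "P ! q = (v, h)"
begin

lemma scan_right:
  assumes "v < length ts" "ts ! v = (tape_of w, j)" "j \<le> Suc (length w)"
    and "\<And>s. s \<noteq> 0 \<Longrightarrow> h s = (s, MRight, q)"
  shows "(step (code_machine k P) ^^ (Suc (length w) - j)) (q, ts) =
         (q, ts[v := (tape_of w, Suc (length w))])"
  using assms
proof (induction "Suc (length w) - j" arbitrary: j ts)
  case 0
  then show ?case by simp (metis list_update_id)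
next
  case (Suc n)
  have nz: "read_tape (ts ! v) \<noteq> 0"
    using Suc by (cases j) auto
  have a: "step (code_machine k P) (q, ts) = (q, ts[v := (tape_of w, Suc j)])"
  proof -
    have "step (code_machine k P) (q, ts) =
          (q, ts[v := act_tape (read_tape (ts ! v), MRight) (ts ! v)])"
      using Suc.prems nz by (intro step_code_machine[OF instr]) auto
    then show ?thesis
      using Suc.prems by (simp add: act_tape_def read_tape_def move_head_def)
  qed
  have "(step (code_machine k P) ^^ (Suc (length w) - Suc j)) (q, ts[v := (tape_of w, Suc j)]) =
         (q, (ts[v := (tape_of w, Suc j)])[v := (tape_of w, Suc (length w))])"
    using Suc by (intro Suc.hyps) auto
  from funpow_step_first[of "step (code_machine k P)", OF a this] show ?case
    using Suc.hyps by (simp add: Suc_diff_le)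
qed

lemma scan_left:
  assumes "v < length ts" "ts ! v = (tape_of w, j)" "j \<le> length w"
    and "\<And>s. s \<noteq> 1 \<Longrightarrow> h s = (s, MLeft, q)"
  shows "(step (code_machine k P) ^^ j) (q, ts) = (q, ts[v := (tape_of w, 0)])"
  using assms
proof (induction j arbitrary: ts)
  case 0
  then show ?case by simp (metis list_update_id)
next
  case (Suc j)
  have nz: "read_tape (ts ! v) \<noteq> 1"
    using Suc by auto
  have a: "step (code_machine k P) (q, ts) = (q, ts[v := (tape_of w, j)])"
  proof -
    have "step (code_machine k P) (q, ts) =
          (q, ts[v := act_tape (read_tape (ts ! v), MLeft) (ts ! v)])"
      using Suc.prems nz by (intro step_code_machine[OF instr]) auto
    then show ?thesis
      using Suc.prems by (simp add: act_tape_def read_tape_def move_head_def)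
  qed
  have "(step (code_machine k P) ^^ j) (q, ts[v := (tape_of w, j)]) =
         (q, (ts[v := (tape_of w, j)])[v := (tape_of w, 0)])"
    using Suc by (intro Suc.IH) auto
  from funpow_step_first[of "step (code_machine k P)", OF a this] show ?case
    by simp
qed

text \<open>Erasing from the right keeps the contents of the form \<open>tape_of\<close> of a
  shorter word at every moment, hence the reverse induction.\<close>

lemma erase_left:
  assumes "v < length ts" "ts ! v = (tape_of w, length w)"
    and "\<And>s. s \<noteq> 1 \<Longrightarrow> h s = (0, MLeft, q)"
  shows "(step (code_machine k P) ^^ length w) (q, ts) = (q, ts[v := (tape_of [], 0)])"
  using assms
proof (induction w arbitrary: ts rule: rev_induct)
  case Nil
  then show ?case by simp (metis list_update_id)
next
  case (snoc b w)
  have nz: "read_tape (ts ! v) \<noteq> 1"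
    using snoc by auto
  have "(tape_of (w @ [b]))(Suc (length w) := 0) = tape_of w"
    by (auto simp: tape_of_def fun_eq_iff nth_append)
  then have a: "step (code_machine k P) (q, ts) = (q, ts[v := (tape_of w, length w)])"
    using snoc.prems nz instr
    by (subst step_code_machine[where q = q and q' = q and v = v and h = h and a = 0 and d = MLeft])
       (auto simp: act_tape_def read_tape_def move_head_def)
  have "(step (code_machine k P) ^^ length w) (q, ts[v := (tape_of w, length w)]) =
         (q, (ts[v := (tape_of w, length w)])[v := (tape_of [], 0)])"
    using snoc by (intro snoc.IH) auto
  from funpow_step_first[of "step (code_machine k P)", OF a this] show ?case
    by simp
qed

end


text \<open>Between commands the heads on the tapes of the variables are at the left end, except for those
  of the variables of the enclosing loops, which a command must not touch.\<close>

definition load :: "nat set \<Rightarrow> (nat \<Rightarrow> bool list) \<Rightarrow> tape list \<Rightarrow> tape list" where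
  "load V \<sigma> ts = map (\<lambda>v. if v \<in> V then (tape_of (\<sigma> v), 0) else ts ! v) [0..<length ts]"

lemma length_load [simp]: "length (load V \<sigma> ts) = length ts"
  by (simp add: load_def)

lemma nth_load [simp]:
  "v < length ts \<Longrightarrow> load V \<sigma> ts ! v = (if v \<in> V then (tape_of (\<sigma> v), 0) else ts ! v)"
  by (simp add: load_def)

lemma loaded_iff:
  "load V \<sigma> ts = ts \<longleftrightarrow> (\<forall>v < length ts. v \<in> V \<longrightarrow> ts ! v = (tape_of (\<sigma> v), 0))"
  by (auto simp: list_eq_iff_nth_eq)

lemma load_update: "v \<notin> V \<Longrightarrow> (load V \<sigma> ts)[v := t] = load V \<sigma> (ts[v := t])"
  by (cases "v < length ts") (auto simp: list_eq_iff_nth_eq nth_list_update)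

lemma exec_other: "v \<notin> vars c \<Longrightarrow> exec c \<sigma> v = \<sigma> v"
proof (induction c arbitrary: \<sigma>)
  case (For u c d)
  have "foldr (\<lambda>b. if b then exec d else exec c) w \<sigma> v = \<sigma> v" for w
    using For by (induction w) auto
  then show ?case by simp
qed auto

text \<open>Induction on the head position: the unread part is \<open>take j w\<close>, and
  \<open>foldr\<close> consumes it from its end just as the head does. \<open>r b\<close> and
  \<open>x b\<close> are entry and exit of the body for the bit \<open>b\<close>. The offset
  \<open>m\<close> generalises the start of the time counter that \<open>steps\<close> threads
  through the fold; the final \<open>+ 1\<close> is the exit at the marker.\<close>

lemma run_loop:
  assumes P: "q < length P" "P ! q = (v, \<lambda>s. if s = 1 then (s, MStay, qe)
      else if s = 2 then (s, MStay, r False) else (s, MStay, r True))"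
    and body: "\<And>b \<rho> us. load V \<rho> us = us \<Longrightarrow> length us = length ts \<Longrightarrow>
      (step (code_machine k P) ^^ tm b \<rho>) (r b, us) = (x b, load V (f b \<rho>) us)"
    and ret: "\<And>b. x b < length P \<and> P ! x b = (v, \<lambda>s. (s, MLeft, q))"
    and v: "v < length ts" "v \<notin> V"
    and ts: "ts ! v = (tape_of w, j)" "j \<le> length w" "load V \<rho> ts = ts"
  shows "\<exists>n. (step (code_machine k P) ^^ n) (q, ts) =
      (qe, (load V (foldr f (take j w) \<rho>) ts)[v := (tape_of w, 0)]) \<and>
      m + n = snd (foldr (\<lambda>b (\<rho>, n). (f b \<rho>, n + tm b \<rho> + 2)) (take j w) (\<rho>, m)) + 1"
  using body v ts
proof (induction j arbitrary: \<rho> ts m)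
  case 0
  have "step (code_machine k P) (q, ts) = (qe, ts[v := act_tape (1, MStay) (ts ! v)])"
    using 0 by (intro step_code_machine[OF P]) auto
  also have "act_tape (1, MStay) (ts ! v) = ts ! v"
    using 0 by (auto simp: act_tape_def move_head_def tape_of_def)
  finally show ?case
    using 0 by (intro exI[of _ 1]) (simp add: list_update_same_conv)
next
  case (Suc j)
  define b where "b = w ! j"
  let ?M = "code_machine k P"
  let ?ts' = "load V (f b \<rho>) (ts[v := (tape_of w, j)])"
  have 1: "step ?M (q, ts) = (r b, ts)"
  proof -
    have "step ?M (q, ts) = (r b, ts[v := act_tape (read_tape (ts ! v), MStay) (ts ! v)])"
      using Suc.prems by (intro step_code_machine[OF P]) (auto simp: b_def)
    then show ?thesis by simp
  qed
  have 2: "(step ?M ^^ tm b \<rho>) (r b, ts) = (x b, load V (f b \<rho>) ts)"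
    using Suc.prems by blast
  have 3: "step ?M (x b, load V (f b \<rho>) ts) = (q, ?ts')"
  proof -
    note rb = ret[of b]
    have [simp]: "load V (f b \<rho>) ts ! v = ts ! v"
      using Suc.prems by simp
    have "step ?M (x b, load V (f b \<rho>) ts) =
        (q, (load V (f b \<rho>) ts)[v := act_tape (read_tape (ts ! v), MLeft) (load V (f b \<rho>) ts ! v)])"
      using Suc.prems by (intro step_code_machine[OF conjunct1[OF rb] conjunct2[OF rb]]) auto
    moreover have "act_tape (read_tape (ts ! v), MLeft) (ts ! v) = (tape_of w, j)"
      using Suc.prems by (simp add: act_tape_def read_tape_def move_head_def)
    ultimately show ?thesis
      using Suc.prems by (simp add: load_update)
  qed
  have "\<exists>n. (step ?M ^^ n) (q, ?ts') =
      (qe, (load V (foldr f (take j w) (f b \<rho>)) ?ts')[v := (tape_of w, 0)]) \<and>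
      m + tm b \<rho> + 2 + n = snd (foldr (\<lambda>b (\<rho>, n). (f b \<rho>, n + tm b \<rho> + 2)) (take j w)
        (f b \<rho>, m + tm b \<rho> + 2)) + 1"
    using Suc.prems by (intro Suc.IH) (auto simp: loaded_iff nth_list_update)
  then obtain n where n: "(step ?M ^^ n) (q, ?ts') =
      (qe, (load V (foldr f (take j w) (f b \<rho>)) ?ts')[v := (tape_of w, 0)])"
      "m + tm b \<rho> + 2 + n = snd (foldr (\<lambda>b (\<rho>, n). (f b \<rho>, n + tm b \<rho> + 2)) (take j w)
        (f b \<rho>, m + tm b \<rho> + 2)) + 1" by blast
  have tk: "take (Suc j) w = take j w @ [b]"
    using Suc.prems by (simp add: take_Suc_conv_app_nth b_def)
  have "(step ?M ^^ (Suc (tm b \<rho> + Suc n))) (q, ts) =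
      (qe, (load V (foldr f (take j w) (f b \<rho>)) ?ts')[v := (tape_of w, 0)])"
    by (rule funpow_step_first[where f = "step ?M", OF 1], rule funpow_stepsI[OF 2 _ refl],
        rule funpow_step_first[where f = "step ?M", OF 3 n(1)])
  moreover have "(load V (foldr f (take j w) (f b \<rho>)) ?ts')[v := (tape_of w, 0)] =
      (load V (foldr f (take (Suc j) w) \<rho>) ts)[v := (tape_of w, 0)]"
    using Suc.prems by (auto simp: list_eq_iff_nth_eq nth_list_update tk)
  ultimately show ?case
    using n(2) by (intro exI[of _ "Suc (tm b \<rho> + Suc n)"]) (simp add: tk)
qed

text \<open>The code sits between arbitrary \<open>A\<close> and \<open>B\<close> because
  subcommands run inside a larger program. The tape of an enclosing loop variable, whose head is in
  the middle, is left open by \<open>load (vars c)\<close>, and admissibility keeps the body off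
  it.\<close>

lemma compile_correct:
  assumes "P = A @ compile c (length A) @ B" "admissible c" "vars c \<subseteq> {..<length ts}"
    "load (vars c) \<sigma> ts = ts"
  shows "(step (code_machine k P) ^^ steps c \<sigma>) (length A, ts) =
    (length A + code_size c, load (vars c) (exec c \<sigma>) ts)"
  using assms
proof (induction c arbitrary: A B \<sigma> ts)
  case Skip
  then show ?case by simp
next
  case (App v b)
  let ?q = "length A" and ?M = "code_machine k P" and ?w = "\<sigma> v"
  have v: "v < length ts" "ts ! v = (tape_of ?w, 0)"
    using App.prems by (auto simp: loaded_iff)
  have P0: "?q < length P" "P ! ?q = (v, \<lambda>s. if s = 0 then (bit_symbol b, MLeft, ?q + 1) else (s, MRight, ?q))"
    using App.prems by auto
  have P1: "?q + 1 < length P" "P ! (?q + 1) = (v, \<lambda>s. if s = 1 then (s, MStay, ?q + 2) else (s, MLeft, ?q + 1))"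
    using App.prems by (auto simp: nth_append)
  have 1: "(step ?M ^^ Suc (length ?w)) (?q, ts) = (?q, ts[v := (tape_of ?w, Suc (length ?w))])"
    using scan_right[OF P0, of ts ?w 0] v by simp
  have upd: "(tape_of ?w)(Suc (length ?w) := bit_symbol b) = tape_of (?w @ [b])"
    by (auto simp: tape_of_def fun_eq_iff nth_append)
  have 2: "step ?M (?q, ts[v := (tape_of ?w, Suc (length ?w))]) =
      (?q + 1, ts[v := (tape_of (?w @ [b]), length ?w)])"
    using v step_code_machine[OF P0, of "ts[v := (tape_of ?w, Suc (length ?w))]" "bit_symbol b" MLeft "?q + 1" k]
    by (auto simp: act_tape_def move_head_def upd)
  have 3: "(step ?M ^^ length ?w) (?q + 1, ts[v := (tape_of (?w @ [b]), length ?w)]) =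
      (?q + 1, ts[v := (tape_of (?w @ [b]), 0)])"
    using v by (subst scan_left[OF P1]) auto
  have 4: "step ?M (?q + 1, ts[v := (tape_of (?w @ [b]), 0)]) =
      (?q + 2, ts[v := (tape_of (?w @ [b]), 0)])"
    using v step_code_machine[OF P1, of "ts[v := (tape_of (?w @ [b]), 0)]" 1 MStay "?q + 2" k]
    by (auto simp: act_tape_def move_head_def tape_of_def fun_upd_idem)
  have "(step ?M ^^ (Suc (length ?w) + Suc (length ?w + 1))) (?q, ts) =
      (?q + 2, ts[v := (tape_of (?w @ [b]), 0)])"
    by (rule funpow_stepsI[OF 1 _ refl], rule funpow_step_first[where f = "step ?M", OF 2], rule funpow_stepsI[OF 3 _ refl])
       (use 4 in simp)
  moreover have "ts[v := (tape_of (?w @ [b]), 0)] = load {v} (\<sigma>(v := ?w @ [b])) ts"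
    using v by (auto simp: list_eq_iff_nth_eq nth_list_update)
  moreover have "Suc (length ?w) + Suc (length ?w + 1) = steps (App v b) \<sigma>"
    by simp
  ultimately show ?case by (metis code_size.simps(2) exec.simps(2) vars.simps(2))
next
  case (Clear v)
  let ?q = "length A" and ?M = "code_machine k P" and ?w = "\<sigma> v"
  have v: "v < length ts" "ts ! v = (tape_of ?w, 0)"
    using Clear.prems by (auto simp: loaded_iff)
  have P0: "?q < length P" "P ! ?q = (v, \<lambda>s. if s = 0 then (s, MLeft, ?q + 1) else (s, MRight, ?q))"
    using Clear.prems by auto
  have P1: "?q + 1 < length P" "P ! (?q + 1) = (v, \<lambda>s. if s = 1 then (s, MStay, ?q + 2) else (0, MLeft, ?q + 1))"
    using Clear.prems by (auto simp: nth_append)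
  have 1: "(step ?M ^^ Suc (length ?w)) (?q, ts) = (?q, ts[v := (tape_of ?w, Suc (length ?w))])"
    using scan_right[OF P0, of ts ?w 0] v by simp
  have upd: "(tape_of ?w)(Suc (length ?w) := 0) = tape_of ?w"
    by (auto simp: tape_of_def fun_eq_iff)
  have 2: "step ?M (?q, ts[v := (tape_of ?w, Suc (length ?w))]) =
      (?q + 1, ts[v := (tape_of ?w, length ?w)])"
    using v step_code_machine[OF P0, of "ts[v := (tape_of ?w, Suc (length ?w))]" 0 MLeft "?q + 1" k]
    by (auto simp: act_tape_def move_head_def upd)
  have 3: "(step ?M ^^ length ?w) (?q + 1, ts[v := (tape_of ?w, length ?w)]) =
      (?q + 1, ts[v := (tape_of [], 0)])"
    using v by (subst erase_left[OF P1, where w = "?w"]) auto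
  have 4: "step ?M (?q + 1, ts[v := (tape_of [], 0)]) = (?q + 2, ts[v := (tape_of [], 0)])"
    using v step_code_machine[OF P1, of "ts[v := (tape_of [], 0)]" 1 MStay "?q + 2" k]
    by (auto simp: act_tape_def move_head_def tape_of_def fun_upd_idem)
  have "(step ?M ^^ (Suc (length ?w) + Suc (length ?w + 1))) (?q, ts) =
      (?q + 2, ts[v := (tape_of [], 0)])"
    by (rule funpow_stepsI[OF 1 _ refl], rule funpow_step_first[where f = "step ?M", OF 2], rule funpow_stepsI[OF 3 _ refl])
       (use 4 in simp)
  moreover have "ts[v := (tape_of [], 0)] = load {v} (\<sigma>(v := [])) ts"
    using v by (auto simp: list_eq_iff_nth_eq nth_list_update)
  moreover have "Suc (length ?w) + Suc (length ?w + 1) = steps (Clear v) \<sigma>"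
    by simp
  ultimately show ?case by (metis code_size.simps(3) exec.simps(3) vars.simps(3))
next
  case (Seq c d)
  have 1: "(step (code_machine k P) ^^ steps c \<sigma>) (length A, ts) =
      (length A + code_size c, load (vars c) (exec c \<sigma>) ts)"
    using Seq.prems by (intro Seq.IH(1)[where B = "compile d (length A + code_size c) @ B"])
      (auto simp: loaded_iff)
  let ?ts = "load (vars c) (exec c \<sigma>) ts"
  have 2: "(step (code_machine k P) ^^ steps d (exec c \<sigma>)) (length (A @ compile c (length A)), ?ts) =
      (length (A @ compile c (length A)) + code_size d, load (vars d) (exec d (exec c \<sigma>)) ?ts)"
    using Seq.prems by (intro Seq.IH(2)) (auto simp: loaded_iff exec_other)
  have 3: "load (vars d) (exec d (exec c \<sigma>)) ?ts = load (vars c \<union> vars d) (exec d (exec c \<sigma>)) ts"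
    by (auto simp: list_eq_iff_nth_eq exec_other)
  show ?case
    using funpow_stepsI[OF 1, of "steps d (exec c \<sigma>)"] 2 3 by (simp add: add.assoc)
next
  case (For v c d)
  let ?q = "length A" and ?M = "code_machine k P" and ?w = "\<sigma> v"
  let ?V = "vars c \<union> vars d"
  let ?qe = "?q + code_size c + code_size d + 4"
  let ?h0 = "(v, \<lambda>s. if s = 0 then (s, MLeft, ?q + 1) else (s, MRight, ?q)) :: instr"
  let ?h1 = "(v, \<lambda>s. if s = 1 then (s, MStay, ?qe)
           else if s = 2 then (s, MStay, ?q + 2) else (s, MStay, ?q + code_size c + 3)) :: instr"
  let ?hb = "(v, \<lambda>s. (s, MLeft, ?q + 1)) :: instr"
  have P: "P = A @ [?h0, ?h1] @ compile c (?q + 2) @ [?hb] @ compile d (?q + code_size c + 3) @ [?hb] @ B"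
    using For.prems by simp
  have lenP: "length P = ?qe + length B"
    by (simp add: P)
  have v: "v < length ts" "ts ! v = (tape_of ?w, 0)" "v \<notin> ?V"
    using For.prems by (auto simp: loaded_iff)
  have P0: "?q < length P" "P ! ?q = ?h0" by (auto simp: P)
  have P1: "?q + 1 < length P" "P ! (?q + 1) = ?h1" by (auto simp: P nth_append)
  have Pc: "P ! (?q + 2 + code_size c) = ?hb" by (simp add: P nth_append)
  have Pd: "P ! (?q + 3 + code_size c + code_size d) = ?hb" by (simp add: P nth_append)
  have 1: "(step ?M ^^ Suc (length ?w)) (?q, ts) = (?q, ts[v := (tape_of ?w, Suc (length ?w))])"
    using scan_right[OF P0, of ts ?w 0] v by simp
  have upd: "(tape_of ?w)(Suc (length ?w) := 0) = tape_of ?w"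
    by (auto simp: tape_of_def fun_eq_iff)
  let ?ts = "ts[v := (tape_of ?w, length ?w)]"
  have 2: "step ?M (?q, ts[v := (tape_of ?w, Suc (length ?w))]) = (?q + 1, ?ts)"
    using v step_code_machine[OF P0, of "ts[v := (tape_of ?w, Suc (length ?w))]" 0 MLeft "?q + 1" k]
    by (auto simp: act_tape_def move_head_def upd)
  let ?r = "\<lambda>b. if b then ?q + code_size c + 3 else ?q + 2"
  let ?x = "\<lambda>b. if b then ?q + 3 + code_size c + code_size d else ?q + 2 + code_size c"
  let ?f = "\<lambda>b. if b then exec d else exec c"
  let ?tm = "\<lambda>b. if b then steps d else steps c"
  have body: "(step ?M ^^ ?tm b \<rho>) (?r b, us) = (?x b, load ?V (?f b \<rho>) us)"
    if us: "load ?V \<rho> us = us" "length us = length ?ts" for b \<rho> us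
  proof (cases b)
    case True
    have "(step ?M ^^ steps d \<rho>) (length (A @ [?h0, ?h1] @ compile c (?q + 2) @ [?hb]), us) =
      (length (A @ [?h0, ?h1] @ compile c (?q + 2) @ [?hb]) + code_size d, load (vars d) (exec d \<rho>) us)"
      using For.prems us P by (intro For.IH(2)[where B = "?hb # B"])
        (auto simp: loaded_iff algebra_simps intro!: arg_cong[of _ _ "compile d"])
    moreover have "load (vars d) (exec d \<rho>) us = load ?V (exec d \<rho>) us"
      using us by (auto simp: list_eq_iff_nth_eq exec_other)
    ultimately show ?thesis using True by (simp add: algebra_simps numeral_3_eq_3)
  next
    case False
    have "(step ?M ^^ steps c \<rho>) (length (A @ [?h0, ?h1]), us) =
      (length (A @ [?h0, ?h1]) + code_size c, load (vars c) (exec c \<rho>) us)"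
      using For.prems us P
      by (intro For.IH(1)[where B = "[?hb] @ compile d (?q + code_size c + 3) @ [?hb] @ B"])
         (auto simp: loaded_iff algebra_simps)
    moreover have "load (vars c) (exec c \<rho>) us = load ?V (exec c \<rho>) us"
      using us by (auto simp: list_eq_iff_nth_eq exec_other)
    ultimately show ?thesis using False by (simp add: algebra_simps)
  qed
  have "\<exists>n. (step ?M ^^ n) (?q + 1, ?ts) =
      (?qe, (load ?V (foldr ?f (take (length ?w) ?w) \<sigma>) ?ts)[v := (tape_of ?w, 0)]) \<and>
      0 + n = snd (foldr (\<lambda>b (\<rho>, n). (?f b \<rho>, n + ?tm b \<rho> + 2)) (take (length ?w) ?w) (\<sigma>, 0)) + 1"
    using v For.prems(4) lenP P1 Pc Pd
    by (intro run_loop[where r = ?r and x = ?x] body)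
       (auto simp: loaded_iff nth_list_update)
  then obtain n where n: "(step ?M ^^ n) (?q + 1, ?ts) =
      (?qe, (load ?V (foldr ?f ?w \<sigma>) ?ts)[v := (tape_of ?w, 0)])"
      "n = snd (foldr (\<lambda>b (\<rho>, n). (?f b \<rho>, n + ?tm b \<rho> + 2)) ?w (\<sigma>, 0)) + 1"
    by auto
  have "(step ?M ^^ (Suc (length ?w) + Suc n)) (?q, ts) =
      (?qe, (load ?V (foldr ?f ?w \<sigma>) ?ts)[v := (tape_of ?w, 0)])"
    by (rule funpow_stepsI[OF 1 _ refl], rule funpow_step_first[where f = "step ?M", OF 2 n(1)])
  moreover have "(load ?V (foldr ?f ?w \<sigma>) ?ts)[v := (tape_of ?w, 0)] =
      load (vars (For v c d)) (exec (For v c d) \<sigma>) ts"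
  proof -
    have "exec (For v c d) \<sigma> v = \<sigma> v"
    proof -
      have "foldr ?f w \<sigma> v = \<sigma> v" for w
        using v by (induction w) (auto simp: exec_other)
      then show ?thesis by simp
    qed
    then show ?thesis
      using v by (intro nth_equalityI) (auto simp: nth_list_update)
  qed
  moreover have "Suc (length ?w) + Suc n = steps (For v c d) \<sigma>"
    using n(2) by simp
  ultimately have "(step ?M ^^ steps (For v c d) \<sigma>) (?q, ts) =
      (?qe, load (vars (For v c d)) (exec (For v c d) \<sigma>) ts)"
    by (simp only:)
  then show ?case
    by (simp only: code_size.simps add.assoc)
qed


text \<open>No block jumps beyond its own exit; for the whole program at address 0 that exit is the
  halting state.\<close>

lemma compile_instr:
  "(v, h) \<in> set (compile c q) \<Longrightarrow> s < 4 \<Longrightarrow> h s = (a, d, q') \<Longrightarrow> a < 4 \<and> q' \<le> q + code_size c"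
proof (induction c arbitrary: q)
  case (Seq c1 c2)
  from Seq.prems(1) consider "(v, h) \<in> set (compile c1 q)" | "(v, h) \<in> set (compile c2 (q + code_size c1))"
    by auto
  then show ?case
  proof cases
    case 1
    then show ?thesis using Seq.IH(1)[OF 1 Seq.prems(2,3)] by simp
  next
    case 2
    then show ?thesis using Seq.IH(2)[OF 2 Seq.prems(2,3)] by simp
  qed
next
  case (For u c1 c2)
  from For.prems(1) consider "(v, h) \<in> set (compile c1 (q + 2))"
    | "(v, h) \<in> set (compile c2 (q + code_size c1 + 3))"
    | "fst (h s) \<in> {s} \<and> snd (snd (h s)) \<le> q + code_size (For u c1 c2)"
    by auto
  then show ?case
  proof cases
    case 1
    then show ?thesis using For.IH(1)[OF 1 For.prems(2,3)] by simp
  next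
    case 2
    then show ?thesis using For.IH(2)[OF 2 For.prems(2,3)] by simp
  next
    case 3
    then show ?thesis using For.prems by simp
  qed
qed (auto split: if_splits)

lemma compile_vars: "(v, h) \<in> set (compile c q) \<Longrightarrow> v \<in> vars c"
  by (induction c arbitrary: q) auto

lemma wf_code_machine:
  assumes "vars c \<subseteq> {..<k}"
  shows "wf_machine (code_machine k (compile c 0))"
proof -
  have "fst (instr_trans (compile c 0 ! q) ss) \<le> code_size c \<and>
      (\<forall>(s, d) \<in> set (snd (instr_trans (compile c 0 ! q) ss)). s < 4)"
    if q: "q < code_size c" and ss: "length ss = k" "set ss \<subseteq> {..<4}" for q ss
  proof -
    obtain v h where vh: "compile c 0 ! q = (v, h)" by fastforce
    then have mem: "(v, h) \<in> set (compile c 0)" using q by (metis length_compile nth_mem)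
    then have v: "v < length ss" using assms compile_vars ss by blast
    obtain a d q' where h: "h (ss ! v) = (a, d, q')" by (metis prod_cases3)
    have "ss ! v < 4" using v ss nth_mem by blast
    then have "a < 4 \<and> q' \<le> code_size c" using compile_instr[OF mem _ h] by simp
    moreover have "set ((map (\<lambda>s. (s, MStay)) ss)[v := (a, d)]) \<subseteq>
        insert (a, d) ((\<lambda>s. (s, MStay)) ` set ss)"
      using set_update_subset_insert[of "map (\<lambda>s. (s, MStay)) ss"] by simp
    ultimately show ?thesis using ss by (auto simp: instr_trans_def vh h)
  qed
  then show ?thesis
    by (fastforce simp: wf_machine_def code_machine_def instr_trans_def split_beta)
qed

section \<open>Polynomial bounds on lengths and running times\<close>

text \<open>If \<open>B v\<close> bounds the length of \<open>v\<close> throughout the execution, \<open>apps B c u\<close> bounds the number of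
  symbols appended to \<open>u\<close> and \<open>cost B c\<close> the running time. The bounds are polynomials when they can
  be computed by recursion on a rank, that is, when every append to a variable is only inside
  loops over variables of lower rank.\<close>

primrec apps :: "(nat \<Rightarrow> 'a) \<Rightarrow> cmd \<Rightarrow> nat \<Rightarrow> 'a :: comm_semiring_1" where
  "apps B Skip u = 0"
| "apps B (App v b) u = of_bool (u = v)"
| "apps B (Clear v) u = 0"
| "apps B (Seq c d) u = apps B c u + apps B d u"
| "apps B (For v c d) u = B v * (apps B c u + apps B d u)"

primrec cost :: "(nat \<Rightarrow> 'a) \<Rightarrow> cmd \<Rightarrow> 'a :: comm_semiring_1" where
  "cost B Skip = 0"
| "cost B (App v b) = 2 * B v + 3"
| "cost B (Clear v) = 2 * B v + 3"
| "cost B (Seq c d) = cost B c + cost B d"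
| "cost B (For v c d) = B v + 3 + B v * (cost B c + cost B d + 2)"

text \<open>The hypothesis makes \<open>B\<close> cover the initial length plus everything still to
  be appended. It survives each part of the execution, since what has been appended moves from the
  second summand to the first; a loop spends one share of \<open>apps\<close> per bit, charging both
  branches.\<close>

lemma exec_bounds:
  assumes "\<And>u. length (\<sigma> u) + apps B c u \<le> B u"
  shows "length (exec c \<sigma> u) \<le> length (\<sigma> u) + apps B c u \<and> steps c \<sigma> \<le> cost B c"
  using assms
proof (induction c arbitrary: \<sigma> u)
  case (App v b)
  then show ?case using App[of v] by simp
next
  case (Clear v)
  then show ?case using Clear[of v] by simp
next
  case (Seq c d)
  have 1: "length (exec c \<sigma> u) \<le> length (\<sigma> u) + apps B c u \<and> steps c \<sigma> \<le> cost B c" for u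
    using Seq.prems by (intro Seq.IH(1)) (metis (no_types, lifting) add.assoc add_leD1 apps.simps(4))
  have "length (exec d (exec c \<sigma>) u) \<le> length (exec c \<sigma> u) + apps B d u \<and>
      steps d (exec c \<sigma>) \<le> cost B d"
  proof (rule Seq.IH(2))
    show "length (exec c \<sigma> u) + apps B d u \<le> B u" for u
      using 1[of u] Seq.prems[of u] by simp
  qed
  then show ?case using 1[of u] by simp
next
  case (For v c d)
  define f where "f = (\<lambda>b (\<rho>, n). ((if b then exec d else exec c) \<rho>,
      n + (if b then steps d else steps c) \<rho> + 2))"
  have loop: "(\<forall>u. length (fst (foldr f w (\<sigma>, 0)) u) \<le>
        length (\<sigma> u) + length w * (apps B c u + apps B d u)) \<and>
      snd (foldr f w (\<sigma>, 0)) \<le> length w * (cost B c + cost B d + 2)"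
    if "length w \<le> B v" for w
    using that
  proof (induction w)
    case Nil
    then show ?case by simp
  next
    case (Cons b w)
    obtain \<rho> n where \<rho>: "foldr f w (\<sigma>, 0) = (\<rho>, n)" by fastforce
    have len: "length (\<rho> u) \<le> length (\<sigma> u) + length w * (apps B c u + apps B d u)" for u
      using Cons \<rho> by simp
    have n: "n \<le> length w * (cost B c + cost B d + 2)"
      using Cons \<rho> by simp
    have fits: "length (\<rho> u) + (apps B c u + apps B d u) \<le> B u" for u
    proof -
      have "length (\<rho> u) + (apps B c u + apps B d u) \<le>
          length (\<sigma> u) + Suc (length w) * (apps B c u + apps B d u)"
        using len[of u] by simp
      also have "\<dots> \<le> length (\<sigma> u) + B v * (apps B c u + apps B d u)"
        using Cons.prems by (intro add_left_mono mult_right_mono) auto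
      also have "\<dots> \<le> B u" using For.prems[of u] by simp
      finally show ?thesis .
    qed
    have c: "length (exec c \<rho> u) \<le> length (\<rho> u) + apps B c u \<and> steps c \<rho> \<le> cost B c" for u
    proof (rule For.IH(1))
      show "length (\<rho> u) + apps B c u \<le> B u" for u using fits[of u] by simp
    qed
    have d: "length (exec d \<rho> u) \<le> length (\<rho> u) + apps B d u \<and> steps d \<rho> \<le> cost B d" for u
    proof (rule For.IH(2))
      show "length (\<rho> u) + apps B d u \<le> B u" for u using fits[of u] by simp
    qed
    show ?case
    proof (intro conjI allI)
      fix u
      show "length (fst (foldr f (b # w) (\<sigma>, 0)) u) \<le>
          length (\<sigma> u) + length (b # w) * (apps B c u + apps B d u)"
        using c[of u] d[of u] len[of u] by (simp add: \<rho>) (simp add: f_def)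
      show "snd (foldr f (b # w) (\<sigma>, 0)) \<le> length (b # w) * (cost B c + cost B d + 2)"
        using c[of 0] d[of 0] n by (simp add: \<rho>) (simp add: f_def add_mono)
    qed
  qed
  have fst: "fst (foldr f w (\<sigma>, n)) = foldr (\<lambda>b. if b then exec d else exec c) w \<sigma>" for w n
    by (induction w) (simp_all add: f_def split_beta)
  have Bv: "length (\<sigma> v) \<le> B v" using For.prems[of v] by simp
  have "length (\<sigma> v) * (apps B c u + apps B d u) \<le> B v * (apps B c u + apps B d u)"
    "length (\<sigma> v) * (cost B c + cost B d + 2) \<le> B v * (cost B c + cost B d + 2)"
    by (rule mult_le_mono1[OF Bv])+
  moreover have "steps (For v c d) \<sigma> = length (\<sigma> v) + 3 + snd (foldr f (\<sigma> v) (\<sigma>, 0))"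
    by (simp add: f_def)
  moreover have "cost B (For v c d) = B v + 3 + B v * (cost B c + cost B d + 2)"
    by simp
  moreover have "length (exec (For v c d) \<sigma> u) = length (fst (foldr f (\<sigma> v) (\<sigma>, 0)) u)"
    by (simp add: fst)
  moreover have "apps B (For v c d) u = B v * (apps B c u + apps B d u)"
    by simp
  moreover have "length (fst (foldr f (\<sigma> v) (\<sigma>, 0)) u) \<le>
      length (\<sigma> u) + length (\<sigma> v) * (apps B c u + apps B d u)"
    "snd (foldr f (\<sigma> v) (\<sigma>, 0)) \<le> length (\<sigma> v) * (cost B c + cost B d + 2)"
    using loop[OF Bv] by auto
  ultimately show ?case using Bv by (intro conjI; linarith)
qed auto

lemma poly_apps: "poly (apps B c u) x = apps (\<lambda>v. poly (B v) x) c u"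
  by (induction c) auto

lemma poly_cost: "poly (cost B c) x = cost (\<lambda>v. poly (B v) x) c"
  by (induction c) auto

primrec appended :: "cmd \<Rightarrow> nat set" where
  "appended Skip = {}"
| "appended (App v b) = {v}"
| "appended (Clear v) = {}"
| "appended (Seq c d) = appended c \<union> appended d"
| "appended (For v c d) = appended c \<union> appended d"

primrec ranked :: "(nat \<Rightarrow> nat) \<Rightarrow> cmd \<Rightarrow> bool" where
  "ranked r Skip \<longleftrightarrow> True"
| "ranked r (App v b) \<longleftrightarrow> True"
| "ranked r (Clear v) \<longleftrightarrow> True"
| "ranked r (Seq c d) \<longleftrightarrow> ranked r c \<and> ranked r d"
| "ranked r (For v c d) \<longleftrightarrow> ranked r c \<and> ranked r d \<and> (\<forall>u \<in> appended c \<union> appended d. r v < r u)"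

lemma apps_not_appended: "u \<notin> appended c \<Longrightarrow> apps B c u = 0"
  by (induction c) auto

lemma apps_ranked_cong:
  "ranked r c \<Longrightarrow> (\<And>v. r v < r u \<Longrightarrow> B v = B' v) \<Longrightarrow> apps B c u = apps B' c u"
proof (induction c)
  case (For v c d)
  then show ?case
    by (cases "u \<in> appended c \<union> appended d") (auto simp: apps_not_appended)
qed auto

text \<open>The required \<open>B\<close> is a fixed point. Iterating from 0, its value at
  \<open>u\<close> is final after \<open>r u + 1\<close> rounds, because \<open>apps\<close> at
  \<open>u\<close> consults only variables of lower rank. The general semiring lets the fixed point
  consist of polynomials.\<close>

lemma ranked_bound_exists:
  fixes a :: "'a :: comm_semiring_1"
  assumes "ranked r c"
  obtains B where "\<And>u. B u = a + apps B c u"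
proof -
  define F where "F = (\<lambda>B u. a + apps B c u)"
  define G where "G = (\<lambda>k. (F ^^ k) (\<lambda>_. 0))"
  have G: "G (Suc k) u = a + apps (G k) c u" for k u
    by (simp add: G_def F_def)
  have stable: "r u < k \<Longrightarrow> r u < l \<Longrightarrow> G k u = G l u" for u k l
  proof (induction "r u" arbitrary: u k l rule: less_induct)
    case less
    obtain k' l' where kl: "k = Suc k'" "l = Suc l'"
      using less.prems by (cases k; cases l) auto
    have "apps (G k') c u = apps (G l') c u"
    proof (rule apps_ranked_cong[OF assms])
      show "G k' v = G l' v" if "r v < r u" for v
        by (rule less.hyps) (use that less.prems kl in auto)
    qed
    then show ?case by (simp add: kl G)
  qed
  have "G (Suc (r u)) u = a + apps (\<lambda>u. G (Suc (r u)) u) c u" for u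
  proof -
    have "apps (G (r u)) c u = apps (\<lambda>u. G (Suc (r u)) u) c u"
    proof (rule apps_ranked_cong[OF assms])
      show "G (r u) v = G (Suc (r v)) v" if "r v < r u" for v
        by (rule stable) (use that in auto)
    qed
    then show ?thesis by (simp add: G)
  qed
  then show ?thesis by (rule that)
qed

theorem polytime_exec:
  assumes "admissible c" "ranked r c" "vars c \<subseteq> {..<k}" "n < k"
  shows "polytime n (\<lambda>ws. exec c (\<lambda>i. if i < length ws then ws ! i else []) n)"
proof -
  \<comment> \<open>The indeterminate stands for the total input length, which bounds the initial
    content of each variable.\<close>
  obtain B :: "nat \<Rightarrow> nat poly" where B: "\<And>u. B u = [:0, 1:] + apps B c u"
    using ranked_bound_exists[OF assms(2)] by blast
  let ?P = "compile c 0"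
  let ?M = "code_machine k ?P"
  show ?thesis
    unfolding polytime_def
  proof (intro exI[of _ ?M] exI[of _ "cost B c"] conjI allI impI)
    show "wf_machine ?M" using wf_code_machine assms by blast
    show "n < num_tapes ?M" using assms by (simp add: code_machine_def)
    fix ws :: "bool list list"
    assume ws: "length ws = n"
    define \<sigma> where "\<sigma> = (\<lambda>i. if i < length ws then ws ! i else [])"
    define N where "N = sum_list (map length ws)"
    define ts where "ts = map (\<lambda>i. (tape_of (\<sigma> i), 0 :: nat)) [0..<k]"
    have start: "start_config ?M ws = (0, ts)"
      by (simp add: start_config_def ts_def \<sigma>_def code_machine_def)
    have run: "(step ?M ^^ steps c \<sigma>) (length ([] :: instr list), ts) =
        (length ([] :: instr list) + code_size c, load (vars c) (exec c \<sigma>) ts)"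
      using assms by (intro compile_correct[where B = "[]"]) (auto simp: ts_def loaded_iff)
    have len: "length (\<sigma> u) \<le> N" for u
      unfolding \<sigma>_def N_def by (auto intro!: member_le_sum_list)
    have "length (\<sigma> u) + apps (\<lambda>v. poly (B v) N) c u \<le> poly (B u) N" for u
      using len[of u] by (subst B) (simp add: poly_apps)
    then have "steps c \<sigma> \<le> cost (\<lambda>v. poly (B v) N) c"
      using exec_bounds by blast
    then have time: "steps c \<sigma> \<le> poly (cost B c) N"
      by (simp add: poly_cost)
    have "fst (load (vars c) (exec c \<sigma>) ts ! n) = tape_of (exec c \<sigma> n)"
      using assms by (auto simp: ts_def exec_other)
    with run time show "\<exists>t \<le> poly (cost B c) (sum_list (map length ws)). \<exists>ts.
        (step ?M ^^ t) (start_config ?M ws) = (num_states ?M, ts) \<and>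
        fst (ts ! n) = tape_of (exec c (\<lambda>i. if i < length ws then ws ! i else []) n)"
      unfolding \<sigma>_def[symmetric] N_def[symmetric] start
      by (intro exI[of _ "steps c \<sigma>"]) (simp add: code_machine_def)
  qed
qed

section \<open>Decoding of instances\<close>

lemma bits_inj: "bits m = bits n \<Longrightarrow> m = n"
proof (induction m arbitrary: n rule: less_induct)
  case (less m)
  show ?case
  proof (cases "m = 0 \<or> n = 0")
    case True
    then show ?thesis
      using less.prems by (auto simp: bits.simps[of m] bits.simps[of n] split: if_splits)
  next
    case False
    then have "odd m = odd n" "bits (m div 2) = bits (n div 2)"
      using less.prems by (auto simp: bits.simps[of m] bits.simps[of n])
    moreover from this have "m div 2 = n div 2"
      using False less.IH[of "m div 2" "n div 2"] by simp
    ultimately show ?thesis by presburger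
  qed
qed

lemma enc_list_simps [simp]:
  "enc_list [] = [False]"
  "enc_list (w # ws) = True # w @ enc_list ws"
  by (auto simp: enc_list_def)

text \<open>Codes are concatenated without separators, so injectivity alone would not pass through
  the induction; the remainders \<open>r\<close> and \<open>s\<close> have to be carried along. The
  assumption on \<open>h\<close> is limited to members of \<open>xs\<close> so that an induction
  hypothesis on subterms can discharge it.\<close>

lemma enc_list_map_prefix_free:
  assumes "\<And>x y r s. x \<in> set xs \<Longrightarrow> h x @ r = h y @ s \<Longrightarrow> x = y \<and> r = s"
    and "enc_list (map h xs) @ r = enc_list (map h ys) @ s"
  shows "xs = ys \<and> r = s"
  using assms
proof (induction xs arbitrary: ys r s)
  case Nil
  then show ?case by (cases ys) auto
next
  case (Cons x xs)
  from Cons.prems(2) obtain y ys' where ys: "ys = y # ys'"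
    by (cases ys) auto
  have "h x @ enc_list (map h xs) @ r = h y @ enc_list (map h ys') @ s"
    using Cons.prems(2) ys by simp
  then have "x = y \<and> enc_list (map h xs) @ r = enc_list (map h ys') @ s"
    using Cons.prems(1) by (metis list.set_intros(1))
  then show ?case
    using Cons.IH[of r ys' s] Cons.prems(1) ys by (metis list.set_intros(2))
qed

lemma enc_nat_prefix_free:
  assumes "enc_nat m @ r = enc_nat n @ s"
  shows "m = n \<and> r = s"
proof -
  have "bits m = bits n \<and> r = s"
    using assms unfolding enc_nat_def
    by (intro enc_list_map_prefix_free[where h = "\<lambda>b. [b]"]) auto
  then show ?thesis using bits_inj by blast
qed

lemma enc_trm_prefix_free: "enc_trm t @ r = enc_trm u @ s \<Longrightarrow> t = u \<and> r = s"
proof (induction t arbitrary: u r s)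
  case (Var i)
  then obtain j where u: "u = Var j" by (cases u) auto
  then have "enc_nat i @ r = enc_nat j @ s"
    using Var by simp
  then show ?case
    using enc_nat_prefix_free u by blast
next
  case (Fun f ts)
  from Fun.prems obtain g us where u: "u = Fun g us" by (cases u) auto
  have 1: "enc_nat f @ (enc_list (map enc_trm ts) @ r) = enc_nat g @ (enc_list (map enc_trm us) @ s)"
    using Fun.prems u by simp
  note 2 = enc_nat_prefix_free[OF 1]
  have "ts = us \<and> r = s"
    by (rule enc_list_map_prefix_free[OF _ conjunct2[OF 2]]) (rule Fun.IH)
  then show ?case using 2 u by simp
qed

text \<open>\<open>HCS\<close> only asks for some instance with the given code; injectivity
  identifies it with the query that was written.\<close>

lemma enc_instance_inj:
  assumes "enc_instance \<tau>s = enc_instance \<upsilon>s"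
  shows "\<tau>s = \<upsilon>s"
proof -
  have "ts = us \<and> r = s"
    if "enc_list (map enc_trm ts) @ r = enc_list (map enc_trm us) @ s" for ts us r s
    using that by (rule enc_list_map_prefix_free[rotated]) (rule enc_trm_prefix_free)
  then have "\<tau>s = \<upsilon>s \<and> [] = ([] :: bool list)"
    using assms unfolding enc_instance_def
    by (intro enc_list_map_prefix_free[where h = "\<lambda>ts. enc_list (map enc_trm ts)"]) auto
  then show ?thesis by simp
qed

section \<open>Soundness\<close>

primrec eval_trm :: "(nat \<Rightarrow> 'a list \<Rightarrow> 'a) \<Rightarrow> (nat \<Rightarrow> 'a) \<Rightarrow> trm \<Rightarrow> 'a" where
  "eval_trm F e (Var i) = e i"
| "eval_trm F e (Fun f ts) = F f (map (eval_trm F e) ts)"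

primrec eval_fm ::
  "(nat \<Rightarrow> 'a list \<Rightarrow> 'a) \<Rightarrow> (nat \<Rightarrow> 'a list \<Rightarrow> bool) \<Rightarrow> (nat \<Rightarrow> 'a) \<Rightarrow> fm \<Rightarrow> bool" where
  "eval_fm F G e Falsum \<longleftrightarrow> False"
| "eval_fm F G e (Pred r ts) \<longleftrightarrow> G r (map (eval_trm F e) ts)"
| "eval_fm F G e (Imp p q) \<longleftrightarrow> (eval_fm F G e p \<longrightarrow> eval_fm F G e q)"
| "eval_fm F G e (And p q) \<longleftrightarrow> eval_fm F G e p \<and> eval_fm F G e q"
| "eval_fm F G e (Or p q) \<longleftrightarrow> eval_fm F G e p \<or> eval_fm F G e q"
| "eval_fm F G e (All p) \<longleftrightarrow> (\<forall>a. eval_fm F G (case_nat a e) p)"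
| "eval_fm F G e (Ex p) \<longleftrightarrow> (\<exists>a. eval_fm F G (case_nat a e) p)"

lemma eval_subst_trm: "eval_trm F e (subst_trm \<sigma> t) = eval_trm F (\<lambda>i. eval_trm F e (\<sigma> i)) t"
  by (induction t) (simp_all add: o_def cong: map_cong)

lemma eval_lift_subst:
  "(\<lambda>i. eval_trm F (case_nat a e) (lift_subst \<sigma> i)) = case_nat a (\<lambda>i. eval_trm F e (\<sigma> i))"
  by (auto simp: fun_eq_iff lift_subst_def eval_subst_trm split: nat.split)

lemma eval_subst: "eval_fm F G e (subst \<sigma> p) = eval_fm F G (\<lambda>i. eval_trm F e (\<sigma> i)) p"
  by (induction p arbitrary: e \<sigma>) (simp_all add: eval_subst_trm eval_lift_subst o_def)

lemma eval_lift [simp]: "eval_fm F G (case_nat a e) (lift p) = eval_fm F G e p"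
  by (simp add: eval_subst)

lemma eval_inst [simp]: "eval_fm F G e (inst t p) = eval_fm F G (case_nat (eval_trm F e t) e) p"
proof -
  have "(\<lambda>i. eval_trm F e (case_nat t Var i)) = case_nat (eval_trm F e t) e"
    by (auto simp: fun_eq_iff split: nat.split)
  then show ?thesis by (simp add: eval_subst)
qed

lemma soundness: "\<Gamma> \<turnstile> p \<Longrightarrow> \<forall>q \<in> set \<Gamma>. eval_fm F G e q \<Longrightarrow> eval_fm F G e p"
proof (induction arbitrary: e rule: derives.induct)
  case (AllI \<Gamma> p)
  have "eval_fm F G (case_nat a e) p" for a
    using AllI.prems by (intro AllI.IH) auto
  then show ?case by simp
next
  case (ExE \<Gamma> p q)
  have "eval_fm F G e (Ex p)"
    using ExE.prems by (rule ExE.IH(1))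
  then obtain a where "eval_fm F G (case_nat a e) p" by auto
  then have "eval_fm F G (case_nat a e) (lift q)"
    using ExE.prems by (intro ExE.IH(2)) auto
  then show ?case by simp
qed auto

lemma consistent_if_model: "(\<And>e. eval_fm F G e p) \<Longrightarrow> consistent p"
  using soundness[of "[p]" Falsum F G] by (auto simp: consistent_def)

lemma eval_quantifier_free:
  "quantifier_free p \<Longrightarrow> eval_fm F G e p = truth (\<lambda>(r, ts). G r (map (eval_trm F e) ts)) p"
  by (induction p) auto

section \<open>The tableau sentence\<close>

text \<open>The first argument of an atom is a time \<open>T\<close> and the second one, if any, a cell \<open>i\<close>. The machine
  \<open>\<mu>\<close> is the decider of the search problem (0) or the clock (1). At time \<open>T\<close> it is in state \<open>q\<close>
  (\<open>St \<mu> q\<close>), reads \<open>a\<close> on tape \<open>j\<close> (\<open>Rd \<mu> j a\<close>), has the symbol \<open>a\<close> in cell \<open>i\<close> of tape \<open>j\<close>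
  (\<open>Sy \<mu> j a\<close>), and its head on tape \<open>j\<close> is at \<open>i\<close> (\<open>Hd \<mu> j\<close>) or elsewhere (\<open>Aw \<mu> j\<close>). Cell \<open>i + 1\<close> of
  the input tape contains \<open>a\<close> (\<open>In a\<close>). The guessed solution has a symbol in cell \<open>i\<close> (\<open>Yp\<close>), and this
  is the bit 1 (\<open>Yb\<close>); \<open>Wp\<close> and \<open>Wb\<close> are copies of \<open>Yp\<close> and \<open>Yb\<close>. The predicates \<open>Hd\<close> and \<open>Aw\<close> are
  separate so that the clauses describing a step are Horn clauses; hence an assignment satisfying
  them makes everything true that holds in the computation, whatever else it makes true.\<close>

datatype pname =
    St nat nat
  | Rd nat nat nat
  | Sy nat nat nat
  | Hd nat nat
  | Aw nat nat
  | In nat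
  | Yp
  | Yb
  | Wp
  | Wb

instance pname :: countable
  by countable_datatype

definition atom :: "pname \<Rightarrow> trm list \<Rightarrow> fm" where
  "atom P ts = Pred (to_nat P) ts"

definition Zero :: trm where
  "Zero = Fun 0 []"

definition Next :: "trm \<Rightarrow> trm" where
  "Next t = Fun 1 [t]"

definition Push :: "bool \<Rightarrow> trm \<Rightarrow> trm" where
  "Push b t = Fun (bit_symbol b) [t]"

text \<open>The empty conjunction is a tautology without atoms, so a conjunction contributes exactly
  the atoms of its members, in order.\<close>

definition conjs :: "fm list \<Rightarrow> fm" where
  "conjs ps = foldr And ps (Imp Falsum Falsum)"

definition imps :: "fm list \<Rightarrow> fm \<Rightarrow> fm" where
  "imps ps q = foldr Imp ps q"

lemma truth_simps [simp]:
  "truth \<alpha> (atom P ts) \<longleftrightarrow> \<alpha> (to_nat P, ts)"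
  "truth \<alpha> (conjs ps) \<longleftrightarrow> (\<forall>p \<in> set ps. truth \<alpha> p)"
  "truth \<alpha> (imps ps q) \<longleftrightarrow> ((\<forall>p \<in> set ps. truth \<alpha> p) \<longrightarrow> truth \<alpha> q)"
proof -
  show "truth \<alpha> (conjs ps) \<longleftrightarrow> (\<forall>p \<in> set ps. truth \<alpha> p)"
    unfolding conjs_def by (induction ps) auto
  show "truth \<alpha> (imps ps q) \<longleftrightarrow> ((\<forall>p \<in> set ps. truth \<alpha> p) \<longrightarrow> truth \<alpha> q)"
    unfolding imps_def by (induction ps) auto
qed (simp add: atom_def)

text \<open>In a left move cell 0 is special: a head at 0 stays there and a head at 1 arrives there,
  so cell 0 is free afterwards only if both were. After a right move no head is at 0.\<close>

fun move_clauses :: "nat \<Rightarrow> nat \<Rightarrow> move \<Rightarrow> trm \<Rightarrow> trm \<Rightarrow> fm list" where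
  "move_clauses \<mu> j MStay T i =
     [imps [atom (Hd \<mu> j) [T, i]] (atom (Hd \<mu> j) [Next T, i]),
      imps [atom (Aw \<mu> j) [T, i]] (atom (Aw \<mu> j) [Next T, i])]"
| "move_clauses \<mu> j MRight T i =
     [imps [atom (Hd \<mu> j) [T, i]] (atom (Hd \<mu> j) [Next T, Next i]),
      imps [atom (Aw \<mu> j) [T, i]] (atom (Aw \<mu> j) [Next T, Next i]),
      atom (Aw \<mu> j) [Next T, Zero]]"
| "move_clauses \<mu> j MLeft T i =
     [imps [atom (Hd \<mu> j) [T, Zero]] (atom (Hd \<mu> j) [Next T, Zero]),
      imps [atom (Hd \<mu> j) [T, Next i]] (atom (Hd \<mu> j) [Next T, i]),
      imps [atom (Aw \<mu> j) [T, Zero], atom (Aw \<mu> j) [T, Next Zero]] (atom (Aw \<mu> j) [Next T, Zero]),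
      imps [atom (Aw \<mu> j) [T, Next (Next i)]] (atom (Aw \<mu> j) [Next T, Next i])]"

definition act_clauses :: "nat \<Rightarrow> nat \<Rightarrow> nat \<times> move \<Rightarrow> trm \<Rightarrow> trm \<Rightarrow> fm list" where
  "act_clauses \<mu> j a T i =
     imps [atom (Hd \<mu> j) [T, i]] (atom (Sy \<mu> j (fst a)) [Next T, i]) # move_clauses \<mu> j (snd a) T i"

text \<open>The heads of several tapes stand at different cells, yet one cell variable suffices: the
  symbols read are first collected in \<open>Rd\<close> atoms, which mention no cell, and the
  transition clauses start from those.\<close>

definition step_clauses :: "nat \<Rightarrow> machine \<Rightarrow> trm \<Rightarrow> trm \<Rightarrow> fm list" where
  "step_clauses \<mu> M T i =
     concat (map (\<lambda>j. concat (map (\<lambda>a.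
       [imps [atom (Hd \<mu> j) [T, i], atom (Sy \<mu> j a) [T, i]] (atom (Rd \<mu> j a) [T]),
        imps [atom (Aw \<mu> j) [T, i], atom (Sy \<mu> j a) [T, i]] (atom (Sy \<mu> j a) [Next T, i])])
       [0..<num_symbols M])) [0..<num_tapes M]) @
     concat (map (\<lambda>q. map (\<lambda>ss.
       imps (atom (St \<mu> q) [T] # map (\<lambda>j. atom (Rd \<mu> j (ss ! j)) [T]) [0..<num_tapes M])
         (conjs (atom (St \<mu> (fst (trans M q ss))) [Next T] #
            concat (map (\<lambda>j. act_clauses \<mu> j (snd (trans M q ss) ! j) T i) [0..<num_tapes M]))))
       (List.n_lists (num_tapes M) [0..<num_symbols M])) [0..<num_states M])"

text \<open>A string term is itself the time 0 of its computations. On the guess tape the falsity of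
  \<open>Yb\<close> or \<open>Yp\<close> must have an effect, hence the disjunctions, the only
  clauses of the matrix that are not Horn.\<close>

definition init_clauses :: "nat \<Rightarrow> machine \<Rightarrow> trm \<Rightarrow> trm \<Rightarrow> fm list" where
  "init_clauses \<mu> M X i =
     atom (St \<mu> 0) [X] #
     map (\<lambda>a. imps [atom (In a) [X, i]] (atom (Sy \<mu> 0 a) [X, Next i])) [0, 2, 3] @
     concat (map (\<lambda>j. [atom (Sy \<mu> j 1) [X, Zero], atom (Hd \<mu> j) [X, Zero], atom (Aw \<mu> j) [X, Next i]])
       [0..<num_tapes M]) @
     concat (map (\<lambda>j.
       if \<mu> = 0 \<and> j = 1
       then [imps [atom Yb [X, Next i]] (atom (Sy \<mu> j 3) [X, Next i]),
             imps [atom Yp [X, Next i]] (Or (atom Yb [X, Next i]) (atom (Sy \<mu> j 2) [X, Next i])),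
             Or (atom Yp [X, Next i]) (atom (Sy \<mu> j 0) [X, Next i])]
       else [atom (Sy \<mu> j 0) [X, Next i]])
       [1..<num_tapes M])"

definition input_clauses :: "trm \<Rightarrow> trm \<Rightarrow> fm list" where
  "input_clauses T i =
     atom (In 0) [Zero, i] #
     concat (map (\<lambda>b. atom (In (bit_symbol b)) [Push b T, Zero] #
       map (\<lambda>a. imps [atom (In a) [T, i]] (atom (In a) [Push b T, Next i])) [0, 2, 3])
       [False, True])"

text \<open>The second clause makes the guess an initial segment. The third carries it along the
  times, because its bound is checked only at the time at which the clock has halted.\<close>

definition guess_clauses :: "trm \<Rightarrow> trm \<Rightarrow> fm list" where
  "guess_clauses T i =
     [imps [atom Yb [T, Next i]] (atom Yp [T, Next i]),
      imps [atom Yp [T, Next (Next i)]] (atom Yp [T, Next i]),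
      imps [atom Yp [T, i]] (atom Yp [Next T, i])]"

text \<open>The decider must not answer 0, and the guess must not extend beyond the output of the clock.\<close>

definition end_clauses :: "machine \<Rightarrow> machine \<Rightarrow> trm \<Rightarrow> trm \<Rightarrow> fm list" where
  "end_clauses M U T i =
     [imps [atom (St 0 (num_states M)) [T], atom (Sy 0 2 2) [T, Next Zero]] Falsum,
      imps [atom (St 1 (num_states U)) [T], atom (Sy 1 1 0) [T, Next i], atom Yp [T, Next i]] Falsum]"

definition copy_clauses :: "trm \<Rightarrow> trm \<Rightarrow> fm list" where
  "copy_clauses z w =
     [imps [atom Wp [z, w]] (atom Yp [z, w]), imps [atom Yp [z, w]] (atom Wp [z, w]),
      imps [atom Wb [z, w]] (atom Yb [z, w]), imps [atom Yb [z, w]] (atom Wb [z, w])]"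

definition core_clauses :: "machine \<Rightarrow> machine \<Rightarrow> trm \<Rightarrow> trm \<Rightarrow> fm list" where
  "core_clauses M U T i =
     guess_clauses T i @ input_clauses T i @ end_clauses M U T i @
     concat (map (\<lambda>X. init_clauses 0 M X i @ init_clauses 1 U X i) [Zero, Push False T, Push True T]) @
     step_clauses 0 M T i @ step_clauses 1 U T i"

text \<open>The copied atom has variables of its own, so that all copy instances can take
  \<open>Zero\<close> for \<open>T\<close> and \<open>i\<close> and thus share one set of core
  clauses.\<close>

definition matrix :: "machine \<Rightarrow> machine \<Rightarrow> trm \<Rightarrow> trm \<Rightarrow> trm \<Rightarrow> trm \<Rightarrow> fm" where
  "matrix M U T i z w = conjs (copy_clauses z w @ core_clauses M U T i)"

definition search_sentence :: "machine \<Rightarrow> machine \<Rightarrow> fm" where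
  "search_sentence M U = All (All (All (All (matrix M U (Var 3) (Var 2) (Var 1) (Var 0)))))"

section \<open>Runs\<close>

definition config_ok :: "machine \<Rightarrow> config \<Rightarrow> bool" where
  "config_ok M c \<longleftrightarrow> fst c \<le> num_states M \<and> length (snd c) = num_tapes M \<and>
     (\<forall>t \<in> set (snd c). \<forall>i. fst t i < num_symbols M)"

lemma trans_ok:
  assumes "wf_machine M" "config_ok M c" "fst c < num_states M"
    "trans M (fst c) (map read_tape (snd c)) = (q, as)"
  shows "q \<le> num_states M" "length as = num_tapes M" "\<And>a. a \<in> set as \<Longrightarrow> fst a < num_symbols M"
proof -
  have "length (map read_tape (snd c)) = num_tapes M" "set (map read_tape (snd c)) \<subseteq> {..<num_symbols M}"
    using assms by (auto simp: config_ok_def read_tape_def)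
  then have "fst (q, as) \<le> num_states M \<and> length (snd (q, as)) = num_tapes M \<and>
      (\<forall>(s, d) \<in> set (snd (q, as)). s < num_symbols M)"
    using assms unfolding wf_machine_def by metis
  then show "q \<le> num_states M" "length as = num_tapes M" "\<And>a. a \<in> set as \<Longrightarrow> fst a < num_symbols M"
    by auto
qed

lemma step_unfold:
  assumes "wf_machine M" "config_ok M c" "fst c < num_states M"
    "trans M (fst c) (map read_tape (snd c)) = (q, as)"
  shows "step M c = (q, map (\<lambda>j. act_tape (as ! j) (snd c ! j)) [0..<num_tapes M])"
proof -
  have "map2 act_tape as (snd c) = map (\<lambda>j. act_tape (as ! j) (snd c ! j)) [0..<num_tapes M]"
    using trans_ok[OF assms] assms(2) by (intro nth_equalityI) (auto simp: config_ok_def)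
  then show ?thesis
    using assms by (simp add: step_def)
qed

lemma config_ok_step:
  assumes "wf_machine M" "config_ok M c"
  shows "config_ok M (step M c)"
proof (cases "fst c < num_states M")
  case True
  obtain q as where tr: "trans M (fst c) (map read_tape (snd c)) = (q, as)" by fastforce
  show ?thesis
    using trans_ok[OF assms True tr] assms(2)
    by (auto simp: step_unfold[OF assms True tr] config_ok_def act_tape_def)
qed (use assms in \<open>simp add: step_def\<close>)

lemma config_ok_run: "wf_machine M \<Longrightarrow> config_ok M c \<Longrightarrow> config_ok M ((step M ^^ t) c)"
  by (induction t) (auto intro: config_ok_step)

lemma config_ok_start: "wf_machine M \<Longrightarrow> config_ok M (start_config M ws)"
  by (auto simp: config_ok_def start_config_def wf_machine_def tape_of_def)

lemma step_halted: "num_states M \<le> fst c \<Longrightarrow> (step M ^^ t) c = c"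
  by (induction t) (auto simp: step_def)

lemma halted_unique:
  assumes "num_states M \<le> fst ((step M ^^ s) c)" "num_states M \<le> fst ((step M ^^ t) c)"
  shows "(step M ^^ s) c = (step M ^^ t) c"
proof -
  have *: "(step M ^^ l) c = (step M ^^ k) c" if "k \<le> l" "num_states M \<le> fst ((step M ^^ k) c)" for k l
  proof -
    have "(step M ^^ l) c = (step M ^^ (l - k)) ((step M ^^ k) c)"
      using that(1) by (simp flip: funpow_add[THEN fun_cong, unfolded o_apply])
    then show ?thesis using that(2) by (simp add: step_halted)
  qed
  show ?thesis
    using *[of s t] *[of t s] assms by (cases "s \<le> t") auto
qed

lemma head_bound:
  assumes "wf_machine M" "config_ok M c" "\<forall>t \<in> set (snd c). snd t \<le> h"
  shows "\<forall>t \<in> set (snd (step M c)). snd t \<le> Suc h"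
proof (cases "fst c < num_states M")
  case True
  obtain q as where tr: "trans M (fst c) (map read_tape (snd c)) = (q, as)" by fastforce
  have "snd (snd c ! j) \<le> h" if "j < num_tapes M" for j
    using assms that by (auto simp: config_ok_def)
  then show ?thesis
    by (fastforce simp: step_unfold[OF assms(1,2) True tr] act_tape_def move_head_def split: move.splits)
qed (use assms in \<open>auto simp: step_def le_SucI\<close>)

section \<open>Assignments reflect runs\<close>

abbreviation numeral_trm :: "nat \<Rightarrow> trm" where
  "numeral_trm i \<equiv> (Next ^^ i) Zero"

definition reflects :: "(nat \<times> trm list \<Rightarrow> bool) \<Rightarrow> nat \<Rightarrow> trm \<Rightarrow> config \<Rightarrow> nat \<Rightarrow> bool" where
  "reflects \<alpha> \<mu> T c L \<longleftrightarrow> \<alpha> (to_nat (St \<mu> (fst c)), [T]) \<and>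
     (\<forall>j < length (snd c). \<forall>i \<le> L.
        \<alpha> (to_nat (Sy \<mu> j (fst (snd c ! j) i)), [T, numeral_trm i]) \<and>
        (if i = snd (snd c ! j) then \<alpha> (to_nat (Hd \<mu> j), [T, numeral_trm i])
         else \<alpha> (to_nat (Aw \<mu> j), [T, numeral_trm i])))"

text \<open>A step depends on the neighbouring cells, so the region on which the run is reflected shrinks by
  one cell.\<close>

lemma reflects_step:
  assumes wf: "wf_machine M" and ok: "config_ok M c" and run: "fst c < num_states M"
    and head: "\<forall>t \<in> set (snd c). snd t \<le> L"
    and r: "reflects \<alpha> \<mu> T c (Suc L)"
    and cl: "\<And>i p. i \<le> L \<Longrightarrow> p \<in> set (step_clauses \<mu> M T (numeral_trm i)) \<Longrightarrow> truth \<alpha> p"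
  shows "reflects \<alpha> \<mu> (Next T) (step M c) L"
proof -
  let ?k = "num_tapes M" and ?ss = "map read_tape (snd c)"
  obtain q as where tr: "trans M (fst c) ?ss = (q, as)" by fastforce
  note t = trans_ok[OF wf ok run tr]
  have len: "length (snd c) = ?k" using ok by (simp add: config_ok_def)
  have sym: "fst (snd c ! j) i < num_symbols M" if "j < ?k" for i j
    using ok that by (simp add: config_ok_def)
  have hd: "snd (snd c ! j) \<le> L" if "j < ?k" for j
    using head that len by simp
  have St: "\<alpha> (to_nat (St \<mu> (fst c)), [T])"
    using r by (simp add: reflects_def)
  have Sy: "\<alpha> (to_nat (Sy \<mu> j (fst (snd c ! j) i)), [T, numeral_trm i])" if "j < ?k" "i \<le> Suc L" for i j
    using r that len by (simp add: reflects_def)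
  have Hd: "\<alpha> (to_nat (Hd \<mu> j), [T, numeral_trm (snd (snd c ! j))])" if "j < ?k" for j
    using r that len le_SucI[OF hd[OF that]] by (auto simp: reflects_def)
  have Aw: "\<alpha> (to_nat (Aw \<mu> j), [T, numeral_trm i])" if "j < ?k" "i \<le> Suc L" "i \<noteq> snd (snd c ! j)" for i j
    using r that len by (auto simp: reflects_def)
  have keep: "\<alpha> (to_nat (Sy \<mu> j a), [Next T, numeral_trm i])"
    if "j < ?k" "i \<le> L" "a < num_symbols M" "\<alpha> (to_nat (Sy \<mu> j a), [T, numeral_trm i])"
      "\<alpha> (to_nat (Aw \<mu> j), [T, numeral_trm i])" for i j a
  proof -
    have "imps [atom (Aw \<mu> j) [T, numeral_trm i], atom (Sy \<mu> j a) [T, numeral_trm i]]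
        (atom (Sy \<mu> j a) [Next T, numeral_trm i]) \<in> set (step_clauses \<mu> M T (numeral_trm i))"
      using that unfolding step_clauses_def by force
    from cl[OF that(2) this] show ?thesis using that by simp
  qed
  \<comment> \<open>The reading clause is used at the cell under the head, which \<open>head\<close>
    places among the instantiated cells.\<close>
  have read: "\<alpha> (to_nat (Rd \<mu> j (?ss ! j)), [T])" if j: "j < ?k" for j
  proof -
    let ?i = "numeral_trm (snd (snd c ! j))" and ?a = "?ss ! j"
    have a: "?a = fst (snd c ! j) (snd (snd c ! j))" using j len by (simp add: read_tape_def)
    have "imps [atom (Hd \<mu> j) [T, ?i], atom (Sy \<mu> j ?a) [T, ?i]] (atom (Rd \<mu> j ?a) [T])
        \<in> set (step_clauses \<mu> M T ?i)"
      using j sym[OF j] a unfolding step_clauses_def by force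
    from cl[OF hd[OF j] this] show ?thesis
      using Hd[OF j] Sy[OF j le_SucI[OF hd[OF j]]] a by simp
  qed
  \<comment> \<open>The premises of a transition clause mention no cell, so the actions become
    available at each cell \<open>i\<close> in turn.\<close>
  have rule: "\<alpha> (to_nat (St \<mu> q), [Next T])"
      "j < ?k \<Longrightarrow> p \<in> set (act_clauses \<mu> j (as ! j) T (numeral_trm i)) \<Longrightarrow> truth \<alpha> p"
    if i: "i \<le> L" for i j p
  proof -
    let ?p = "imps (atom (St \<mu> (fst c)) [T] # map (\<lambda>j. atom (Rd \<mu> j (?ss ! j)) [T]) [0..<?k])
         (conjs (atom (St \<mu> (fst (trans M (fst c) ?ss))) [Next T] #
            concat (map (\<lambda>j. act_clauses \<mu> j (snd (trans M (fst c) ?ss) ! j) T (numeral_trm i)) [0..<?k])))"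
    have "?ss \<in> set (List.n_lists ?k [0..<num_symbols M])"
      using ok by (auto simp: set_n_lists config_ok_def read_tape_def)
    then have "?p \<in> set (step_clauses \<mu> M T (numeral_trm i))"
      unfolding step_clauses_def set_append set_concat set_map
      by (intro UnI2 UN_I[of "fst c"] imageI) (use run in auto)
    from cl[OF i this] have *: "truth \<alpha> (atom (St \<mu> q) [Next T])"
        "\<forall>j < ?k. \<forall>p \<in> set (act_clauses \<mu> j (as ! j) T (numeral_trm i)). truth \<alpha> p"
      using St read by (auto simp: tr)
    then show "\<alpha> (to_nat (St \<mu> q), [Next T])"
      "j < ?k \<Longrightarrow> p \<in> set (act_clauses \<mu> j (as ! j) T (numeral_trm i)) \<Longrightarrow> truth \<alpha> p"
      by auto
  qed
  have cell: "\<alpha> (to_nat (Sy \<mu> j (fst (act_tape (as ! j) (snd c ! j)) i)), [Next T, numeral_trm i])"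
    if "j < ?k" "i \<le> L" for i j
  proof (cases "i = snd (snd c ! j)")
    case True
    have "imps [atom (Hd \<mu> j) [T, numeral_trm i]] (atom (Sy \<mu> j (fst (as ! j))) [Next T, numeral_trm i])
        \<in> set (act_clauses \<mu> j (as ! j) T (numeral_trm i))"
      by (simp add: act_clauses_def)
    from rule(2)[OF that(2,1) this] show ?thesis
      using Hd[OF that(1)] True by (simp add: act_tape_def)
  next
    case False
    then show ?thesis
      using keep[OF that sym[OF that(1)]] Sy[OF that(1)] Aw[OF that(1)] that by (simp add: act_tape_def)
  qed
  have move: "if i = move_head (snd (as ! j)) (snd (snd c ! j))
      then \<alpha> (to_nat (Hd \<mu> j), [Next T, numeral_trm i])
      else \<alpha> (to_nat (Aw \<mu> j), [Next T, numeral_trm i])" if j: "j < ?k" and i: "i \<le> L" for i j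
  proof -
    let ?h = "snd (snd c ! j)"
    have mv: "\<forall>p \<in> set (move_clauses \<mu> j (snd (as ! j)) T (numeral_trm i)). truth \<alpha> p"
      if "i \<le> L" for i
      using rule(2)[OF that j] by (simp add: act_clauses_def)
    have Hd': "\<alpha> (to_nat (Hd \<mu> j), [T, numeral_trm i])" if "i = ?h" for i
      using Hd[OF j] that by simp
    show ?thesis
    proof (cases "snd (as ! j)")
      case MStay
      then show ?thesis
        using mv[of i] Hd'[of i] Aw[of j i] i j by (auto simp: move_head_def)
    next
      case MRight
      show ?thesis
      proof (cases i)
        case 0
        then show ?thesis using mv[of 0] MRight by (auto simp: move_head_def)
      next
        case (Suc i')
        then show ?thesis
          using mv[of i'] Hd'[of i'] Aw[of j i'] i j MRight by (auto simp: move_head_def)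
      qed
    next
      \<comment> \<open>Only here do the premises reach to the right of the cell concerned, up to
        \<open>Suc i\<close>; this costs one cell of the region.\<close>
      case MLeft
      show ?thesis
      proof (cases i)
        case 0
        consider "?h = 0" | "?h = 1" | "?h > 1" by linarith
        then show ?thesis
        proof cases
          case 1
          then show ?thesis using mv[of 0] Hd'[of 0] 0 MLeft by (auto simp: move_head_def)
        next
          case 2
          then show ?thesis using mv[of 0] Hd'[of 1] 0 MLeft by (auto simp: move_head_def)
        next
          case 3
          then show ?thesis
            using mv[of 0] Aw[of j 0] Aw[of j 1] 0 j MLeft by (auto simp: move_head_def)
        qed
      next
        case (Suc i')
        consider "?h = Suc i" | "?h \<noteq> Suc i" by blast
        then show ?thesis
        proof cases
          case 1
          then show ?thesis using mv[of i] Hd'[of "Suc i"] i MLeft by (auto simp: move_head_def)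
        next
          case 2
          then show ?thesis
            using mv[of i'] Aw[of j "Suc i"] Suc i j MLeft by (auto simp: move_head_def)
        qed
      qed
    qed
  qed
  show ?thesis
    using rule(1)[of 0] cell move
    by (simp add: step_unfold[OF wf ok run tr] reflects_def act_tape_def)
qed

text \<open>After \<open>s\<close> steps the heads are within \<open>s\<close> and the region is
  \<open>L - s\<close>; the next step needs \<open>s \<le> L - Suc s\<close>, which
  \<open>2 * t \<le> L\<close> guarantees for all \<open>s < t\<close>.\<close>

lemma reflects_run:
  assumes wf: "wf_machine M" and ok: "config_ok M c" and head: "\<forall>t \<in> set (snd c). snd t = 0"
    and r: "reflects \<alpha> \<mu> X c L" and L: "2 * t \<le> L"
    and run: "\<And>s. s < t \<Longrightarrow> fst ((step M ^^ s) c) < num_states M"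
    and cl: "\<And>s i p. s < L \<Longrightarrow> i < L \<Longrightarrow>
      p \<in> set (step_clauses \<mu> M ((Next ^^ s) X) (numeral_trm i)) \<Longrightarrow> truth \<alpha> p"
  shows "reflects \<alpha> \<mu> ((Next ^^ t) X) ((step M ^^ t) c) (L - t)"
proof -
  have "s \<le> t \<Longrightarrow> reflects \<alpha> \<mu> ((Next ^^ s) X) ((step M ^^ s) c) (L - s) \<and>
      (\<forall>t \<in> set (snd ((step M ^^ s) c)). snd t \<le> s)" for s
  proof (induction s)
    case 0
    then show ?case using r head by simp
  next
    case (Suc s)
    let ?c = "(step M ^^ s) c"
    have ok': "config_ok M ?c" using config_ok_run[OF wf ok] .
    have hs: "\<forall>t \<in> set (snd ?c). snd t \<le> s" using Suc by simp
    have "reflects \<alpha> \<mu> (Next ((Next ^^ s) X)) (step M ?c) (L - Suc s)"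
    proof (rule reflects_step[OF wf ok'])
      show "fst ?c < num_states M" using run Suc.prems by simp
      show "\<forall>t \<in> set (snd ?c). snd t \<le> L - Suc s" using hs Suc.prems L by fastforce
      show "reflects \<alpha> \<mu> ((Next ^^ s) X) ?c (Suc (L - Suc s))"
        using Suc Suc_diff_Suc[of s L] L by simp
      show "truth \<alpha> p" if "i \<le> L - Suc s" "p \<in> set (step_clauses \<mu> M ((Next ^^ s) X) (numeral_trm i))" for i p
        using cl[of s i p] that Suc.prems L by simp
    qed
    then show ?case using head_bound[OF wf ok' hs] by simp
  qed
  then show ?thesis by simp
qed

text \<open>Only working states have transition clauses, so a run can be followed just to its first
  halt; \<open>halted_unique\<close> identifies that with the given halting configuration.\<close>

lemma first_halting_time:
  assumes "num_states M \<le> fst ((step M ^^ t) c)"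
  obtains s where "s \<le> t" "(step M ^^ s) c = (step M ^^ t) c"
    "\<And>r. r < s \<Longrightarrow> fst ((step M ^^ r) c) < num_states M"
proof -
  define s where "s = (LEAST s. num_states M \<le> fst ((step M ^^ s) c))"
  have "num_states M \<le> fst ((step M ^^ s) c)"
    unfolding s_def by (rule LeastI[where P = "\<lambda>s. num_states M \<le> fst ((step M ^^ s) c)", OF assms])
  moreover have "s \<le> t" unfolding s_def by (rule Least_le[where P = "\<lambda>s. num_states M \<le> fst ((step M ^^ s) c)", OF assms])
  moreover have "fst ((step M ^^ r) c) < num_states M" if "r < s" for r
    using not_less_Least[of r "\<lambda>s. num_states M \<le> fst ((step M ^^ s) c)"] that
    unfolding s_def by (simp add: not_le)
  ultimately show ?thesis using that halted_unique assms by blast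
qed

section \<open>Start configurations forced by an assignment\<close>

primrec string_trm :: "bool list \<Rightarrow> trm" where
  "string_trm [] = Zero"
| "string_trm (b # w) = Push b (string_trm w)"

text \<open>Prepending a bit shifts the input by one cell, so the atoms for a string come from those
  for its tail. This is why all suffixes of the input must occur as times in the query.\<close>

lemma input_reflected:
  assumes "\<And>v i p. suffix v w \<Longrightarrow> i < N \<Longrightarrow>
      p \<in> set (input_clauses (string_trm v) (numeral_trm i)) \<Longrightarrow> truth \<alpha> p" "i < N"
  shows "\<alpha> (to_nat (In (tape_of w (Suc i))), [string_trm w, numeral_trm i])"
  using assms
proof (induction w arbitrary: i)
  case Nil
  then show ?case
    using Nil.prems(1)[of "[]" i "atom (In 0) [Zero, numeral_trm i]"]
    by (simp add: input_clauses_def tape_of_def)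
next
  case (Cons b w)
  show ?case
  proof (cases i)
    case 0
    have "atom (In (bit_symbol b)) [Push b (string_trm w), Zero] \<in> set (input_clauses (string_trm w) Zero)"
      by (cases b) (auto simp: input_clauses_def)
    then have "truth \<alpha> (atom (In (bit_symbol b)) [Push b (string_trm w), Zero])"
      using Cons.prems(1)[of w 0 "atom (In (bit_symbol b)) [Push b (string_trm w), Zero]"] Cons.prems(2)
      by (simp add: suffix_ConsI)
    then show ?thesis using 0 by (cases b) (simp_all add: tape_of_def)
  next
    case (Suc j)
    let ?a = "tape_of w (Suc j)"
    have a: "?a \<in> {0, 2, 3}" by (auto simp: tape_of_def)
    have IH: "\<alpha> (to_nat (In ?a), [string_trm w, numeral_trm j])"
    proof (rule Cons.IH)
      show "truth \<alpha> p" if "suffix v w" "i < N"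
        "p \<in> set (input_clauses (string_trm v) (numeral_trm i))" for v i p
        using Cons.prems(1)[of v i p] that by (simp add: suffix_ConsI)
    qed (use Cons.prems Suc in simp)
    have "imps [atom (In ?a) [string_trm w, numeral_trm j]]
        (atom (In ?a) [Push b (string_trm w), Next (numeral_trm j)]) \<in>
        set (input_clauses (string_trm w) (numeral_trm j))"
      using a unfolding input_clauses_def by (cases b) auto
    from Cons.prems(1)[OF _ _ this] have "\<alpha> (to_nat (In ?a), [Push b (string_trm w), Next (numeral_trm j)])"
      using IH Cons.prems(2) Suc by (simp add: suffix_ConsI)
    moreover have "tape_of (b # w) (Suc i) = ?a"
      using Suc by (simp add: tape_of_def)
    ultimately show ?thesis using Suc by simp
  qed
qed

text \<open>The term \<open>X\<close> does not determine the second tape of the decider: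
  \<open>guess\<close> says that its string is the one \<open>\<alpha>\<close> spells out by
  \<open>Yp\<close> and \<open>Yb\<close>.\<close>

lemma start_reflected:
  assumes init: "\<And>i p. i < N \<Longrightarrow> p \<in> set (init_clauses \<mu> M X (numeral_trm i)) \<Longrightarrow> truth \<alpha> p"
    and inp: "\<And>i. i < N \<Longrightarrow> \<alpha> (to_nat (In (tape_of (hd ws) (Suc i))), [X, numeral_trm i])"
    and guess: "\<And>i. \<mu> = 0 \<Longrightarrow> i < N \<Longrightarrow> tape_of (ws ! 1) (Suc i) =
        (if \<alpha> (to_nat Yb, [X, numeral_trm (Suc i)]) then 3
         else if \<alpha> (to_nat Yp, [X, numeral_trm (Suc i)]) then 2 else 0)"
    and "0 < N" and ws: "length ws = (if \<mu> = 0 then 2 else 1)"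
  shows "reflects \<alpha> \<mu> X (start_config M ws) N"
proof -
  have init': "truth \<alpha> p" if "p \<in> set (init_clauses \<mu> M X (numeral_trm i))" "i < N" for i p
    using init that by blast
  have inits: "\<forall>p \<in> set (init_clauses \<mu> M X (numeral_trm i)). truth \<alpha> p" if "i < N" for i
    using init that by blast
  have "\<alpha> (to_nat (Sy \<mu> j (tape_of (if j < length ws then ws ! j else []) i)), [X, numeral_trm i]) \<and>
        (if i = 0 then \<alpha> (to_nat (Hd \<mu> j), [X, numeral_trm i])
         else \<alpha> (to_nat (Aw \<mu> j), [X, numeral_trm i]))"
    if j: "j < num_tapes M" and i: "i \<le> N" for i j
  proof (cases i)
    case 0
    then show ?thesis
      using inits[of 0] j \<open>0 < N\<close> by (simp add: init_clauses_def tape_of_def ball_Un)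
  next
    case (Suc i')
    then have i': "i' < N" using i by simp
    have "\<alpha> (to_nat (Aw \<mu> j), [X, numeral_trm i])"
      using inits[OF i'] j Suc by (simp add: init_clauses_def ball_Un)
    moreover have "\<alpha> (to_nat (Sy \<mu> j (tape_of (if j < length ws then ws ! j else []) i)), [X, numeral_trm i])"
    proof -
      consider "j = 0" | "j = 1" "\<mu> = 0" | "j \<ge> 1" "\<not> (\<mu> = 0 \<and> j = 1)" by linarith
      then show ?thesis
      proof cases
        case 1
        let ?a = "tape_of (hd ws) (Suc i')"
        have "?a \<in> {0, 2, 3}" by (auto simp: tape_of_def)
        then have "imps [atom (In ?a) [X, numeral_trm i']] (atom (Sy \<mu> 0 ?a) [X, Next (numeral_trm i')])
            \<in> set (init_clauses \<mu> M X (numeral_trm i'))"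
          by (auto simp: init_clauses_def)
        moreover have "hd ws = ws ! 0" "0 < length ws" using ws by (cases ws; simp split: if_splits)+
        ultimately show ?thesis using init'[OF _ i'] inp[OF i'] 1 Suc by fastforce
      next
        case 2
        have "p \<in> set (init_clauses 0 M X (numeral_trm i'))"
          if "p \<in> {imps [atom Yb [X, numeral_trm i]] (atom (Sy \<mu> j 3) [X, numeral_trm i]),
             imps [atom Yp [X, numeral_trm i]] (Or (atom Yb [X, numeral_trm i]) (atom (Sy \<mu> j 2) [X, numeral_trm i])),
             Or (atom Yp [X, numeral_trm i]) (atom (Sy \<mu> j 0) [X, numeral_trm i])}" for p
          using that 2 j Suc by (auto simp: init_clauses_def intro!: bexI[of _ 1])
        then show ?thesis
          using init'[OF _ i'] guess[OF 2(2) i'] 2 Suc ws by fastforce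
      next
        case 3
        then have "atom (Sy \<mu> j 0) [X, Next (numeral_trm i')] \<in> set (init_clauses \<mu> M X (numeral_trm i'))"
          using j by (auto simp: init_clauses_def intro!: bexI[of _ j])
        from init'[OF this i'] have "\<alpha> (to_nat (Sy \<mu> j 0), [X, numeral_trm i])"
          using Suc by simp
        moreover have "\<not> j < length ws" using ws 3 by (auto split: if_splits)
        ultimately show ?thesis using Suc by (simp add: tape_of_def)
      qed
    qed
    ultimately show ?thesis using Suc by simp
  qed
  moreover have "\<alpha> (to_nat (St \<mu> 0), [X])"
    using inits[of 0] \<open>0 < N\<close> by (simp add: init_clauses_def)
  ultimately show ?thesis
    by (simp add: reflects_def start_config_def split del: if_split cong: if_cong)
qed

lemma run_reflected:
  assumes wf: "wf_machine M" and start: "reflects \<alpha> \<mu> X (start_config M ws) N"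
    and halt: "(step M ^^ t) (start_config M ws) = (num_states M, ts)" and t: "2 * t \<le> N"
    and cl: "\<And>s i p. s < N \<Longrightarrow> i < N \<Longrightarrow>
      p \<in> set (step_clauses \<mu> M ((Next ^^ s) X) (numeral_trm i)) \<Longrightarrow> truth \<alpha> p"
  obtains s where "s \<le> t" "reflects \<alpha> \<mu> ((Next ^^ s) X) (num_states M, ts) (N - t)"
proof -
  obtain s where s: "s \<le> t" "(step M ^^ s) (start_config M ws) = (num_states M, ts)"
      "\<And>r. r < s \<Longrightarrow> fst ((step M ^^ r) (start_config M ws)) < num_states M"
    using first_halting_time[of M t "start_config M ws"] halt by auto
  have "reflects \<alpha> \<mu> ((Next ^^ s) X) ((step M ^^ s) (start_config M ws)) (N - s)"
  proof (rule reflects_run[OF wf config_ok_start[OF wf] _ start])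
    show "\<forall>t \<in> set (snd (start_config M ws)). snd t = 0" by (auto simp: start_config_def)
    show "2 * s \<le> N" using t s by simp
  qed (use s cl in auto)
  then have "reflects \<alpha> \<mu> ((Next ^^ s) X) (num_states M, ts) (N - t)"
    using s(1,2) by (auto simp: reflects_def)
  then show ?thesis using that s(1) by blast
qed

text \<open>The suffixes serve the input atoms and, under one more \<open>Push\<close>, the start
  configurations; the successors serve the runs.\<close>

definition time_trms :: "bool list \<Rightarrow> nat \<Rightarrow> trm set" where
  "time_trms x N = string_trm ` {v. suffix v x} \<union> (\<lambda>s. (Next ^^ s) (string_trm x)) ` {..<N}"

text \<open>Applied to pairs of values of \<open>Wp\<close> and \<open>Wb\<close>. The guess is an
  initial segment, so it ends at the first absent symbol.\<close>

fun decode :: "bool list \<Rightarrow> bool list" where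
  "decode (True # b # w) = b # decode w"
| "decode w = []"

text \<open>By \<open>m < n\<close> a pair with false first bit precedes \<open>rest\<close>, which
  is therefore never read.\<close>

lemma decode_pairs:
  "l \<le> m \<Longrightarrow> m < n \<Longrightarrow> decode (concat (map (\<lambda>k. [k < m, h k]) [l..<n]) @ rest) = map h [l..<m]"
proof (induction "m - l" arbitrary: l)
  case 0
  then show ?case by (simp add: upt_conv_Cons)
next
  case (Suc d)
  then have "l < m" by simp
  then show ?case
    using Suc.hyps(1)[of "Suc l"] Suc.hyps(2) Suc.prems upt_conv_Cons[of l n] upt_conv_Cons[of l m] by simp
qed

section \<open>The guess made by a satisfying assignment\<close>

lemma reflects_symbol:
  "reflects \<alpha> \<mu> T (q, ts) L \<Longrightarrow> j < length ts \<Longrightarrow> i \<le> L \<Longrightarrow>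
    \<alpha> (to_nat (Sy \<mu> j (fst (ts ! j) i)), [T, numeral_trm i])"
  by (simp add: reflects_def)

text \<open>In the bound on \<open>N\<close>, \<open>2 * t\<close> is for following the clock and
  \<open>P + 2\<close> keeps cell \<open>P + 1\<close> among the instantiated cells and within the
  region that remains.\<close>

locale clauses_hold =
  fixes M U :: machine and \<alpha> :: "nat \<times> trm list \<Rightarrow> bool" and x :: "bool list" and N P t :: nat
    and ts :: "tape list"
  assumes wf: "wf_machine M" "wf_machine U" and tapes: "2 < num_tapes M" "1 < num_tapes U"
    and core: "T \<in> time_trms x N \<Longrightarrow> i < N \<Longrightarrow> p \<in> set (core_clauses M U T (numeral_trm i)) \<Longrightarrow> truth \<alpha> p"
    and clock: "(step U ^^ t) (start_config U [x]) = (num_states U, ts)"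
      "fst (ts ! 1) = tape_of (replicate P True)"
    and N: "2 * t + P + 2 \<le> N"
begin

abbreviation X :: trm where
  "X \<equiv> string_trm x"

abbreviation Yp_at :: "nat \<Rightarrow> bool" where
  "Yp_at k \<equiv> \<alpha> (to_nat Yp, [X, numeral_trm (Suc k)])"

abbreviation Yb_at :: "nat \<Rightarrow> bool" where
  "Yb_at k \<equiv> \<alpha> (to_nat Yb, [X, numeral_trm (Suc k)])"

lemma X_time: "s < N \<Longrightarrow> (Next ^^ s) X \<in> time_trms x N"
  by (auto simp: time_trms_def)

lemma X_in: "X \<in> time_trms x N"
  by (auto simp: time_trms_def)

lemma step_core:
  assumes "s < N" "i < N"
    "p \<in> set (step_clauses 0 M ((Next ^^ s) X) (numeral_trm i)) \<union>
         set (step_clauses 1 U ((Next ^^ s) X) (numeral_trm i))"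
  shows "truth \<alpha> p"
  using core[OF X_time[OF assms(1)] assms(2), of p] assms(3) by (auto simp: core_clauses_def)

lemma init_core:
  assumes "i < N" "p \<in> set (init_clauses 0 M X (numeral_trm i)) \<union> set (init_clauses 1 U X (numeral_trm i))"
  shows "truth \<alpha> p"
proof -
  \<comment> \<open>For nonempty \<open>x\<close> the start configuration at \<open>X\<close> is
    found in the instance whose time is the tail of \<open>x\<close>.\<close>
  obtain T where T: "T \<in> time_trms x N" "X \<in> {Zero, Push False T, Push True T}"
  proof (cases x)
    case Nil
    then show ?thesis using that X_in by auto
  next
    case (Cons b v)
    then show ?thesis using that[of "string_trm v"]
      by (cases b) (auto simp: time_trms_def suffix_ConsI)
  qed
  then have "p \<in> set (core_clauses M U T (numeral_trm i))"
    using assms(2) by (auto simp: core_clauses_def)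
  then show ?thesis using core T assms(1) by blast
qed

lemma input_core:
  assumes "i < N"
  shows "\<alpha> (to_nat (In (tape_of x (Suc i))), [X, numeral_trm i])"
proof (rule input_reflected[OF _ assms])
  show "truth \<alpha> p" if "suffix v x" "i < N" "p \<in> set (input_clauses (string_trm v) (numeral_trm i))" for v i p
    using core[of "string_trm v" i p] that by (auto simp: core_clauses_def time_trms_def)
qed

lemma guess_core:
  assumes "s < N" "i < N"
  shows "\<alpha> (to_nat Yb, [(Next ^^ s) X, numeral_trm (Suc i)]) \<Longrightarrow> \<alpha> (to_nat Yp, [(Next ^^ s) X, numeral_trm (Suc i)])"
    "\<alpha> (to_nat Yp, [(Next ^^ s) X, numeral_trm (Suc (Suc i))]) \<Longrightarrow> \<alpha> (to_nat Yp, [(Next ^^ s) X, numeral_trm (Suc i)])"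
    "\<alpha> (to_nat Yp, [(Next ^^ s) X, numeral_trm i]) \<Longrightarrow> \<alpha> (to_nat Yp, [(Next ^^ Suc s) X, numeral_trm i])"
proof -
  have "\<forall>p \<in> set (guess_clauses ((Next ^^ s) X) (numeral_trm i)). truth \<alpha> p"
    using core[OF X_time[OF assms(1)] assms(2)] by (auto simp: core_clauses_def)
  then show "\<alpha> (to_nat Yb, [(Next ^^ s) X, numeral_trm (Suc i)]) \<Longrightarrow> \<alpha> (to_nat Yp, [(Next ^^ s) X, numeral_trm (Suc i)])"
    "\<alpha> (to_nat Yp, [(Next ^^ s) X, numeral_trm (Suc (Suc i))]) \<Longrightarrow> \<alpha> (to_nat Yp, [(Next ^^ s) X, numeral_trm (Suc i)])"
    "\<alpha> (to_nat Yp, [(Next ^^ s) X, numeral_trm i]) \<Longrightarrow> \<alpha> (to_nat Yp, [(Next ^^ Suc s) X, numeral_trm i])"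
    by (auto simp: guess_clauses_def)
qed

lemma end_core:
  assumes "s < N" "i < N"
  shows "\<not> (\<alpha> (to_nat (St 0 (num_states M)), [(Next ^^ s) X]) \<and> \<alpha> (to_nat (Sy 0 2 2), [(Next ^^ s) X, Next Zero]))"
    "\<not> (\<alpha> (to_nat (St 1 (num_states U)), [(Next ^^ s) X]) \<and> \<alpha> (to_nat (Sy 1 1 0), [(Next ^^ s) X, numeral_trm (Suc i)])
       \<and> \<alpha> (to_nat Yp, [(Next ^^ s) X, numeral_trm (Suc i)]))"
proof -
  have "\<forall>p \<in> set (end_clauses M U ((Next ^^ s) X) (numeral_trm i)). truth \<alpha> p"
    using core[OF X_time[OF assms(1)] assms(2)] by (auto simp: core_clauses_def)
  then show "\<not> (\<alpha> (to_nat (St 0 (num_states M)), [(Next ^^ s) X]) \<and> \<alpha> (to_nat (Sy 0 2 2), [(Next ^^ s) X, Next Zero]))"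
    "\<not> (\<alpha> (to_nat (St 1 (num_states U)), [(Next ^^ s) X]) \<and> \<alpha> (to_nat (Sy 1 1 0), [(Next ^^ s) X, numeral_trm (Suc i)])
       \<and> \<alpha> (to_nat Yp, [(Next ^^ s) X, numeral_trm (Suc i)]))"
    by (auto simp: end_clauses_def)
qed

text \<open>A symbol in cell \<open>P + 1\<close> would persist to the halting time of the clock,
  whose output is blank there, against \<open>end_clauses\<close>.\<close>

lemma guess_bounded: "\<not> Yp_at P"
proof -
  have start: "reflects \<alpha> 1 X (start_config U [x]) N"
    by (rule start_reflected) (use init_core input_core N in auto)
  obtain s where s: "s \<le> t" "reflects \<alpha> 1 ((Next ^^ s) X) (num_states U, ts) (N - t)"
    by (rule run_reflected[OF wf(2) start clock(1)]) (use N step_core in auto)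
  have len: "1 < length ts"
    using config_ok_run[OF wf(2) config_ok_start[OF wf(2)], of t "[x]"] clock tapes
    by (simp add: config_ok_def)
  have "\<alpha> (to_nat (Sy 1 1 (fst (ts ! 1) (Suc P))), [(Next ^^ s) X, numeral_trm (Suc P)])"
    by (rule reflects_symbol[OF s(2) len]) (use N in simp)
  then have "\<alpha> (to_nat (Sy 1 1 0), [(Next ^^ s) X, numeral_trm (Suc P)])"
    using clock(2) by (simp add: tape_of_def)
  moreover have "\<alpha> (to_nat (St 1 (num_states U)), [(Next ^^ s) X])"
    using s(2) by (simp add: reflects_def)
  ultimately have no: "\<not> \<alpha> (to_nat Yp, [(Next ^^ s) X, numeral_trm (Suc P)])"
    using end_core(2)[of s P] s(1) N by auto
  have "r \<le> s \<Longrightarrow> Yp_at P \<Longrightarrow> \<alpha> (to_nat Yp, [(Next ^^ r) X, numeral_trm (Suc P)])" for r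
    by (induction r) (use guess_core(3)[of _ "Suc P"] s(1) N in auto)
  then show ?thesis using no by blast
qed

definition guess_length :: nat where
  "guess_length = (LEAST k. \<not> Yp_at k)"

definition guess :: "bool list" where
  "guess = map Yb_at [0..<guess_length]"

lemma guess_length_le: "guess_length \<le> P"
  unfolding guess_length_def using guess_bounded by (rule Least_le)

lemma Yp_at_iff:
  assumes "k < N"
  shows "Yp_at k \<longleftrightarrow> k < guess_length"
proof
  assume "k < guess_length"
  then show "Yp_at k" unfolding guess_length_def using not_less_Least by blast
next
  have "\<not> Yp_at guess_length"
    unfolding guess_length_def using guess_bounded by (rule LeastI)
  then have "k < N \<Longrightarrow> guess_length \<le> k \<Longrightarrow> \<not> Yp_at k" for k
  proof (induction k)
    case (Suc k)
    then show ?case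
      using guess_core(2)[of 0 k] by (cases "guess_length = Suc k") auto
  qed auto
  then show "Yp_at k \<Longrightarrow> k < guess_length"
    using assms not_le by blast
qed

text \<open>Had the decider answered 0, the assignment would reflect a 2 in the first cell after the
  marker of its output tape at the halting time, which \<open>end_clauses\<close> forbids.\<close>

lemma guess_correct:
  assumes halt: "(step M ^^ u) (start_config M [x, guess]) = (num_states M, us)" "fst (us ! 2) = tape_of [r]"
    and u: "2 * u + 2 \<le> N"
  shows r
proof (rule ccontr)
  assume r: "\<not> r"
  have tape: "tape_of guess (Suc i) = (if Yb_at i then 3 else if Yp_at i then 2 else 0)" if "i < N" for i
    using Yp_at_iff[OF that] guess_core(1)[of 0 i] that by (auto simp: tape_of_def guess_def)
  have start: "reflects \<alpha> 0 X (start_config M [x, guess]) N"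
    by (rule start_reflected) (use init_core input_core tape N in auto)
  obtain s where s: "s \<le> u" "reflects \<alpha> 0 ((Next ^^ s) X) (num_states M, us) (N - u)"
    by (rule run_reflected[OF wf(1) start halt(1)]) (use u step_core in auto)
  have len: "2 < length us"
    using config_ok_run[OF wf(1) config_ok_start[OF wf(1)], of u "[x, guess]"] halt tapes
    by (simp add: config_ok_def)
  have "\<alpha> (to_nat (Sy 0 2 (fst (us ! 2) (Suc 0))), [(Next ^^ s) X, numeral_trm (Suc 0)])"
    by (rule reflects_symbol[OF s(2) len]) (use u in simp)
  then have "\<alpha> (to_nat (Sy 0 2 2), [(Next ^^ s) X, Next Zero])"
    using halt(2) r by (simp add: tape_of_def)
  moreover have "\<alpha> (to_nat (St 0 (num_states M)), [(Next ^^ s) X])"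
    using s(2) by (simp add: reflects_def)
  ultimately show False
    using end_core(1)[of s 0] s(1) u by auto
qed

end

section \<open>The intended model\<close>

text \<open>An element \<open>(w, t)\<close> of the model is read as the moment \<open>t\<close> of the computations on the
  instance \<open>w\<close> when it is a time, and as the cell \<open>t\<close> when it is a position.\<close>

type_synonym point = "bool list \<times> nat"

text \<open>\<open>Push\<close> resets the second component even above arguments that are not
  strings; thus every term at which a start configuration is imposed denotes a time 0.\<close>

definition fun_interp :: "nat \<Rightarrow> point list \<Rightarrow> point" where
  "fun_interp f ds =
     (if f = 0 then ([], 0) else if f = 1 then (fst (ds ! 0), Suc (snd (ds ! 0)))
      else ((f = 3) # fst (ds ! 0), 0))"

text \<open>The conditions on \<open>Y\<close> refer to every time at which the machine has halted,
  since the end clauses range over all times.\<close>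

locale search_model =
  fixes M U :: machine and Y :: "bool list \<Rightarrow> bool list"
  assumes wf: "wf_machine M" "wf_machine U" and tapes: "2 < num_tapes M" "1 < num_tapes U"
    and accepts: "fst ((step M ^^ t) (start_config M [w, Y w])) = num_states M \<Longrightarrow>
      fst (snd ((step M ^^ t) (start_config M [w, Y w])) ! 2) 1 \<noteq> 2"
    and clock: "fst ((step U ^^ t) (start_config U [w])) = num_states U \<Longrightarrow>
      length (Y w) \<le> i \<or> fst (snd ((step U ^^ t) (start_config U [w])) ! 1) (Suc i) \<noteq> 0"
begin

definition run :: "nat \<Rightarrow> point \<Rightarrow> config" where
  "run \<mu> d = (if \<mu> = 0 then (step M ^^ snd d) (start_config M [fst d, Y (fst d)])
             else (step U ^^ snd d) (start_config U [fst d]))"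

abbreviation cell :: "nat \<Rightarrow> nat \<Rightarrow> point \<Rightarrow> tape" where
  "cell \<mu> j d \<equiv> snd (run \<mu> d) ! j"

text \<open>Only the string of the first point matters, so persistence in time is automatic. Cell
  \<open>k\<close> holds bit \<open>k - 1\<close> of the solution; the marker cell 0 counts as
  guessed.\<close>

definition guessed :: "point list \<Rightarrow> bool" where
  "guessed ds \<longleftrightarrow> snd (ds ! 1) \<le> length (Y (fst (ds ! 0)))"

definition guessed_true :: "point list \<Rightarrow> bool" where
  "guessed_true ds \<longleftrightarrow> guessed ds \<and> snd (ds ! 1) \<noteq> 0 \<and> Y (fst (ds ! 0)) ! (snd (ds ! 1) - 1)"

fun meaning :: "pname \<Rightarrow> point list \<Rightarrow> bool" where
  "meaning (St \<mu> q) ds \<longleftrightarrow> fst (run \<mu> (ds ! 0)) = q"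
| "meaning (Rd \<mu> j a) ds \<longleftrightarrow> read_tape (cell \<mu> j (ds ! 0)) = a"
| "meaning (Sy \<mu> j a) ds \<longleftrightarrow> fst (cell \<mu> j (ds ! 0)) (snd (ds ! 1)) = a"
| "meaning (Hd \<mu> j) ds \<longleftrightarrow> snd (cell \<mu> j (ds ! 0)) = snd (ds ! 1)"
| "meaning (Aw \<mu> j) ds \<longleftrightarrow> snd (cell \<mu> j (ds ! 0)) \<noteq> snd (ds ! 1)"
| "meaning (In a) ds \<longleftrightarrow> tape_of (fst (ds ! 0)) (Suc (snd (ds ! 1))) = a"
| "meaning Yp ds \<longleftrightarrow> guessed ds"
| "meaning Yb ds \<longleftrightarrow> guessed_true ds"
| "meaning Wp ds \<longleftrightarrow> guessed ds"
| "meaning Wb ds \<longleftrightarrow> guessed_true ds"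

definition pred_interp :: "nat \<Rightarrow> point list \<Rightarrow> bool" where
  "pred_interp r ds \<longleftrightarrow> meaning (from_nat r) ds"

abbreviation ev :: "(nat \<Rightarrow> point) \<Rightarrow> trm \<Rightarrow> point" where
  "ev \<equiv> eval_trm fun_interp"

definition canonical :: "(nat \<Rightarrow> point) \<Rightarrow> nat \<times> trm list \<Rightarrow> bool" where
  "canonical e = (\<lambda>(r, ts). pred_interp r (map (ev e) ts))"

lemma canonical_atom [simp]: "canonical e (to_nat P, ts) \<longleftrightarrow> meaning P (map (ev e) ts)"
  by (simp add: canonical_def pred_interp_def)

lemma ev_simps [simp]:
  "ev e Zero = ([], 0)"
  "ev e (Next s) = (fst (ev e s), Suc (snd (ev e s)))"
  "ev e (Push b s) = (b # fst (ev e s), 0)"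
  by (auto simp: Zero_def Next_def Push_def fun_interp_def)

text \<open>The clauses hold at all times, also after a halt: the configuration is then constant,
  and no transition clause has a true premise on the state.\<close>

lemma step_clauses_canonical:
  assumes K: "wf_machine K" "config_ok K (run \<mu> (ev e T))"
    and nxt: "run \<mu> (ev e (Next T)) = step K (run \<mu> (ev e T))"
    and p: "p \<in> set (step_clauses \<mu> K T i)"
  shows "truth (canonical e) p"
proof -
  let ?c = "run \<mu> (ev e T)" and ?k = "num_tapes K"
  have nxt': "run \<mu> (fst (ev e T), Suc (snd (ev e T))) = step K ?c"
    using nxt by simp
  have next_cell: "snd (step K ?c) ! j = act_tape (as ! j) (snd ?c ! j)"
    if "fst ?c < num_states K" "trans K (fst ?c) (map read_tape (snd ?c)) = (q, as)" "j < ?k" for j q as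
    using step_unfold[OF K that(1,2)] that(3) by simp
  from p consider
      (read) j a where "p = imps [atom (Hd \<mu> j) [T, i], atom (Sy \<mu> j a) [T, i]] (atom (Rd \<mu> j a) [T])"
    | (keep) j a where "j < ?k"
        "p = imps [atom (Aw \<mu> j) [T, i], atom (Sy \<mu> j a) [T, i]] (atom (Sy \<mu> j a) [Next T, i])"
    | (rule) q ss where "q < num_states K" "length ss = ?k"
        "p = imps (atom (St \<mu> q) [T] # map (\<lambda>j. atom (Rd \<mu> j (ss ! j)) [T]) [0..<?k])
         (conjs (atom (St \<mu> (fst (trans K q ss))) [Next T] #
            concat (map (\<lambda>j. act_clauses \<mu> j (snd (trans K q ss) ! j) T i) [0..<?k])))"
    unfolding step_clauses_def by (auto simp: set_n_lists)
  then show ?thesis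
  proof cases
    case read
    then show ?thesis by (simp add: read_tape_def)
  next
    case keep
    show ?thesis
    proof (cases "fst ?c < num_states K")
      case True
      obtain q as where tr: "trans K (fst ?c) (map read_tape (snd ?c)) = (q, as)" by fastforce
      show ?thesis
        using keep next_cell[OF True tr keep(1)] by (auto simp: nxt' act_tape_def)
    next
      case False
      then have "step K ?c = ?c" by (simp add: step_def)
      then show ?thesis using keep by (simp add: nxt')
    qed
  next
    case rule
    show ?thesis
    proof (cases "fst ?c = q \<and> (\<forall>j < ?k. read_tape (snd ?c ! j) = ss ! j)")
      case False
      then show ?thesis using rule by auto
    next
      case True
      have "map read_tape (snd ?c) = ss"
        using True rule K(2) by (intro nth_equalityI) (auto simp: config_ok_def)
      then obtain q' as where tr: "trans K (fst ?c) (map read_tape (snd ?c)) = (q', as)"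
          and tr': "trans K q ss = (q', as)"
        using True by fastforce
      have run: "fst ?c < num_states K" using True rule by simp
      have "truth (canonical e) r" if "j < ?k" "r \<in> set (act_clauses \<mu> j (as ! j) T i)" for j r
        using that(2) next_cell[OF run tr that(1)]
        by (cases "snd (as ! j)")
           (auto simp: act_clauses_def nxt' act_tape_def move_head_def)
      moreover have "fst (step K ?c) = q'"
        using step_unfold[OF K run tr] by simp
      ultimately show ?thesis
        using rule tr' by (auto simp: nxt')
    qed
  qed
qed

lemma run_ok: "config_ok (if \<mu> = 0 then M else U) (run \<mu> d)"
  using wf by (auto simp: run_def intro!: config_ok_run config_ok_start)

lemma init_clauses_canonical:
  assumes "p \<in> set (init_clauses \<mu> (if \<mu> = 0 then M else U) X i)" "snd (ev e X) = 0"
  shows "truth (canonical e) p"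
proof -
  obtain w where w: "ev e X = (w, 0)" using assms(2) by (metis prod.collapse)
  have start: "run 0 (w, 0) = start_config M [w, Y w]" "\<mu> \<noteq> 0 \<Longrightarrow> run \<mu> (w, 0) = start_config U [w]"
    by (simp_all add: run_def)
  have tape: "tape_of v 0 = Suc 0" "tape_of [] (Suc k) = 0" for v k
    by (simp_all add: tape_of_def)
  \<comment> \<open>With this formula the three guess clauses become a case distinction on one
    symbol.\<close>
  have Y: "tape_of (Y w) (Suc k) = (if guessed_true [(w, 0), (fst (ev e i), Suc k)] then 3
      else if guessed [(w, 0), (fst (ev e i), Suc k)] then 2 else 0)" for k
    by (auto simp: tape_of_def guessed_def guessed_true_def)
  show ?thesis
    using assms(1) tapes unfolding init_clauses_def
    by (auto simp: w start start_config_def Y tape nth_Cons' guessed_true_def split: if_splits)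
qed

lemma core_clauses_canonical:
  assumes "p \<in> set (core_clauses M U T i)"
  shows "truth (canonical e) p"
proof -
  from assms consider
      "p \<in> set (guess_clauses T i)" | "p \<in> set (input_clauses T i)" | "p \<in> set (end_clauses M U T i)"
    | X \<mu> where "X \<in> {Zero, Push False T, Push True T}" "\<mu> \<in> {0, 1}"
        "p \<in> set (init_clauses \<mu> (if \<mu> = 0 then M else U) X i)"
    | \<mu> where "\<mu> \<in> {0, 1}" "p \<in> set (step_clauses \<mu> (if \<mu> = 0 then M else U) T i)"
    unfolding core_clauses_def by fastforce
  then show ?thesis
  proof cases
    case 1
    then show ?thesis by (auto simp: guess_clauses_def guessed_def guessed_true_def)
  next
    case 2
    then show ?thesis by (auto simp: input_clauses_def tape_of_def)
  next
    case 3
    then show ?thesis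
      using accepts[of "snd (ev e T)" "fst (ev e T)"] clock[of "snd (ev e T)" "fst (ev e T)" "snd (ev e i)"]
      by (auto simp: end_clauses_def run_def guessed_def)
  next
    case (4 X \<mu>)
    then show ?thesis by (intro init_clauses_canonical[of p \<mu> X i e]) auto
  next
    case (5 \<mu>)
    show ?thesis
      by (rule step_clauses_canonical[OF _ run_ok _ 5(2)]) (use wf in \<open>auto simp: run_def\<close>)
  qed
qed

lemma matrix_canonical: "truth (canonical e) (matrix M U T i z w)"
  using core_clauses_canonical by (auto simp: matrix_def copy_clauses_def)

end

section \<open>Programs\<close>

lemma polytime_cong:
  assumes "\<And>ws. length ws = n \<Longrightarrow> F ws = G ws"
  shows "polytime n F = polytime n G"
  using assms by (simp add: polytime_def)

lemma exec_For_same: "exec (For v c c) \<sigma> = (exec c ^^ length (\<sigma> v)) \<sigma>"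
proof -
  have "foldr (\<lambda>b. if b then exec c else exec c) w \<sigma> = (exec c ^^ length w) \<sigma>" for w
    by (induction w) auto
  then show ?thesis by simp
qed

primrec emit :: "nat \<Rightarrow> bool list \<Rightarrow> cmd" where
  "emit v [] = Skip"
| "emit v (b # w) = Seq (App v b) (emit v w)"

lemma exec_emit [simp]: "exec (emit v w) \<sigma> = \<sigma>(v := \<sigma> v @ w)"
  by (induction w arbitrary: \<sigma>) auto

lemma emit_simps [simp]:
  "admissible (emit v w)" "ranked r (emit v w)" "vars (emit v w) \<subseteq> {v}" "appended (emit v w) \<subseteq> {v}"
  by (induction w) auto

lemma exec_For_emit:
  "exec (For v (emit u w0) (emit u w1)) \<sigma> =
    \<sigma>(u := \<sigma> u @ concat (map (\<lambda>b. if b then w1 else w0) (rev (\<sigma> v))))"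
proof -
  have "foldr (\<lambda>b. if b then exec (emit u w1) else exec (emit u w0)) w \<sigma> =
      \<sigma>(u := \<sigma> u @ concat (map (\<lambda>b. if b then w1 else w0) (rev w)))" for w
    by (induction w) auto
  then show ?thesis by simp
qed

section \<open>Unary polynomials\<close>

text \<open>Horner's scheme in unary, where variable \<open>a + 1\<close> holds the value for the
  remaining coefficients. A fresh variable per coefficient is what allows a ranking:
  \<open>a\<close> is appended to in loops over \<open>x\<close> and \<open>a + 1\<close>
  only.\<close>

primrec horner :: "nat \<Rightarrow> nat \<Rightarrow> nat list \<Rightarrow> cmd" where
  "horner x a [] = Skip"
| "horner x a (c # cs) =
     Seq (horner x (Suc a) cs)
       (Seq (For (Suc a) (For x (App a True) (App a True)) (For x (App a True) (App a True)))
         (emit a (replicate c True)))"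

lemma exec_append_loop:
  "exec (For x (App a True) (App a True)) \<sigma> = \<sigma>(a := \<sigma> a @ replicate (length (\<sigma> x)) True)"
proof -
  have "(exec (App a True) ^^ n) \<sigma> = \<sigma>(a := \<sigma> a @ replicate n True)" for n
    by (induction n) (auto simp: replicate_append_same)
  then show ?thesis unfolding exec_For_same by simp
qed

lemma exec_horner:
  assumes "x < a" "\<And>v. a \<le> v \<Longrightarrow> \<sigma> v = []"
  shows "exec (horner x a cs) \<sigma> a = replicate (foldr (\<lambda>c v. c + length (\<sigma> x) * v) cs 0) True \<and>
    (\<forall>v < a. exec (horner x a cs) \<sigma> v = \<sigma> v)"
  using assms
proof (induction cs arbitrary: a)
  case (Cons c cs)
  let ?val = "\<lambda>cs. foldr (\<lambda>c v. c + length (\<sigma> x) * v) cs 0"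
  let ?\<rho> = "exec (horner x (Suc a) cs) \<sigma>"
  have IH: "?\<rho> (Suc a) = replicate (?val cs) True" "\<forall>v < Suc a. ?\<rho> v = \<sigma> v"
    using Cons.IH[of "Suc a"] Cons.prems by auto
  define L where "L = For x (App a True) (App a True)"
  have L: "exec L \<tau> = \<tau>(a := \<tau> a @ replicate (length (\<tau> x)) True)" for \<tau>
    unfolding L_def by (rule exec_append_loop)
  have loop: "(exec L ^^ n) ?\<rho> = ?\<rho>(a := replicate (n * length (\<sigma> x)) True)" for n
  proof (induction n)
    case 0
    then show ?case using IH(2) Cons.prems(2)[of a] by auto
  next
    case (Suc n)
    have "(exec L ^^ Suc n) ?\<rho> = exec L (?\<rho>(a := replicate (n * length (\<sigma> x)) True))"
      by (simp only: funpow.simps o_apply Suc.IH)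
    also have "\<dots> = ?\<rho>(a := replicate (n * length (\<sigma> x)) True @ replicate (length (\<sigma> x)) True)"
      using IH(2) Cons.prems(1) L[of "?\<rho>(a := replicate (n * length (\<sigma> x)) True)"] by simp
    finally show ?case by (simp add: replicate_add[symmetric] add.commute)
  qed
  have "exec (For (Suc a) L L) ?\<rho> = ?\<rho>(a := replicate (?val cs * length (\<sigma> x)) True)"
    unfolding exec_For_same IH(1) length_replicate by (rule loop)
  then have "exec (horner x a (c # cs)) \<sigma> =
      (?\<rho>(a := replicate (?val cs * length (\<sigma> x)) True))
        (a := replicate (?val cs * length (\<sigma> x)) True @ replicate c True)"
    by (simp only: horner.simps exec.simps(4) L_def exec_emit fun_upd_same)
  also have "\<dots> = ?\<rho>(a := replicate (?val (c # cs)) True)"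
    by (simp add: replicate_add[symmetric] mult.commute add.commute)
  finally show ?case using IH(2) by simp
qed simp

lemma poly_eq_foldr: "poly q n = foldr (\<lambda>c v. c + n * v) (coeffs q) 0"
  by (simp add: poly_def horner_sum_foldr)

lemma exec_horner_poly:
  assumes "x < a" "\<And>v. a \<le> v \<Longrightarrow> \<sigma> v = []"
  shows "exec (horner x a (coeffs q)) \<sigma> a = replicate (poly q (length (\<sigma> x))) True"
    "v < a \<Longrightarrow> exec (horner x a (coeffs q)) \<sigma> v = \<sigma> v"
  using exec_horner[OF assms, where cs = "coeffs q"] unfolding poly_eq_foldr by auto

lemma horner_admissible: "x < a \<Longrightarrow> admissible (horner x a cs)"
  by (induction cs arbitrary: a) auto

lemma horner_vars: "vars (horner x a cs) \<subseteq> insert x {a..a + length cs}"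
proof (induction cs arbitrary: a)
  case (Cons c cs)
  have "vars (horner x (Suc a) cs) \<subseteq> insert x {a..a + length (c # cs)}"
    using Cons[of "Suc a"] by (rule order_trans) auto
  moreover have "vars (emit a (replicate c True)) \<subseteq> insert x {a..a + length (c # cs)}"
    using emit_simps(3) by (rule order_trans) auto
  ultimately show ?case by simp
qed simp

lemma horner_ranked:
  assumes "\<And>v. a \<le> v \<Longrightarrow> v < a + length cs \<Longrightarrow> r x < r v \<and> r (Suc v) < r v"
  shows "ranked r (horner x a cs)"
  using assms
proof (induction cs arbitrary: a)
  case (Cons c cs)
  then show ?case using Cons.prems[of a] by auto
qed simp

lemma polytime_unary_poly: "polytime 1 (\<lambda>ws. replicate (poly q (length (ws ! 0))) True)"
proof -
  let ?c = "horner 0 1 (coeffs q)" and ?K = "length (coeffs q) + 2"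
  have "polytime 1 (\<lambda>ws. exec ?c (\<lambda>i. if i < length ws then ws ! i else []) 1)"
  proof (rule polytime_exec)
    show "ranked (\<lambda>v. if v = 0 then 0 else ?K - v) ?c"
      by (rule horner_ranked) auto
    show "vars ?c \<subseteq> {..<?K}" using horner_vars[of 0 1 "coeffs q"] by auto
  qed (auto intro: horner_admissible)
  also have "polytime 1 (\<lambda>ws. exec ?c (\<lambda>i. if i < length ws then ws ! i else []) 1) =
      polytime 1 (\<lambda>ws. replicate (poly q (length (ws ! 0))) True)"
    by (rule polytime_cong) (subst exec_horner_poly; simp)
  finally show ?thesis .
qed

section \<open>The query program\<close>

text \<open>The part of the code of a unary application that precedes the argument, ending in the
  continuation bit of the argument list; a single \<open>False\<close> follows the argument. A tower
  of unary symbols is thus printed by consecutive loops.\<close>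

definition unary_code :: "nat \<Rightarrow> bool list" where
  "unary_code f = True # enc_nat f @ [True]"

lemma enc_unary: "enc_trm (Fun f [t]) = unary_code f @ enc_trm t @ [False]"
  by (simp add: unary_code_def)

lemma enc_string_trm:
  "enc_trm (string_trm w) =
     concat (map (\<lambda>b. if b then unary_code 3 else unary_code 2) w) @ enc_trm Zero @ replicate (length w) False"
  by (induction w) (auto simp: Push_def enc_unary replicate_append_same simp del: enc_trm.simps)

lemma enc_Next_funpow:
  "enc_trm ((Next ^^ n) t) = concat (replicate n (unary_code 1)) @ enc_trm t @ replicate n False"
  by (induction n) (auto simp: Next_def enc_unary replicate_append_same simp del: enc_trm.simps)

text \<open>Variable \<open>w\<close> holds the string in reverse because a loop visits the last bit
  first.\<close>

definition emit_trm :: "nat \<Rightarrow> nat \<Rightarrow> nat \<Rightarrow> cmd" where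
  "emit_trm u s w =
     Seq (For s (emit u (unary_code 1)) (emit u (unary_code 1)))
    (Seq (For w (emit u (unary_code 2)) (emit u (unary_code 3)))
    (Seq (emit u (enc_trm Zero))
    (Seq (For w (emit u [False]) (emit u [False]))
         (For s (emit u [False]) (emit u [False])))))"

lemma exec_emit_trm:
  assumes "s \<noteq> u" "w \<noteq> u"
  shows "exec (emit_trm u s w) \<sigma> =
    \<sigma>(u := \<sigma> u @ enc_trm ((Next ^^ length (\<sigma> s)) (string_trm (rev (\<sigma> w)))))"
proof -
  have [simp]: "concat (map (\<lambda>b. v) w) = concat (replicate (length w) v)" for v w :: "bool list"
    by (simp flip: map_replicate_const)
  have [simp]: "map (\<lambda>b. False) w = replicate (length w) False" for w :: "bool list"
    by (rule map_replicate_const)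
  have [simp]: "concat (replicate n [False]) = replicate n False" for n
    by (induction n) auto
  show ?thesis
    using assms unfolding emit_trm_def exec.simps(4) exec_For_emit exec_emit
    by (simp add: enc_Next_funpow enc_string_trm)
qed

text \<open>The program uses variable 0 for the instance, 1 for the output, 2 for a reversed string,
  3 and 4 for the unary counters of the time and of the cell, 5 for the empty string, 6 and 7 for
  the unary bound on the counters, and the remaining ones for the evaluation of that bound.\<close>

abbreviation zeros :: "bool list" where
  "zeros \<equiv> True # enc_trm Zero @ True # enc_trm Zero"

text \<open>The two leading bits announce an instance and its first term; the last
  \<open>False\<close> closes the list of its four terms.\<close>

definition emit_core :: cmd where
  "emit_core =
     Seq (emit 1 [True, True]) (Seq (emit_trm 1 3 2) (Seq (emit 1 [True]) (Seq (emit_trm 1 4 5)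
       (emit 1 (zeros @ [False])))))"

definition emit_copy :: cmd where
  "emit_copy =
     Seq (emit 1 (True # zeros @ [True])) (Seq (emit_trm 1 3 2) (Seq (emit 1 [True]) (Seq (emit_trm 1 4 5)
       (emit 1 [False]))))"

definition core_row :: cmd where
  "core_row = Seq (Clear 4) (For 6 (Seq emit_core (App 4 True)) (Seq emit_core (App 4 True)))"

text \<open>The counter is increased before printing, as the guess begins in cell 1.\<close>

definition copy_row :: cmd where
  "copy_row = For 7 (Seq (App 4 True) emit_copy) (Seq (App 4 True) emit_copy)"

text \<open>The bound is stored twice: the last loop runs over 7, and admissibility forces the row
  inside it to count with another variable, 6. In the loop over the input, a row is printed before
  the string grows, which yields the proper suffixes.\<close>

definition query_program :: "nat poly \<Rightarrow> cmd" where
  "query_program q =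
     Seq (horner 0 7 (coeffs q))
    (Seq (For 7 (App 6 True) (App 6 True))
    (Seq (For 0 (App 2 False) (App 2 True))
    (Seq copy_row
    (Seq (Clear 2)
    (Seq (For 0 (Seq core_row (App 2 False)) (Seq core_row (App 2 True)))
    (Seq (For 7 (Seq core_row (App 3 True)) (Seq core_row (App 3 True)))
         (emit 1 [False])))))))"

definition core_instance :: "nat \<Rightarrow> bool list \<Rightarrow> nat \<Rightarrow> trm list" where
  "core_instance s w i = [(Next ^^ s) (string_trm w), numeral_trm i, Zero, Zero]"

definition copy_instance :: "bool list \<Rightarrow> nat \<Rightarrow> trm list" where
  "copy_instance w i = [Zero, Zero, string_trm w, numeral_trm i]"

definition core_instances :: "nat \<Rightarrow> nat \<Rightarrow> bool list \<Rightarrow> trm list list" where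
  "core_instances N s w = map (core_instance s w) [0..<N]"

text \<open>The second block treats the proper suffixes; \<open>x\<close> itself is the case
  \<open>s = 0\<close> of the third. The copy instances must precede both, since the assignment
  string is ordered by last occurrences.\<close>

definition query :: "bool list \<Rightarrow> nat \<Rightarrow> trm list list" where
  "query x N =
     map (\<lambda>k. copy_instance x (Suc k)) [0..<N] @
     concat (map (core_instances N 0) (map (\<lambda>k. drop (length x - k) x) [0..<length x])) @
     concat (map (\<lambda>s. core_instances N s x) [0..<N])"

definition enc_terms :: "trm list \<Rightarrow> bool list" where
  "enc_terms ts = enc_list (map enc_trm ts)"

definition enc_items :: "trm list list \<Rightarrow> bool list" where
  "enc_items \<tau>s = concat (map (\<lambda>ts. True # enc_terms ts) \<tau>s)"

lemma enc_instance_items: "enc_instance \<tau>s = enc_items \<tau>s @ [False]"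
  by (simp add: enc_instance_def enc_items_def enc_terms_def enc_list_def comp_def)

lemma enc_items_simps [simp]:
  "enc_items [] = []"
  "enc_items (\<tau>s @ \<upsilon>s) = enc_items \<tau>s @ enc_items \<upsilon>s"
  "enc_items [ts] = True # enc_terms ts"
  by (auto simp: enc_items_def)

text \<open>Describes the output by its list of instances, so that the program is verified without
  looking at codes. With 5 empty, a numeral is printed as a time over the empty string.\<close>

definition store :: "(nat \<Rightarrow> bool list) \<Rightarrow> trm list list \<Rightarrow> bool list \<Rightarrow> nat \<Rightarrow> nat \<Rightarrow> nat \<Rightarrow> bool list" where
  "store \<rho> \<tau>s w s i = \<rho>(1 := enc_items \<tau>s, 2 := w, 3 := replicate s True, 4 := replicate i True, 5 := [])"

lemma exec_emit_core:
  "exec emit_core (store \<rho> \<tau>s w s i) = store \<rho> (\<tau>s @ [core_instance s (rev w) i]) w s i"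
  unfolding emit_core_def exec.simps(4)
  by (simp add: exec_emit_trm)
     (simp add: fun_eq_iff store_def core_instance_def enc_terms_def)

lemma exec_emit_copy:
  "exec emit_copy (store \<rho> \<tau>s w 0 i) = store \<rho> (\<tau>s @ [copy_instance (rev w) i]) w 0 i"
  unfolding emit_copy_def exec.simps(4)
  by (simp add: exec_emit_trm)
     (simp add: fun_eq_iff store_def copy_instance_def enc_terms_def)

lemma exec_App_store:
  "exec (App 2 b) (store \<rho> \<tau>s w s i) = store \<rho> \<tau>s (w @ [b]) s i"
  "exec (App 3 True) (store \<rho> \<tau>s w s i) = store \<rho> \<tau>s w (Suc s) i"
  "exec (App 4 True) (store \<rho> \<tau>s w s i) = store \<rho> \<tau>s w s (Suc i)"
  "exec (Clear 2) (store \<rho> \<tau>s w s i) = store \<rho> \<tau>s [] s i"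
  "exec (Clear 4) (store \<rho> \<tau>s w s i) = store \<rho> \<tau>s w s 0"
  by (auto simp: fun_eq_iff store_def replicate_append_same)

lemma exec_core_row:
  assumes "\<rho> 6 = replicate N True"
  shows "exec core_row (store \<rho> \<tau>s w s i) = store \<rho> (\<tau>s @ core_instances N s (rev w)) w s N"
proof -
  define body where "body = Seq emit_core (App 4 True)"
  have b: "exec body (store \<rho> \<tau>s w s i) = store \<rho> (\<tau>s @ [core_instance s (rev w) i]) w s (Suc i)" for \<tau>s i
    unfolding body_def exec.simps(4) exec_emit_core exec_App_store(3) ..
  have "(exec body ^^ n) (store \<rho> \<tau>s w s 0) =
      store \<rho> (\<tau>s @ map (core_instance s (rev w)) [0..<n]) w s n" for n
    by (induction n) (simp_all add: b)
  moreover have "length (store \<rho> \<tau>s w s 0 6) = N"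
    by (simp add: store_def assms)
  ultimately show ?thesis
    unfolding core_row_def exec.simps(4) exec_App_store(5) body_def[symmetric] exec_For_same
    by (simp add: core_instances_def)
qed

lemma exec_copy_row:
  assumes "\<rho> 7 = replicate N True"
  shows "exec copy_row (store \<rho> [] w 0 0) =
    store \<rho> (map (\<lambda>k. copy_instance (rev w) (Suc k)) [0..<N]) w 0 N"
proof -
  define body where "body = Seq (App 4 True) emit_copy"
  have b: "exec body (store \<rho> \<tau>s w 0 i) = store \<rho> (\<tau>s @ [copy_instance (rev w) (Suc i)]) w 0 (Suc i)" for \<tau>s i
    unfolding body_def exec.simps(4) exec_emit_copy exec_App_store(3) ..
  have "(exec body ^^ n) (store \<rho> [] w 0 0) =
      store \<rho> (map (\<lambda>k. copy_instance (rev w) (Suc k)) [0..<n]) w 0 n" for n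
    by (induction n) (simp_all add: b)
  moreover have "length (store \<rho> [] w 0 0 7) = N"
    by (simp add: store_def assms)
  ultimately show ?thesis
    unfolding copy_row_def body_def[symmetric] exec_For_same by simp
qed

lemma exec_query_program:
  assumes "\<And>v. v \<noteq> 0 \<Longrightarrow> \<sigma> v = []"
  shows "exec (query_program q) \<sigma> 1 = enc_instance (query (\<sigma> 0) (poly q (length (\<sigma> 0))))"
proof -
  let ?x = "\<sigma> 0" and ?N = "poly q (length (\<sigma> 0))"
  define \<rho>1 where "\<rho>1 = exec (horner 0 7 (coeffs q)) \<sigma>"
  have \<rho>1: "\<rho>1 7 = replicate ?N True" "\<And>v. v < 7 \<Longrightarrow> \<rho>1 v = \<sigma> v"
    unfolding \<rho>1_def using exec_horner_poly[where q = q and x = 0 and a = 7 and \<sigma> = \<sigma>] assms by auto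
  define \<rho>2 where "\<rho>2 = \<rho>1(6 := replicate ?N True)"
  have copy: "exec (For 7 (App 6 True) (App 6 True)) \<rho>1 = \<rho>2"
    using \<rho>1 assms[of 6] by (subst exec_append_loop) (simp add: \<rho>2_def)
  have \<rho>2: "\<rho>2 6 = replicate ?N True" "\<rho>2 7 = replicate ?N True" "\<rho>2 0 = ?x"
    using \<rho>1 by (auto simp: \<rho>2_def)
  have s2: "\<rho>2 = store \<rho>2 [] [] 0 0"
    using \<rho>1 assms by (auto simp: fun_eq_iff store_def \<rho>2_def)
  have rev: "foldr (\<lambda>b. if b then exec (App 2 True) else exec (App 2 False)) w (store \<rho>2 \<tau>s [] s i) =
      store \<rho>2 \<tau>s (rev w) s i" for w \<tau>s s i
    by (induction w) (auto simp: exec_App_store simp del: exec.simps)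
  let ?C = "map (\<lambda>k. copy_instance ?x (Suc k)) [0..<?N]"
  let ?A = "\<lambda>w. concat (map (core_instances ?N 0) (map (\<lambda>k. drop (length w - k) w) [0..<length w]))"
  let ?B = "\<lambda>n. concat (map (\<lambda>s. core_instances ?N s ?x) [0..<n])"
  have 1: "exec (For 0 (App 2 False) (App 2 True)) \<rho>2 = store \<rho>2 [] (rev ?x) 0 0"
    unfolding exec.simps(5) \<rho>2(3) by (subst s2) (rule rev)
  have 2: "exec copy_row (store \<rho>2 [] (rev ?x) 0 0) = store \<rho>2 ?C (rev ?x) 0 ?N"
    using exec_copy_row[of \<rho>2 ?N "rev ?x"] \<rho>2 by simp
  define body where "body = (\<lambda>b. Seq core_row (App 2 b))"
  have body: "exec (body b) (store \<rho>2 \<tau>s (rev w) 0 i) =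
      store \<rho>2 (\<tau>s @ core_instances ?N 0 w) (rev (b # w)) 0 ?N" for b \<tau>s w i
    unfolding body_def exec.simps(4) exec_core_row[where \<rho> = \<rho>2, OF \<rho>2(1)] exec_App_store by simp
  have "foldr (\<lambda>b. if b then exec (body True) else exec (body False)) w (store \<rho>2 ?C [] 0 ?N) =
      store \<rho>2 (?C @ ?A w) (rev w) 0 ?N" for w
  proof (induction w)
    case (Cons b w)
    \<comment> \<open>A bit added in front makes the old string the longest proper suffix, which
      comes last in the list.\<close>
    have "map (\<lambda>k. drop (length (b # w) - k) (b # w)) [0..<length (b # w)] =
        map (\<lambda>k. drop (length w - k) w) [0..<length w] @ [w]"
      by (auto simp: Suc_diff_le)
    then have "?A (b # w) = ?A w @ core_instances ?N 0 w"
      by (simp only: map_append concat_append list.map concat.simps append_Nil2)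
    moreover have "(if b then exec (body True) else exec (body False)) = exec (body b)"
      by simp
    ultimately show ?case
      using body[of b "?C @ ?A w" w ?N] Cons.IH by (simp only: foldr.simps o_apply append_assoc)
  qed simp
  moreover have "store \<rho>2 ?C [] 0 ?N 0 = ?x"
    by (simp add: store_def \<rho>2)
  ultimately have 3: "exec (For 0 (Seq core_row (App 2 False)) (Seq core_row (App 2 True)))
      (store \<rho>2 ?C [] 0 ?N) = store \<rho>2 (?C @ ?A ?x) (rev ?x) 0 ?N"
    unfolding exec.simps(5) body_def by simp
  define tick where "tick = Seq core_row (App 3 True)"
  have tick: "exec tick (store \<rho>2 \<tau>s (rev ?x) s i) =
      store \<rho>2 (\<tau>s @ core_instances ?N s ?x) (rev ?x) (Suc s) ?N" for \<tau>s s i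
    unfolding tick_def exec.simps(4) exec_core_row[where \<rho> = \<rho>2, OF \<rho>2(1)] exec_App_store by simp
  have "(exec tick ^^ n) (store \<rho>2 (?C @ ?A ?x) (rev ?x) 0 ?N) =
      store \<rho>2 (?C @ ?A ?x @ ?B n) (rev ?x) n ?N" for n
    by (induction n) (simp_all add: tick)
  moreover have "length (store \<rho>2 (?C @ ?A ?x) (rev ?x) 0 ?N 7) = ?N"
    by (simp add: store_def \<rho>2)
  ultimately have 4: "exec (For 7 tick tick) (store \<rho>2 (?C @ ?A ?x) (rev ?x) 0 ?N) =
      store \<rho>2 (query ?x ?N) (rev ?x) ?N ?N"
    unfolding exec_For_same query_def by simp
  have "exec (query_program q) \<sigma> = exec (emit 1 [False]) (store \<rho>2 (query ?x ?N) (rev ?x) ?N ?N)"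
    unfolding query_program_def exec.simps(4) \<rho>1_def[symmetric] copy 1 2 exec_App_store(4) 3
      tick_def[symmetric] 4 ..
  then show ?thesis
    by (simp add: store_def enc_instance_items)
qed

section \<open>Admissibility and ranks of the query program\<close>

lemma emit_not_in: "u \<noteq> v \<Longrightarrow> u \<notin> vars (emit v w)"
  by (auto dest: subsetD[OF emit_simps(3)])

lemma emit_trm_properties:
  "vars (emit_trm u s w) \<subseteq> {u, s, w}"
  "appended (emit_trm u s w) \<subseteq> {u}"
  "s \<noteq> u \<Longrightarrow> w \<noteq> u \<Longrightarrow> admissible (emit_trm u s w)"
  "r s < r u \<Longrightarrow> r w < r u \<Longrightarrow> ranked r (emit_trm u s w)"
proof -
  have "vars (emit u v) \<subseteq> {u, s, w}" for v
    by (rule order_trans[OF emit_simps(3)]) simp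
  then show "vars (emit_trm u s w) \<subseteq> {u, s, w}"
    by (simp add: emit_trm_def del: emit.simps)
  show "appended (emit_trm u s w) \<subseteq> {u}"
    by (simp add: emit_trm_def del: emit.simps)
  show "s \<noteq> u \<Longrightarrow> w \<noteq> u \<Longrightarrow> admissible (emit_trm u s w)"
    by (simp add: emit_trm_def emit_not_in del: emit.simps)
  have "\<forall>x \<in> appended (emit u v). r y < r x" if "r y < r u" for y v
    using that by (auto dest: subsetD[OF emit_simps(4)])
  then show "r s < r u \<Longrightarrow> r w < r u \<Longrightarrow> ranked r (emit_trm u s w)"
    by (simp add: emit_trm_def ball_Un del: emit.simps)
qed

lemma emit_instance_properties:
  assumes "c \<in> {emit_core, emit_copy}"
  shows "vars c \<subseteq> {1, 2, 3, 4, 5}" "appended c \<subseteq> {1}" "admissible c"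
    "r 2 < r 1 \<Longrightarrow> r 3 < r 1 \<Longrightarrow> r 4 < r 1 \<Longrightarrow> r 5 < r 1 \<Longrightarrow> ranked r c"
proof -
  let ?V = "{1, 2, 3, 4, 5} :: nat set"
  have "vars (emit 1 v) \<subseteq> ?V" for v
    by (rule order_trans[OF emit_simps(3)]) simp
  moreover have "vars (emit_trm 1 3 2) \<subseteq> ?V" "vars (emit_trm 1 4 5) \<subseteq> ?V"
    by (rule order_trans[OF emit_trm_properties(1)], simp)+
  ultimately show "vars c \<subseteq> ?V"
    using assms
    by (elim insertE emptyE) (simp_all only: emit_core_def emit_copy_def vars.simps Un_subset_iff simp_thms)
  show "appended c \<subseteq> {1}"
    using assms emit_simps(4)[where v = 1] emit_trm_properties(2)[where u = 1]
    by (elim insertE emptyE) (simp_all only: emit_core_def emit_copy_def appended.simps Un_subset_iff simp_thms)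
  show "admissible c"
    using assms by (auto simp: emit_core_def emit_copy_def intro!: emit_trm_properties(3) simp del: emit.simps)
  show "r 2 < r 1 \<Longrightarrow> r 3 < r 1 \<Longrightarrow> r 4 < r 1 \<Longrightarrow> r 5 < r 1 \<Longrightarrow> ranked r c"
    using assms by (auto simp: emit_core_def emit_copy_def intro!: emit_trm_properties(4) simp del: emit.simps)
qed

lemma row_properties:
  "vars core_row \<subseteq> {1, 2, 3, 4, 5, 6}" "appended core_row \<subseteq> {1, 4}" "admissible core_row"
  "vars copy_row \<subseteq> {1, 2, 3, 4, 5, 7}" "appended copy_row \<subseteq> {1, 4}" "admissible copy_row"
  and ranked_rows: "r 2 < r 1 \<Longrightarrow> r 3 < r 1 \<Longrightarrow> r 4 < r 1 \<Longrightarrow> r 5 < r 1 \<Longrightarrow> r 6 < r 4 \<Longrightarrow> ranked r core_row"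
    "r 2 < r 1 \<Longrightarrow> r 3 < r 1 \<Longrightarrow> r 4 < r 1 \<Longrightarrow> r 5 < r 1 \<Longrightarrow> r 7 < r 4 \<Longrightarrow> ranked r copy_row"
proof -
  note core = emit_instance_properties[of emit_core, simplified]
    and copy = emit_instance_properties[of emit_copy, simplified]
  show "vars core_row \<subseteq> {1, 2, 3, 4, 5, 6}" "appended core_row \<subseteq> {1, 4}"
    using core(1,2) by (auto simp: core_row_def)
  show "vars copy_row \<subseteq> {1, 2, 3, 4, 5, 7}" "appended copy_row \<subseteq> {1, 4}"
    using copy(1,2) by (auto simp: copy_row_def)
  show "admissible core_row" using core(1,3) by (auto simp: core_row_def)
  show "admissible copy_row" using copy(1,3) by (auto simp: copy_row_def)
  show "ranked r core_row" if "r 2 < r 1" "r 3 < r 1" "r 4 < r 1" "r 5 < r 1" "r 6 < r 4"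
    using core(2,4) that by (auto simp: core_row_def)
  show "ranked r copy_row" if "r 2 < r 1" "r 3 < r 1" "r 4 < r 1" "r 5 < r 1" "r 7 < r 4"
    using copy(2,4) that by (auto simp: copy_row_def)
qed

lemma polytime_query: "polytime 1 (\<lambda>ws. enc_instance (query (ws ! 0) (poly q (length (ws ! 0)))))"
proof -
  let ?c = "query_program q" and ?K = "length (coeffs q) + 8"
  have "polytime 1 (\<lambda>ws. exec ?c (\<lambda>i. if i < length ws then ws ! i else []) 1)"
  proof (rule polytime_exec)
    \<comment> \<open>In increasing order: the input and the empty string, the Horner variables by
      decreasing index, the copied bound, the string and the counters, the output.\<close>
    let ?r = "\<lambda>v. if v = 0 \<or> v = 5 then 0 else if 7 \<le> v then ?K - v else if v = 1 then ?K + 3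
      else if v = 6 then ?K + 1 else ?K + 2"
    have "ranked ?r (horner 0 7 (coeffs q))"
      by (rule horner_ranked) auto
    then show "ranked ?r ?c"
      using row_properties(2,5) by (auto simp: query_program_def intro!: ranked_rows)
    have "vars (horner 0 7 (coeffs q)) \<subseteq> {..<?K}"
      using horner_vars[of 0 7 "coeffs q"] by (rule order_trans) auto
    moreover have "vars core_row \<subseteq> {..<?K}"
      using row_properties(1) by (rule order_trans) auto
    moreover have "vars copy_row \<subseteq> {..<?K}"
      using row_properties(4) by (rule order_trans) auto
    ultimately show "vars ?c \<subseteq> {..<?K}"
      by (simp add: query_program_def)
    show "admissible ?c"
      using row_properties(1,3,6) by (auto simp: query_program_def horner_admissible)
  qed simp
  also have "polytime 1 (\<lambda>ws. exec ?c (\<lambda>i. if i < length ws then ws ! i else []) 1) =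
      polytime 1 (\<lambda>ws. enc_instance (query (ws ! 0) (poly q (length (ws ! 0)))))"
    by (rule polytime_cong) (subst exec_query_program; simp)
  finally show ?thesis .
qed

section \<open>The decoding machine\<close>

text \<open>Written directly, since loops run backwards and do not stop early. State 0 steps over
  the markers, 1 expects a presence bit, 2 the bit itself.\<close>

definition decoder :: machine where
  "decoder = \<lparr>num_tapes = 3, num_symbols = 4, num_states = 3,
     trans = (\<lambda>q ss.
       if q = 0 then (1, [(ss ! 0, MStay), (ss ! 1, MRight), (ss ! 2, MRight)])
       else if q = 1 \<and> ss ! 1 = 3 then (2, [(ss ! 0, MStay), (ss ! 1, MRight), (ss ! 2, MStay)])
       else if q = 2 \<and> ss ! 1 \<noteq> 0 then (1, [(ss ! 0, MStay), (ss ! 1, MRight), (ss ! 1, MRight)])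
       else (3, map (\<lambda>s. (s, MStay)) ss))\<rparr>"

lemma wf_decoder: "wf_machine decoder"
proof -
  have "ss ! i < 4" if "set ss \<subseteq> {..<4}" "length ss = 3" "i < 3"
    for ss :: "nat list" and i

    using subsetD[OF that(1) nth_mem[of i]] that by auto
  then show ?thesis
    by (auto simp: wf_machine_def decoder_def)
qed

lemma act_tape_copy:
  "read_tape t = s \<Longrightarrow> act_tape (s, MRight) t = (fst t, Suc (snd t))"
  "read_tape t = s \<Longrightarrow> act_tape (s, MStay) t = t"
  by (auto simp: act_tape_def read_tape_def move_head_def)

lemma step_decoder:
  "step decoder (0, [t0, t1, t2]) =
     (1, [t0, (fst t1, Suc (snd t1)), (fst t2, Suc (snd t2))])"
  "step decoder (1, [t0, t1, t2]) =
     (if read_tape t1 = 3 then (2, [t0, (fst t1, Suc (snd t1)), t2]) else (3, [t0, t1, t2]))"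
  "step decoder (2, [t0, t1, t2]) =
     (if read_tape t1 \<noteq> 0
      then (1, [t0, (fst t1, Suc (snd t1)), ((fst t2)(snd t2 := read_tape t1), Suc (snd t2))])
      else (3, [t0, t1, t2]))"
  by (auto simp: step_def decoder_def act_tape_copy) (auto simp: act_tape_def move_head_def)

lemma decoder_run:
  "\<exists>n \<le> length w + 1. \<exists>t1 t2. (step decoder ^^ n)
      (1, [t0, (tape_of (u @ w), Suc (length u)), (tape_of v, Suc (length v))]) = (3, [t0, t1, t2]) \<and>
    fst t2 = tape_of (v @ decode w)"
proof (induction w arbitrary: u v rule: decode.induct)
  case (1 b w)
  let ?t1 = "\<lambda>n. (tape_of (u @ True # b # w), n + length u)" and ?t2 = "(tape_of v, Suc (length v))"
  have r: "read_tape (?t1 1) = 3" "read_tape (?t1 2) = bit_symbol b"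
    by (simp_all add: read_tape_def tape_of_def nth_append)
  have upd: "(tape_of v)(Suc (length v) := bit_symbol b) = tape_of (v @ [b])"
    by (auto simp: tape_of_def fun_eq_iff nth_append)
  have s1: "step decoder (1, [t0, ?t1 1, ?t2]) = (2, [t0, ?t1 2, ?t2])"
    using r(1) step_decoder(2)[of t0 "?t1 1" ?t2] by simp
  have s2: "step decoder (2, [t0, ?t1 2, ?t2]) =
      (1, [t0, ?t1 3, (tape_of (v @ [b]), Suc (Suc (length v)))])"
    using r(2) upd step_decoder(3)[of t0 "?t1 2" ?t2] by (simp add: numeral_3_eq_3)
  obtain n t1 t2 where n: "n \<le> length w + 1" "(step decoder ^^ n)
      (1, [t0, ?t1 3, (tape_of (v @ [b]), Suc (Suc (length v)))]) = (3, [t0, t1, t2])"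
      "fst t2 = tape_of (v @ b # decode w)"
    using 1[of "u @ [True, b]" "v @ [b]"] by (auto simp: numeral_3_eq_3)
  have "(step decoder ^^ Suc (Suc n)) (1, [t0, ?t1 1, ?t2]) = (3, [t0, t1, t2])"
    by (rule funpow_step_first[where f = "step decoder", OF s1],
        rule funpow_step_first[where f = "step decoder", OF s2 n(2)])
  then show ?case
    using n(1,3) by (intro exI[of _ "Suc (Suc n)"]) auto
next
  case ("2_1" )
  have "read_tape (tape_of u, Suc (length u)) = 0" by simp
  then show ?case
    by (intro exI[of _ 1]) (simp add: step_decoder(2)[unfolded One_nat_def])
next
  case ("2_2" w)
  have "read_tape (tape_of (u @ False # w), Suc (length u)) = 2"
    by (simp add: read_tape_def tape_of_def)
  then show ?case
    by (intro exI[of _ 1]) (simp add: step_decoder(2)[unfolded One_nat_def])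
next
  case ("2_3" b)
  let ?t1 = "\<lambda>n. (tape_of (u @ [b]), n + length u)" and ?t2 = "(tape_of v, Suc (length v))"
  have r: "read_tape (?t1 1) = bit_symbol b" "read_tape (?t1 2) = 0"
    by (simp_all add: read_tape_def tape_of_def)
  have s1: "step decoder (1, [t0, ?t1 1, ?t2]) = (if b then 2 else 3, [t0, ?t1 (if b then 2 else 1), ?t2])"
    using r(1) step_decoder(2)[of t0 "?t1 1" ?t2] by simp
  have s2: "step decoder (2, [t0, ?t1 2, ?t2]) = (3, [t0, ?t1 2, ?t2])"
    using r(2) step_decoder(3)[of t0 "?t1 2" ?t2] by simp
  show ?case
  proof (cases b)
    case True
    then show ?thesis using s1 s2 by (intro exI[of _ "Suc (Suc 0)"]) simp
  next
    case False
    then show ?thesis using s1 by (intro exI[of _ "Suc 0"]) simp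
  qed
qed

lemma polytime_decode: "polytime 2 (\<lambda>ws. decode (ws ! 1))"
  unfolding polytime_def
proof (intro exI[of _ decoder] exI[of _ "[:2, 1:]"] conjI allI impI)
  show "wf_machine decoder" by (rule wf_decoder)
  show "2 < num_tapes decoder" by (simp add: decoder_def)
  fix ws :: "bool list list"
  assume "length ws = 2"
  then obtain x v where ws: "ws = [x, v]"
    by (auto simp: numeral_2_eq_2 length_Suc_conv)
  have start: "start_config decoder ws = (0, [(tape_of x, 0), (tape_of v, 0), (tape_of [], 0)])"
    by (simp add: start_config_def decoder_def ws upt_rec)
  obtain n t1 t2 where n: "n \<le> length v + 1" "(step decoder ^^ n)
      (1, [(tape_of x, 0), (tape_of ([] @ v), Suc (length ([] :: bool list))), (tape_of [], Suc (length ([] :: bool list)))]) =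
        (3, [(tape_of x, 0), t1, t2])" "fst t2 = tape_of ([] @ decode v)"
    using decoder_run by meson
  have "(step decoder ^^ Suc n) (start_config decoder ws) = (3, [(tape_of x, 0), t1, t2])"
    unfolding start by (rule funpow_step_first[where f = "step decoder", OF step_decoder(1)]) (use n in simp)
  then show "\<exists>t \<le> poly [:2, 1:] (sum_list (map length ws)). \<exists>ts.
      (step decoder ^^ t) (start_config decoder ws) = (num_states decoder, ts) \<and>
      fst (ts ! 2) = tape_of (decode (ws ! 1))"
    using n ws by (intro exI[of _ "Suc n"]) (auto simp: decoder_def)
qed

section \<open>The reduction\<close>

lemma subst_simps [simp]:
  "subst \<sigma> (atom P ts) = atom P (map (subst_trm \<sigma>) ts)"
  "subst \<sigma> (conjs ps) = conjs (map (subst \<sigma>) ps)"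
  "subst \<sigma> (imps ps q) = imps (map (subst \<sigma>) ps) (subst \<sigma> q)"
  "subst_trm \<sigma> Zero = Zero" "subst_trm \<sigma> (Next t) = Next (subst_trm \<sigma> t)"
  "subst_trm \<sigma> (Push b t) = Push b (subst_trm \<sigma> t)"
proof -
  show "subst \<sigma> (conjs ps) = conjs (map (subst \<sigma>) ps)"
    unfolding conjs_def by (induction ps) auto
  show "subst \<sigma> (imps ps q) = imps (map (subst \<sigma>) ps) (subst \<sigma> q)"
    unfolding imps_def by (induction ps) auto
qed (auto simp: atom_def Zero_def Next_def Push_def)

lemma subst_act_clauses:
  "map (subst \<sigma>) (act_clauses \<mu> j a T i) = act_clauses \<mu> j a (subst_trm \<sigma> T) (subst_trm \<sigma> i)"
  by (cases a; cases "snd a") (auto simp: act_clauses_def)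

lemma subst_matrix:
  "subst \<sigma> (matrix M U T i z w) =
    matrix M U (subst_trm \<sigma> T) (subst_trm \<sigma> i) (subst_trm \<sigma> z) (subst_trm \<sigma> w)"
proof -
  have "map (subst \<sigma>) (step_clauses \<mu> M T i) = step_clauses \<mu> M (subst_trm \<sigma> T) (subst_trm \<sigma> i)" for \<mu> M
    by (simp add: step_clauses_def map_concat comp_def subst_act_clauses)
  moreover have "map (subst \<sigma>) (init_clauses \<mu> M T i) = init_clauses \<mu> M (subst_trm \<sigma> T) (subst_trm \<sigma> i)" for \<mu> M T
    by (auto simp: init_clauses_def map_concat comp_def intro!: arg_cong[of _ _ concat])
  moreover have "map (subst \<sigma>) (guess_clauses T i) = guess_clauses (subst_trm \<sigma> T) (subst_trm \<sigma> i)"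
    "map (subst \<sigma>) (input_clauses T i) = input_clauses (subst_trm \<sigma> T) (subst_trm \<sigma> i)"
    "map (subst \<sigma>) (end_clauses M U T i) = end_clauses M U (subst_trm \<sigma> T) (subst_trm \<sigma> i)"
    "map (subst \<sigma>) (copy_clauses z w) = copy_clauses (subst_trm \<sigma> z) (subst_trm \<sigma> w)"
    by (simp_all add: guess_clauses_def input_clauses_def end_clauses_def copy_clauses_def)
  ultimately show ?thesis
    by (simp add: matrix_def core_clauses_def)
qed

lemma quantifier_free_simps [simp]:
  "quantifier_free (atom P ts)"
  "quantifier_free (conjs ps) \<longleftrightarrow> (\<forall>p \<in> set ps. quantifier_free p)"
  "quantifier_free (imps ps q) \<longleftrightarrow> (\<forall>p \<in> set ps. quantifier_free p) \<and> quantifier_free q"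
proof -
  show "quantifier_free (conjs ps) \<longleftrightarrow> (\<forall>p \<in> set ps. quantifier_free p)"
    unfolding conjs_def by (induction ps) auto
  show "quantifier_free (imps ps q) \<longleftrightarrow> (\<forall>p \<in> set ps. quantifier_free p) \<and> quantifier_free q"
    unfolding imps_def by (induction ps) auto
qed (simp add: atom_def)

lemma closed_simps [simp]:
  "closed_fm n (atom P ts) \<longleftrightarrow> (\<forall>t \<in> set ts. closed_trm n t)"
  "closed_fm n (conjs ps) \<longleftrightarrow> (\<forall>p \<in> set ps. closed_fm n p)"
  "closed_fm n (imps ps q) \<longleftrightarrow> (\<forall>p \<in> set ps. closed_fm n p) \<and> closed_fm n q"
  "closed_trm n Zero" "closed_trm n (Next t) \<longleftrightarrow> closed_trm n t" "closed_trm n (Push b t) \<longleftrightarrow> closed_trm n t"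
proof -
  show "closed_fm n (conjs ps) \<longleftrightarrow> (\<forall>p \<in> set ps. closed_fm n p)"
    unfolding conjs_def by (induction ps) auto
  show "closed_fm n (imps ps q) \<longleftrightarrow> (\<forall>p \<in> set ps. closed_fm n p) \<and> closed_fm n q"
    unfolding imps_def by (induction ps) auto
qed (auto simp: atom_def Zero_def Next_def Push_def list_all_iff)

lemma act_clauses_quantifier_free: "p \<in> set (act_clauses \<mu> j a T i) \<Longrightarrow> quantifier_free p"
  by (cases "snd a") (auto simp: act_clauses_def)

lemma act_clauses_closed:
  "p \<in> set (act_clauses \<mu> j a T i) \<Longrightarrow> closed_trm n T \<Longrightarrow> closed_trm n i \<Longrightarrow> closed_fm n p"
  by (cases "snd a") (auto simp: act_clauses_def)

lemma matrix_quantifier_free: "quantifier_free (matrix M U T i z w)"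
  by (auto simp: matrix_def copy_clauses_def core_clauses_def guess_clauses_def input_clauses_def
      end_clauses_def init_clauses_def step_clauses_def act_clauses_quantifier_free)

lemma matrix_closed:
  assumes "closed_trm n T" "closed_trm n i" "closed_trm n z" "closed_trm n w"
  shows "closed_fm n (matrix M U T i z w)"
  using assms
  by (auto simp: matrix_def copy_clauses_def core_clauses_def guess_clauses_def input_clauses_def
      end_clauses_def init_clauses_def step_clauses_def act_clauses_closed)

lemma funs_simps [simp]:
  "funs (atom P ts) = \<Union> (funs_trm ` set ts)"
  "funs (conjs ps) = \<Union> (funs ` set ps)"
  "funs (imps ps q) = \<Union> (funs ` set ps) \<union> funs q"
  "funs_trm Zero = {(0, 0)}" "funs_trm (Next t) = insert (1, 1) (funs_trm t)"
  "funs_trm (Push b t) = insert (bit_symbol b, 1) (funs_trm t)"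
proof -
  show "funs (conjs ps) = \<Union> (funs ` set ps)"
    unfolding conjs_def by (induction ps) auto
  show "funs (imps ps q) = \<Union> (funs ` set ps) \<union> funs q"
    unfolding imps_def by (induction ps) auto
qed (auto simp: atom_def Zero_def Next_def Push_def)

definition signature :: "(nat \<times> nat) set" where
  "signature = {(0, 0), (1, 1), (2, 1), (3, 1)}"

lemma funs_matrix: "signature \<subseteq> funs (matrix M U T i z w)"
  by (auto simp: signature_def matrix_def core_clauses_def input_clauses_def)

lemma skolem_prenex_quantifier_free:
  "quantifier_free p \<Longrightarrow> skolem_prenex m k us ts p = (m, k, subst ((!) ts) p)"
  by (cases p) auto

text \<open>There is nothing to skolemize; the variables are merely renumbered from the outermost
  quantifier inwards, which reverses the de Bruijn indices.\<close>

lemma skolem_search_sentence: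
  "skolem_matrix (search_sentence M U) = matrix M U (Var 0) (Var 1) (Var 2) (Var 3)"
  "num_vars (search_sentence M U) = 4"
  by (simp_all add: skolem_matrix_def num_vars_def search_sentence_def skolem_prenex_quantifier_free
      matrix_quantifier_free subst_matrix eval_nat_numeral)

lemma search_sentence_universal: "universal (search_sentence M U)"
proof -
  have "quantifier_free p \<Longrightarrow> universal p" for p by (cases p) auto
  then show ?thesis by (simp add: search_sentence_def matrix_quantifier_free)
qed

lemma search_sentence_closed: "sentence (search_sentence M U)"
  by (simp add: sentence_def search_sentence_def matrix_closed)

lemma (in search_model) consistent_search_sentence: "consistent (search_sentence M U)"
proof (rule consistent_if_model)
  show "eval_fm fun_interp pred_interp e (search_sentence M U)" for e
    using matrix_canonical
    by (simp add: search_sentence_def eval_quantifier_free[OF matrix_quantifier_free] canonical_def)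
qed

lemma hcs_formulas_search_sentence:
  "hcs_formulas (search_sentence M U) \<tau>s =
    map (\<lambda>ts. matrix M U (ts ! 0) (ts ! 1) (ts ! 2) (ts ! 3)) \<tau>s"
  by (simp add: hcs_formulas_def skolem_search_sentence subst_matrix)

lemma funs_signature:
  "funs_trm Zero \<subseteq> signature"
  "funs_trm t \<subseteq> signature \<Longrightarrow> funs_trm ((Next ^^ n) t) \<subseteq> signature"
  "funs_trm (string_trm w) \<subseteq> signature"
proof -
  show "funs_trm t \<subseteq> signature \<Longrightarrow> funs_trm ((Next ^^ n) t) \<subseteq> signature"
    by (induction n) (auto simp: signature_def)
  show "funs_trm (string_trm w) \<subseteq> signature"
    by (induction w) (auto simp: signature_def)
qed (simp add: signature_def)

lemma hcs_instance_query: "hcs_instance (search_sentence M U) (query x N)"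
proof -
  have "length ts = 4 \<and> (\<forall>t \<in> set ts. funs_trm t \<subseteq> signature)"
    if "ts \<in> set (query x N)" for ts
  proof -
    from that consider s w i where "ts = core_instance s w i" | k where "ts = copy_instance x k"
      by (auto simp: query_def core_instances_def)
    then show ?thesis
      by cases (simp_all add: core_instance_def copy_instance_def funs_signature del: funs_simps)
  qed
  then show ?thesis
    using funs_matrix unfolding hcs_instance_def skolem_search_sentence by blast
qed

section \<open>The query and the order of its atoms\<close>

lemma core_instance_in_query:
  assumes "T \<in> time_trms x N" "i < N"
  shows "[T, numeral_trm i, Zero, Zero] \<in> set (query x N)"
proof -
  have run: "core_instance s x i \<in> set (query x N)" if "s < N" for s
  proof -
    have "core_instance s x i \<in> set (core_instances N s x)"
      using assms(2) by (simp add: core_instances_def)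
    then show ?thesis using that by (auto simp: query_def)
  qed
  from assms(1) consider s where "s < N" "T = (Next ^^ s) (string_trm x)"
    | v where "suffix v x" "T = string_trm v"
    by (auto simp: time_trms_def)
  then show ?thesis
  proof cases
    case 1
    then show ?thesis using run by (simp add: core_instance_def)
  next
    case 2
    then obtain u where u: "x = u @ v" by (auto simp: suffix_def)
    show ?thesis
    proof (cases "u = []")
      case True
      then show ?thesis using run[of 0] assms(2) 2 u by (simp add: core_instance_def)
    next
      case False
      then have "v = drop (length x - length v) x" "length v < length x" using u by auto
      then have "core_instance 0 v i \<in> set (query x N)"
        using assms(2) by (force simp: query_def core_instances_def)
      then show ?thesis using 2 by (simp add: core_instance_def)
    qed
  qed
qed

lemma atoms_simps [simp]:
  "atoms (atom P ts) = [(to_nat P, ts)]"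
  "atoms (conjs ps) = concat (map atoms ps)"
  "atoms (imps ps q) = concat (map atoms ps) @ atoms q"
proof -
  show "atoms (conjs ps) = concat (map atoms ps)"
    unfolding conjs_def by (induction ps) auto
  show "atoms (imps ps q) = concat (map atoms ps) @ atoms q"
    unfolding imps_def by (induction ps) auto
qed (simp add: atom_def)

lemma core_atoms:
  assumes "p \<in> set (core_clauses M U T i)"
  shows "(to_nat Wp, ts) \<notin> set (atoms p)" "(to_nat Wb, ts) \<notin> set (atoms p)"
proof -
  have act: "(to_nat Wp, ts) \<notin> set (atoms p) \<and> (to_nat Wb, ts) \<notin> set (atoms p)"
    if "p \<in> set (act_clauses \<mu> j a T i)" for \<mu> j a p
    using that by (cases "snd a") (auto simp: act_clauses_def)
  have "(to_nat Wp, ts) \<notin> set (atoms p) \<and> (to_nat Wb, ts) \<notin> set (atoms p)"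
    using assms
    by (auto simp: core_clauses_def guess_clauses_def input_clauses_def
        end_clauses_def init_clauses_def step_clauses_def dest!: act split: if_splits)
  then show "(to_nat Wp, ts) \<notin> set (atoms p)" "(to_nat Wb, ts) \<notin> set (atoms p)" by auto
qed

text \<open>\<open>remdups\<close> keeps last occurrences, so what recurs in \<open>ys\<close>
  disappears from the front.\<close>

lemma remdups_append_filter: "remdups (xs @ ys) = remdups (filter (\<lambda>x. x \<notin> set ys) xs) @ remdups ys"
  by (induction xs) auto

lemma remdups_doubled:
  assumes "inj a" "inj b" "\<And>k l. a k \<noteq> b l" "distinct ks"
  shows "remdups (concat (map (\<lambda>k. [a k, a k, b k, b k]) ks)) = concat (map (\<lambda>k. [a k, b k]) ks)"
  using assms(4)
proof (induction ks)
  case (Cons k ks)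
  have "b k \<noteq> a l" for l using assms(3)[of l k] by simp
  then show ?case
    using Cons assms(1-3) by (auto dest: injD)
qed simp

lemma Next_inj [simp]: "Next s = Next t \<longleftrightarrow> s = t" "Next t \<noteq> Zero" "Zero \<noteq> Next t"
  by (auto simp: Next_def Zero_def)

lemma numeral_trm_inj: "numeral_trm k = numeral_trm l \<longleftrightarrow> k = l"
proof (induction k arbitrary: l)
  case 0
  then show ?case by (cases l) auto
next
  case (Suc k)
  then show ?case by (cases l) auto
qed

text \<open>Every atom of a copy instance except those of \<open>Wp\<close> and \<open>Wb\<close> occurs again in a later
  instance, so that the answers of \<open>Wp\<close> and \<open>Wb\<close> come first in the assignment string.\<close>

lemma query_atoms:
  assumes "0 < N"
  obtains rest where
    "remdups (concat (map atoms (hcs_formulas (search_sentence M U) (query x N)))) =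
      concat (map (\<lambda>k. [(to_nat Wp, [string_trm x, numeral_trm (Suc k)]),
                        (to_nat Wb, [string_trm x, numeral_trm (Suc k)])]) [0..<N]) @ rest"
proof -
  define w where "w = (\<lambda>k. [string_trm x, numeral_trm (Suc k)])"
  define mat where "mat = (\<lambda>ts. atoms (matrix M U (ts ! 0) (ts ! 1) (ts ! 2) (ts ! 3)))"
  define core where "core = concat (map atoms (core_clauses M U Zero Zero))"
  define Q where "Q = concat (map (core_instances N 0) (map (\<lambda>k. drop (length x - k) x) [0..<length x])) @
     concat (map (\<lambda>s. core_instances N s x) [0..<N])"
  define later where "later = concat (map mat Q)"
  have query: "query x N = map (\<lambda>k. copy_instance x (Suc k)) [0..<N] @ Q"
    by (simp add: query_def Q_def)
  have mem: "set (mat [T, numeral_trm i, Zero, Zero]) \<subseteq> set later" if "T \<in> time_trms x N" "i < N" for T i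
  proof -
    have "[T, numeral_trm i, Zero, Zero] \<in> set Q"
      using core_instance_in_query[OF that] unfolding query by (auto simp: copy_instance_def)
    then show ?thesis by (auto simp: later_def)
  qed
  have mat: "mat [T, i, z, u] = [(to_nat Wp, [z, u]), (to_nat Yp, [z, u]), (to_nat Yp, [z, u]), (to_nat Wp, [z, u]),
      (to_nat Wb, [z, u]), (to_nat Yb, [z, u]), (to_nat Yb, [z, u]), (to_nat Wb, [z, u])] @
      concat (map atoms (core_clauses M U T i))" for T i z u
    by (simp add: mat_def matrix_def copy_clauses_def)
  have "Zero \<in> time_trms x N"
    using imageI[of "[]" "{v. suffix v x}" string_trm] by (simp add: time_trms_def)
  then have core_later: "set core \<subseteq> set later"
    using mem[of Zero 0] assms by (auto simp: mat core_def)
  have Y_later: "(to_nat Yp, w k) \<in> set later" "(to_nat Yb, w k) \<in> set later" if "k < N" for k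
  proof -
    have "string_trm x \<in> time_trms x N" by (auto simp: time_trms_def)
    from mem[OF this that] show "(to_nat Yp, w k) \<in> set later" "(to_nat Yb, w k) \<in> set later"
      by (auto simp: mat w_def core_clauses_def guess_clauses_def)
  qed
  have W_not: "(to_nat P, w k) \<notin> set later" if "P \<in> {Wp, Wb}" for P k
  proof
    assume "(to_nat P, w k) \<in> set later"
    then obtain s v i where "(to_nat P, w k) \<in> set (mat (core_instance s v i))"
      by (auto simp: later_def Q_def core_instances_def)
    \<comment> \<open>Later instances contain copy clauses too, but at \<open>Zero\<close>,
      \<open>Zero\<close>, whereas the cell in \<open>w k\<close> is a successor.\<close>
    moreover have "w k \<noteq> [Zero, Zero]" by (simp add: w_def)
    ultimately obtain p where "p \<in> set (core_clauses M U ((Next ^^ s) (string_trm v)) (numeral_trm i))"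
        "(to_nat P, w k) \<in> set (atoms p)"
      by (auto simp: core_instance_def mat)
    then show False using core_atoms that by blast
  qed
  let ?a = "\<lambda>k. (to_nat Wp, w k)" and ?b = "\<lambda>k. (to_nat Wb, w k)"
  \<comment> \<open>The order of the copy clauses leaves \<open>Wp\<close> before \<open>Wb\<close>,
    the order of bits that \<open>decode\<close> expects.\<close>
  have "filter (\<lambda>a. a \<notin> set later) (mat (copy_instance x (Suc k))) = [?a k, ?a k, ?b k, ?b k]" if "k < N" for k
  proof -
    have "filter (\<lambda>a. a \<notin> set later) core = []"
      using core_later by (auto simp: filter_empty_conv)
    moreover have "mat (copy_instance x (Suc k)) = [?a k, (to_nat Yp, w k), (to_nat Yp, w k), ?a k,
        ?b k, (to_nat Yb, w k), (to_nat Yb, w k), ?b k] @ core"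
      by (simp add: copy_instance_def mat w_def core_def)
    ultimately show ?thesis
      using W_not[of Wp k] W_not[of Wb k] Y_later[OF that] by simp
  qed
  then have filt: "filter (\<lambda>a. a \<notin> set later) (concat (map (\<lambda>k. mat (copy_instance x (Suc k))) [0..<N])) =
      concat (map (\<lambda>k. [?a k, ?a k, ?b k, ?b k]) [0..<N])"
    unfolding filter_concat map_map by (intro arg_cong[of _ _ concat] map_cong) auto
  have "remdups (concat (map (\<lambda>k. [?a k, ?a k, ?b k, ?b k]) [0..<N])) = concat (map (\<lambda>k. [?a k, ?b k]) [0..<N])"
    by (rule remdups_doubled) (auto simp: w_def numeral_trm_inj intro!: injI)
  then have "remdups (concat (map mat (query x N))) = concat (map (\<lambda>k. [?a k, ?b k]) [0..<N]) @ remdups later"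
    unfolding query map_append concat_append later_def[symmetric] map_map comp_def
    by (subst remdups_append_filter) (simp only: filt)
  then show ?thesis
    using that by (simp add: hcs_formulas_search_sentence comp_def mat_def w_def)
qed

lemma poly_nat_mono: "(m :: nat) \<le> n \<Longrightarrow> poly p m \<le> poly p n"
  by (induction p) (auto intro: mult_le_mono)

text \<open>The time bound for the decider is assumed only up to length \<open>P\<close>: the clock
  rules out longer guesses before the decider is consulted.\<close>

lemma solution_decodes:
  assumes R: "\<And>y. length y \<le> P \<Longrightarrow> \<exists>u us. 2 * u + 2 \<le> N \<and>
      (step M ^^ u) (start_config M [x, y]) = (num_states M, us) \<and> fst (us ! 2) = tape_of [R y]"
    and wf: "wf_machine M" "wf_machine U" and tapes: "2 < num_tapes M" "1 < num_tapes U"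
    and clock: "(step U ^^ t) (start_config U [x]) = (num_states U, ts)"
      "fst (ts ! 1) = tape_of (replicate P True)"
    and bound: "2 * t + P + 2 \<le> N"
    and v: "HCS (search_sentence M U) (enc_instance (query x N)) v"
  shows "length (decode v) \<le> P \<and> R (decode v)"
proof -
  obtain \<alpha> where v: "v = map \<alpha> (remdups (concat (map atoms (hcs_formulas (search_sentence M U) (query x N)))))"
    and sat: "\<forall>p \<in> set (hcs_formulas (search_sentence M U) (query x N)). truth \<alpha> p"
    using v enc_instance_inj unfolding HCS_def by blast
  have clauses: "\<forall>p \<in> set (copy_clauses (ts ! 2) (ts ! 3) @ core_clauses M U (ts ! 0) (ts ! 1)). truth \<alpha> p"
    if "ts \<in> set (query x N)" for ts
    using sat that by (auto simp: hcs_formulas_search_sentence matrix_def)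
  interpret clauses_hold M U \<alpha> x N P t ts
  proof
    show "truth \<alpha> p" if "T \<in> time_trms x N" "i < N" "p \<in> set (core_clauses M U T (numeral_trm i))" for T i p
      using clauses[OF core_instance_in_query[OF that(1,2)]] that(3) by simp
  qed (use wf tapes clock bound in auto)
  have copy: "\<alpha> (to_nat Wp, [string_trm x, numeral_trm (Suc k)]) \<longleftrightarrow> k < guess_length"
      "\<alpha> (to_nat Wb, [string_trm x, numeral_trm (Suc k)]) \<longleftrightarrow> Yb_at k" if "k < N" for k
  proof -
    have "copy_instance x (Suc k) \<in> set (query x N)"
      using that by (auto simp: query_def)
    from clauses[OF this] show "\<alpha> (to_nat Wp, [string_trm x, numeral_trm (Suc k)]) \<longleftrightarrow> k < guess_length"
      "\<alpha> (to_nat Wb, [string_trm x, numeral_trm (Suc k)]) \<longleftrightarrow> Yb_at k"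
      using Yp_at_iff[OF that] by (auto simp: copy_instance_def copy_clauses_def)
  qed
  obtain rest where "remdups (concat (map atoms (hcs_formulas (search_sentence M U) (query x N)))) =
      concat (map (\<lambda>k. [(to_nat Wp, [string_trm x, numeral_trm (Suc k)]),
                        (to_nat Wb, [string_trm x, numeral_trm (Suc k)])]) [0..<N]) @ rest"
    using query_atoms[of N M U x] bound by auto
  then have "v = concat (map (\<lambda>k. [k < guess_length, Yb_at k]) [0..<N]) @ map \<alpha> rest"
    using copy by (auto simp: v map_concat comp_def intro!: arg_cong[of _ _ concat])
  then have decode: "decode v = guess"
    using decode_pairs[of 0 guess_length N] guess_length_le bound by (simp add: guess_def)
  have len: "length guess \<le> P"
    using guess_length_le by (simp add: guess_def)
  then obtain u us where "2 * u + 2 \<le> N" "(step M ^^ u) (start_config M [x, guess]) = (num_states M, us)"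
      "fst (us ! 2) = tape_of [R guess]"
    using R by blast
  then show ?thesis
    using guess_correct len decode by metis
qed

lemma (in search_model) query_solvable:
  "\<exists>v. HCS (search_sentence M U) (enc_instance (query x N)) v"
proof -
  let ?\<alpha> = "canonical (\<lambda>_. ([], 0))"
  have "\<forall>p \<in> set (hcs_formulas (search_sentence M U) (query x N)). truth ?\<alpha> p"
    using matrix_canonical by (auto simp: hcs_formulas_search_sentence)
  then show ?thesis
    unfolding HCS_def using hcs_instance_query by blast
qed

theorem theorem3p1:
  fixes R :: search_problem and p :: "nat poly"
  assumes "total_polynomial_search R p"
  shows "\<exists>\<Phi>. sentence \<Phi> \<and> universal \<Phi> \<and> consistent \<Phi> \<and>
           many_one_reducible (bounded_search R p) (HCS \<Phi>)"
proof -
  obtain M b where M: "wf_machine M" "2 < num_tapes M"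
    and decides: "\<And>ws. length ws = 2 \<Longrightarrow> \<exists>t \<le> poly b (sum_list (map length ws)). \<exists>ts.
      (step M ^^ t) (start_config M ws) = (num_states M, ts) \<and> fst (ts ! 2) = tape_of [R (ws ! 0) (ws ! 1)]"
    using assms unfolding total_polynomial_search_def polytime_def by blast
  have decider: "\<exists>t \<le> poly b (length x + length y). \<exists>ts.
      (step M ^^ t) (start_config M [x, y]) = (num_states M, ts) \<and> fst (ts ! 2) = tape_of [R x y]" for x y
    using decides[of "[x, y]"] by simp
  obtain U c where U: "wf_machine U" "1 < num_tapes U"
    and counts: "\<And>ws. length ws = 1 \<Longrightarrow> \<exists>t \<le> poly c (sum_list (map length ws)). \<exists>ts.
      (step U ^^ t) (start_config U ws) = (num_states U, ts) \<and>
      fst (ts ! 1) = tape_of (replicate (poly p (length (ws ! 0))) True)"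
    using polytime_unary_poly[of p] unfolding polytime_def by blast
  have counter: "\<exists>t \<le> poly c (length x). \<exists>ts.
      (step U ^^ t) (start_config U [x]) = (num_states U, ts) \<and>
      fst (ts ! 1) = tape_of (replicate (poly p (length x)) True)" for x
    using counts[of "[x]"] by simp
  \<comment> \<open>The choice need not be computable: \<open>Y\<close> only serves to build the
    model, which gives consistency and the solvability of the queries.\<close>
  define Y where "Y = (\<lambda>x. SOME y. length y \<le> poly p (length x) \<and> R x y)"
  have Y: "length (Y x) \<le> poly p (length x)" "R x (Y x)" for x
    using assms someI_ex[of "\<lambda>y. length y \<le> poly p (length x) \<and> R x y"]
    unfolding total_polynomial_search_def Y_def by auto
  interpret search_model M U Y
  proof
    fix t w i
    show "fst (snd ((step M ^^ t) (start_config M [w, Y w])) ! 2) 1 \<noteq> 2"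
      if halt: "fst ((step M ^^ t) (start_config M [w, Y w])) = num_states M"
    proof -
      obtain u us where u: "(step M ^^ u) (start_config M [w, Y w]) = (num_states M, us)"
          "fst (us ! 2) = tape_of [R w (Y w)]"
        using decider by blast
      have "(step M ^^ t) (start_config M [w, Y w]) = (step M ^^ u) (start_config M [w, Y w])"
        using halt u by (intro halted_unique) auto
      then show ?thesis using u Y by (simp add: tape_of_def)
    qed
    show "length (Y w) \<le> i \<or> fst (snd ((step U ^^ t) (start_config U [w])) ! 1) (Suc i) \<noteq> 0"
      if halt: "fst ((step U ^^ t) (start_config U [w])) = num_states U"
    proof -
      obtain u us where u: "(step U ^^ u) (start_config U [w]) = (num_states U, us)"
          "fst (us ! 1) = tape_of (replicate (poly p (length w)) True)"
        using counter by blast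
      have "(step U ^^ t) (start_config U [w]) = (step U ^^ u) (start_config U [w])"
        using halt u by (intro halted_unique) auto
      then show ?thesis using u Y(1)[of w] by (auto simp: tape_of_def)
    qed
  qed (use M U in auto)
  \<comment> \<open>The first summand is twice the time of the decider on solutions of admissible
    length; the others form the bound \<open>2 * t + P + 2\<close> for the clock.\<close>
  define q where "q = 2 * pcompose b ([:0, 1:] + p) + 2 * c + p + 2"
  have q: "poly q n = 2 * poly b (n + poly p n) + 2 * poly c n + poly p n + 2" for n
    by (simp add: q_def poly_pcompose)
  define f where "f = (\<lambda>x. enc_instance (query x (poly q (length x))))"
  have "many_one_reducible (bounded_search R p) (HCS (search_sentence M U))"
    unfolding many_one_reducible_def
  proof (intro exI[of _ f] exI[of _ "\<lambda>x. decode"] conjI allI impI)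
    show "polytime 1 (\<lambda>ws. f (ws ! 0))"
      unfolding f_def by (rule polytime_query)
    show "polytime 2 (\<lambda>ws. decode (ws ! 1))" by (rule polytime_decode)
    show "\<exists>v. HCS (search_sentence M U) (f x) v" for x
      unfolding f_def by (rule query_solvable)
    fix x v
    assume v: "HCS (search_sentence M U) (f x) v"
    obtain t ts where t: "t \<le> poly c (length x)" "(step U ^^ t) (start_config U [x]) = (num_states U, ts)"
        "fst (ts ! 1) = tape_of (replicate (poly p (length x)) True)"
      using counter by blast
    have "length (decode v) \<le> poly p (length x) \<and> R x (decode v)"
    proof (rule solution_decodes[OF _ M(1) U(1) M(2) U(2) t(2,3) _ v[unfolded f_def]])
      show "2 * t + poly p (length x) + 2 \<le> poly q (length x)"
        using t(1) by (simp add: q)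
      fix y :: "bool list"
      assume "length y \<le> poly p (length x)"
      then have mono: "poly b (length x + length y) \<le> poly b (length x + poly p (length x))"
        by (intro poly_nat_mono) simp
      obtain u us where u: "u \<le> poly b (length x + length y)"
          "(step M ^^ u) (start_config M [x, y]) = (num_states M, us)" "fst (us ! 2) = tape_of [R x y]"
        using decider by blast
      moreover have "2 * u + 2 \<le> poly q (length x)"
        using u(1) mono by (simp add: q)
      ultimately show "\<exists>u us. 2 * u + 2 \<le> poly q (length x) \<and>
          (step M ^^ u) (start_config M [x, y]) = (num_states M, us) \<and> fst (us ! 2) = tape_of [R x y]"
        by blast
    qed
    then show "bounded_search R p x (decode v)"
      by (simp add: bounded_search_def)
  qed
  then show ?thesis
    using search_sentence_closed search_sentence_universal consistent_search_sentence by blast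
qed

end
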